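(* There is a countable linear ordering with Scott sentence complexity $\Sigma^{\mathrm{in}}_5$.
   Context: Infinitary formulas: $\Sigma^{\mathrm{in}}_0=\Pi^{\mathrm{in}}_0$ are the finitary quantifier-free formulas; for $\alpha\ge1$, a $\Sigma^{\mathrm{in}}_\alpha$ formula is a countable disjunction of formulas $\exists\bar x\,\varphi$ with $\varphi\in\Pi^{\mathrm{in}}_\beta$, $\beta<\alpha$, and $\Pi^{\mathrm{in}}_\alpha$ is dual; $d\text{-}\Sigma^{\mathrm{in}}_\alpha$ formulas are conjunctions of a $\Sigma^{\mathrm{in}}_\alpha$ and a $\Pi^{\mathrm{in}}_\alpha$ formula. A Scott sentence of a countable structure is an $L_{\omega_1\omega}$ sentence whose countable models are exactly its isomorphic copies. The Scott sentence complexity of a structure is the least class among $\Pi^{\mathrm{in}}_\alpha,\Sigma^{\mathrm{in}}_\alpha,d\text{-}\Sigma^{\mathrm{in}}_\alpha$ ($\alpha\ge1$) in which it has a Scott sentence, classes ordered by inclusion up to equivalence ($\Pi_\alpha,\Sigma_\alpha\subseteq d\text{-}\Sigma_\alpha\subseteq \Sigma_{\alpha+1}\cap\Pi_{\alpha+1}$). *)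

theory Defs
  imports Complex_Main "HOL-Library.Countable_Set_Type"
begin

unbundle cardinal_syntax

section \<open>Countable ordinals\<close>

typedef omega1 = "Field (cardSuc natLeq)"
proof -
  have "infinite (Field (cardSuc natLeq))"
    using cardSuc_finite[OF natLeq_Card_order] by (simp add: Field_natLeq)
  then show ?thesis
    by (metis ex_in_conv finite.emptyI)
qed

lemma cardSuc_natLeq_Well_order: "Well_order (cardSuc natLeq)"
  by (rule cardSuc_Well_order[OF natLeq_Card_order])

instantiation omega1 :: wellorder
begin

definition less_eq_omega1 :: "omega1 \<Rightarrow> omega1 \<Rightarrow> bool" where
  "a \<le> b \<longleftrightarrow> (Rep_omega1 a, Rep_omega1 b) \<in> cardSuc natLeq"

definition less_omega1 :: "omega1 \<Rightarrow> omega1 \<Rightarrow> bool" where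
  "a < b \<longleftrightarrow> a \<le> b \<and> \<not> b \<le> (a :: omega1)"

instance
proof -
  note W = cardSuc_natLeq_Well_order[unfolded order_on_defs]
  have R: "refl_on (Field (cardSuc natLeq)) (cardSuc natLeq)"
    and T: "trans (cardSuc natLeq)" and A: "antisym (cardSuc natLeq)"
    and Tot: "total_on (Field (cardSuc natLeq)) (cardSuc natLeq)"
    and wfr: "wf (cardSuc natLeq - Id)"
    using W by auto
  have refl: "a \<le> a" for a :: omega1
    unfolding less_eq_omega1_def using R Rep_omega1[of a] by (auto simp: refl_on_def)
  have anti: "a \<le> b \<Longrightarrow> b \<le> a \<Longrightarrow> a = b" for a b :: omega1
    unfolding less_eq_omega1_def using A Rep_omega1_inject by (metis antisymD)
  have tot: "a \<le> b \<or> b \<le> a" for a b :: omega1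
    using Tot Rep_omega1[of a] Rep_omega1[of b] Rep_omega1_inject refl
    unfolding less_eq_omega1_def total_on_def by metis
  have less: "(a, b) \<in> inv_image (cardSuc natLeq - Id) Rep_omega1" if "a < b" for a b
    using that refl unfolding less_omega1_def
    by (auto simp: inv_image_def less_eq_omega1_def)
  show "OFCLASS(omega1, wellorder_class)"
  proof
    fix a b c :: omega1 and P :: "omega1 \<Rightarrow> bool"
    show "a < b \<longleftrightarrow> a \<le> b \<and> \<not> b \<le> a" by (rule less_omega1_def)
    show "a \<le> a" by (rule refl)
    show "a \<le> b \<Longrightarrow> b \<le> c \<Longrightarrow> a \<le> c"
      unfolding less_eq_omega1_def using T by (meson transD)
    show "a \<le> b \<Longrightarrow> b \<le> a \<Longrightarrow> a = b" by (rule anti)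
    show "a \<le> b \<or> b \<le> a" by (rule tot)
    assume step: "\<And>x. (\<And>y. y < x \<Longrightarrow> P y) \<Longrightarrow> P x"
    show "P a"
      using wf_inv_image[OF wfr, of Rep_omega1]
      by (induction a rule: wf_induct_rule) (use step less in blast)
  qed
qed

end

lemma omega1_no_max: "\<exists>b. a < (b :: omega1)"
proof -
  have "infinite (Field (cardSuc natLeq))"
    using cardSuc_finite[OF natLeq_Card_order] by (simp add: Field_natLeq)
  from infinite_Card_order_limit[OF cardSuc_Card_order[OF natLeq_Card_order] this Rep_omega1]
  obtain x where x: "x \<in> Field (cardSuc natLeq)" "Rep_omega1 a \<noteq> x"
    "(Rep_omega1 a, x) \<in> cardSuc natLeq"
    by blast
  then have "a \<le> Abs_omega1 x" "a \<noteq> Abs_omega1 x"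
    by (auto simp: less_eq_omega1_def Abs_omega1_inverse)
  then show ?thesis by (metis order_le_less)
qed

lemma countable_below_omega1: "countable {b. b < (a :: omega1)}"
proof -
  let ?r = "cardSuc natLeq"
  have C: "Card_order ?r" by (rule cardSuc_Card_order[OF natLeq_Card_order])
  have "|underS ?r (Rep_omega1 a)| <o ?r"
    by (rule card_of_underS[OF C Rep_omega1])
  then have "|underS ?r (Rep_omega1 a)| \<le>o natLeq"
    using cardSuc_ordLeq_ordLess[OF natLeq_Card_order card_of_Card_order] by blast
  then have cnt: "countable (underS ?r (Rep_omega1 a))"
    by (simp add: countable_card_le_natLeq)
  have "Rep_omega1 ` {b. b < a} \<subseteq> underS ?r (Rep_omega1 a)"
    by (auto simp: underS_def less_omega1_def less_eq_omega1_def)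
  then have "countable (Rep_omega1 ` {b. b < a})"
    using cnt countable_subset by blast
  then show ?thesis
    by (rule countable_image_inj_on) (simp add: inj_on_def Rep_omega1_inject)
qed

lemma uncountable_omega1: "uncountable (UNIV :: omega1 set)"
proof
  assume "countable (UNIV :: omega1 set)"
  then have "countable (range Rep_omega1)" by simp
  then have "countable (Field (cardSuc natLeq))"
    by (simp add: type_definition.Rep_range[OF type_definition_omega1])
  then have "|Field (cardSuc natLeq)| \<le>o natLeq"
    by (simp add: countable_card_le_natLeq)
  moreover have "|Field (cardSuc natLeq)| =o cardSuc natLeq"
    by (rule card_of_Field_ordIso[OF cardSuc_Card_order[OF natLeq_Card_order]])
  ultimately have "cardSuc natLeq \<le>o natLeq"
    using ordIso_ordLeq_trans ordIso_symmetric by blast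
  then show False
    using cardSuc_greater[OF natLeq_Card_order] not_ordLess_ordLeq by blast
qed

instantiation omega1 :: zero
begin
definition zero_omega1 :: omega1 where "(0 :: omega1) = (LEAST a. True)"
instance ..
end

lemma omega1_zero_le: "0 \<le> (a :: omega1)"
  unfolding zero_omega1_def by (simp add: Least_le)

definition succ_omega1 :: "omega1 \<Rightarrow> omega1" where
  "succ_omega1 a = (LEAST b. a < b)"

lemma less_succ_omega1_iff: "b < succ_omega1 a \<longleftrightarrow> b \<le> a"
  unfolding succ_omega1_def
  by (metis LeastI_ex Least_le leD leI omega1_no_max order_le_less_trans)

definition fin_ord :: "nat \<Rightarrow> omega1" where
  "fin_ord n = (succ_omega1 ^^ n) 0"

section \<open>Infinitary formulas in the language of orderings\<close>

text \<open>Variables are natural numbers. The countable connectives are indexed by an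
  arbitrary (possibly finite or empty) set of natural numbers; the values of the
  family outside the index set are irrelevant.\<close>

datatype fm =
    Eq nat nat
  | Le nat nat
  | Neg fm
  | Conj "nat set" "nat \<Rightarrow> fm"
  | Disj "nat set" "nat \<Rightarrow> fm"
  | FAll nat fm
  | FEx nat fm

primrec fv :: "fm \<Rightarrow> nat set" where
  "fv (Eq x y) = {x, y}"
| "fv (Le x y) = {x, y}"
| "fv (Neg \<phi>) = fv \<phi>"
| "fv (Conj I f) = (\<Union>i\<in>I. fv (f i))"
| "fv (Disj I f) = (\<Union>i\<in>I. fv (f i))"
| "fv (FAll x \<phi>) = fv \<phi> - {x}"
| "fv (FEx x \<phi>) = fv \<phi> - {x}"

text \<open>A structure is a universe with a binary relation on it. Every countable structure
  is isomorphic to one whose universe is a set of natural numbers.\<close>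

type_synonym struc = "nat set \<times> nat rel"

definition is_struc :: "struc \<Rightarrow> bool" where
  "is_struc M \<longleftrightarrow> fst M \<noteq> {} \<and> snd M \<subseteq> fst M \<times> fst M"

primrec sat :: "struc \<Rightarrow> fm \<Rightarrow> (nat \<Rightarrow> nat) \<Rightarrow> bool" where
  "sat M (Eq x y) e \<longleftrightarrow> e x = e y"
| "sat M (Le x y) e \<longleftrightarrow> (e x, e y) \<in> snd M"
| "sat M (Neg \<phi>) e \<longleftrightarrow> \<not> sat M \<phi> e"
| "sat M (Conj I f) e \<longleftrightarrow> (\<forall>i\<in>I. sat M (f i) e)"
| "sat M (Disj I f) e \<longleftrightarrow> (\<exists>i\<in>I. sat M (f i) e)"
| "sat M (FAll x \<phi>) e \<longleftrightarrow> (\<forall>a\<in>fst M. sat M \<phi> (e(x := a)))"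
| "sat M (FEx x \<phi>) e \<longleftrightarrow> (\<exists>a\<in>fst M. sat M \<phi> (e(x := a)))"

definition fm_equiv :: "fm \<Rightarrow> fm \<Rightarrow> bool" where
  "fm_equiv \<phi> \<psi> \<longleftrightarrow>
    (\<forall>M e. is_struc M \<longrightarrow> range e \<subseteq> fst M \<longrightarrow> sat M \<phi> e = sat M \<psi> e)"

inductive fin_qf :: "fm \<Rightarrow> bool" where
  "fin_qf (Eq x y)"
| "fin_qf (Le x y)"
| "fin_qf \<phi> \<Longrightarrow> fin_qf (Neg \<phi>)"
| "finite I \<Longrightarrow> (\<And>i. i \<in> I \<Longrightarrow> fin_qf (f i)) \<Longrightarrow> fin_qf (Conj I f)"
| "finite I \<Longrightarrow> (\<And>i. i \<in> I \<Longrightarrow> fin_qf (f i)) \<Longrightarrow> fin_qf (Disj I f)"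

inductive is_Sigma :: "omega1 \<Rightarrow> fm \<Rightarrow> bool" and is_Pi :: "omega1 \<Rightarrow> fm \<Rightarrow> bool" where
  "fin_qf \<phi> \<Longrightarrow> is_Sigma 0 \<phi>"
| "fin_qf \<phi> \<Longrightarrow> is_Pi 0 \<phi>"
| "0 < \<alpha> \<Longrightarrow>
    (\<And>i. i \<in> I \<Longrightarrow> \<exists>xs \<beta> \<psi>. \<beta> < \<alpha> \<and> is_Pi \<beta> \<psi> \<and> f i = foldr FEx xs \<psi>) \<Longrightarrow>
    is_Sigma \<alpha> (Disj I f)"
| "0 < \<alpha> \<Longrightarrow>
    (\<And>i. i \<in> I \<Longrightarrow> \<exists>xs \<beta> \<psi>. \<beta> < \<alpha> \<and> is_Sigma \<beta> \<psi> \<and> f i = foldr FAll xs \<psi>) \<Longrightarrow>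
    is_Pi \<alpha> (Conj I f)"

text \<open>As usual for \<open>L\<^bsub>\<omega>\<^sub>1\<omega>\<^esub>\<close>, only formulas with finitely many free variables are admitted;
  the same then holds for all their subformulas in these classes.\<close>

definition Sigma_in :: "omega1 \<Rightarrow> fm set" where
  "Sigma_in \<alpha> = {\<phi>. is_Sigma \<alpha> \<phi> \<and> finite (fv \<phi>)}"

definition Pi_in :: "omega1 \<Rightarrow> fm set" where
  "Pi_in \<alpha> = {\<phi>. is_Pi \<alpha> \<phi> \<and> finite (fv \<phi>)}"

definition dSigma_in :: "omega1 \<Rightarrow> fm set" where
  "dSigma_in \<alpha> = {Conj {0, 1} f | f. f 0 \<in> Sigma_in \<alpha> \<and> f 1 \<in> Pi_in \<alpha>}"

definition complexity_classes :: "fm set set" where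
  "complexity_classes = (\<Union>\<alpha>\<in>{0<..}. {Pi_in \<alpha>, Sigma_in \<alpha>, dSigma_in \<alpha>})"

definition class_le :: "fm set \<Rightarrow> fm set \<Rightarrow> bool" where
  "class_le \<Gamma> \<Delta> \<longleftrightarrow> (\<forall>\<phi>\<in>\<Gamma>. \<exists>\<psi>\<in>\<Delta>. fm_equiv \<phi> \<psi>)"

section \<open>Scott sentences and Scott sentence complexity\<close>

definition models :: "struc \<Rightarrow> fm \<Rightarrow> bool" where
  "models M \<phi> \<longleftrightarrow> (\<forall>e. range e \<subseteq> fst M \<longrightarrow> sat M \<phi> e)"

definition struc_iso :: "struc \<Rightarrow> struc \<Rightarrow> bool" where
  "struc_iso M N \<longleftrightarrow> (\<exists>h. bij_betw h (fst M) (fst N) \<and>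
    (\<forall>x\<in>fst M. \<forall>y\<in>fst M. (x, y) \<in> snd M \<longleftrightarrow> (h x, h y) \<in> snd N))"

definition scott_sentence :: "struc \<Rightarrow> fm \<Rightarrow> bool" where
  "scott_sentence M \<phi> \<longleftrightarrow>
    fv \<phi> = {} \<and> (\<forall>N. is_struc N \<longrightarrow> (models N \<phi> \<longleftrightarrow> struc_iso M N))"

definition scott_sentence_complexity :: "struc \<Rightarrow> fm set \<Rightarrow> bool" where
  "scott_sentence_complexity M \<Gamma> \<longleftrightarrow>
    \<Gamma> \<in> complexity_classes \<and> (\<exists>\<phi>\<in>\<Gamma>. scott_sentence M \<phi>) \<and>
    (\<forall>\<Delta>\<in>complexity_classes. (\<exists>\<phi>\<in>\<Delta>. scott_sentence M \<phi>) \<longrightarrow> class_le \<Gamma> \<Delta>)"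

end

theory Submission
  imports Defs "HOL-Library.Product_Lexorder"
begin

text \<open>Let \<open>T\<close> be the shuffle of all finite nonempty orders, \<open>L = T + \<omega>\<cdot>(1 + \<eta>)\<close> and \<open>N = T + \<omega>\<cdot>\<eta>\<close>.
  Once the first element \<open>a\<close> of the first infinite block is named, \<open>L\<close> has a \<open>\<Pi>\<^sub>4\<close> Scott sentence,
  because below \<open>a\<close> the finite blocks and above \<open>a\<close> the \<open>\<omega>\<close>-blocks are pinned down by \<open>\<Sigma>\<^sub>3\<close> formulas;
  quantifying \<open>a\<close> away gives \<open>\<Sigma>\<^sub>5\<close>. There is no \<open>\<Pi>\<^sub>5\<close> Scott sentence: long finite blocks of \<open>T\<close>
  approximate \<open>\<omega>\<close>-blocks so well that adding further \<open>\<omega>\<close>-blocks right above \<open>T\<close> is elementary for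
  \<open>\<Sigma>\<^sub>3\<close> formulas. As \<open>N\<close> is the union of a chain of copies of \<open>L\<close> arising in this way, it satisfies
  all \<open>\<Pi>\<^sub>5\<close> sentences true in \<open>L\<close>, but it has no first infinite block.\<close>

section \<open>Definability in the finite levels of the hierarchy\<close>

text \<open>The level 5 splits as 3 + 2. With parameters in \<open>LO q\<close>,
  \<open>\<Pi>\<^sub>3\<close> formulas pass from \<open>LO q\<close> up to \<open>LO_lim\<close>.
  The chain pays for one universal and one existential block of quantifiers on top: finitely many
  points of \<open>LO_lim\<close> lie in some \<open>LO q\<close>, and this copy of
  \<open>LO 1\<close> also contains the witnesses. All orders are sets of pairs of a rational and a
  natural number, ordered lexicographically, so that the chain consists of literal inclusions and
  scaling the positive indices gives the isomorphisms.

  The shuffle serves both halves of the argument. As every block size is dense, long finite blocks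
  are available above any finite part of \<open>T\<close>, and a back-and-forth argument determines
  the order up to isomorphism.

  Excluding \<open>\<Pi>\<^sub>5\<close> is enough for minimality: a sentence in any class that is
  not above \<open>\<Sigma>\<^sub>5\<close> is equivalent to a \<open>\<Pi>\<^sub>5\<close>
  sentence.\<close>

lemma less_fin_ord_Suc_iff: "b < fin_ord (Suc k) \<longleftrightarrow> b \<le> fin_ord k"
  by (simp add: fin_ord_def less_succ_omega1_iff)

lemma fin_ord_0 [simp]: "fin_ord 0 = 0"
  by (simp add: fin_ord_def)

lemma fin_ord_less_Suc: "fin_ord k < fin_ord (Suc k)"
  by (simp add: less_fin_ord_Suc_iff)

lemma fin_ord_Suc_pos: "0 < fin_ord (Suc k)"
  by (simp add: less_fin_ord_Suc_iff omega1_zero_le)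

lemma is_Pi_fin_ord_SucE:
  assumes "is_Pi (fin_ord (Suc k)) \<phi>"
  obtains I f where "\<phi> = Conj I f"
    "\<And>i. i \<in> I \<Longrightarrow> \<exists>xs \<beta> \<psi>. \<beta> < fin_ord (Suc k) \<and> is_Sigma \<beta> \<psi> \<and> f i = foldr FAll xs \<psi>"
  using assms fin_ord_Suc_pos[of k] by (cases rule: is_Pi.cases) auto

text \<open>A quantifier prefix amounts to one simultaneous choice \<open>g\<close> of values, of
  which only those on \<open>xs\<close> are read.\<close>

lemma sat_foldr_FAll:
  "sat M (foldr FAll xs \<psi>) e \<longleftrightarrow>
    (\<forall>g. range g \<subseteq> fst M \<longrightarrow> sat M \<psi> (override_on e g (set xs)))" if "fst M \<noteq> {}"
proof (induction xs arbitrary: e)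
  case Nil
  then show ?case using that by (auto simp: image_subset_iff)
next
  case (Cons x xs)
  have *: "override_on e g (set (x # xs)) = override_on (e(x := g x)) g (set xs)" for g
    by (auto simp: override_on_def fun_eq_iff)
  show ?case
  proof
    assume S: "sat M (foldr FAll (x # xs) \<psi>) e"
    have "sat M (foldr FAll xs \<psi>) (e(x := g x))" if "range g \<subseteq> fst M" for g
      using S that by auto
    then show "\<forall>g. range g \<subseteq> fst M \<longrightarrow> sat M \<psi> (override_on e g (set (x # xs)))"
      unfolding * using Cons.IH by blast
  next
    assume R: "\<forall>g. range g \<subseteq> fst M \<longrightarrow> sat M \<psi> (override_on e g (set (x # xs)))"
    have "sat M \<psi> (override_on (e(x := a)) g (set xs))"
      if "a \<in> fst M" "range g \<subseteq> fst M" for a g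
    proof -
      \<comment> \<open>If \<open>x\<close> occurs again in \<open>xs\<close>, the inner quantifier
        hides the value \<open>a\<close>, so \<open>g\<close> must stay as it is.\<close>
      have "range (if x \<in> set xs then g else g(x := a)) \<subseteq> fst M" using that by auto
      moreover have "override_on e (if x \<in> set xs then g else g(x := a)) (set (x # xs))
         = override_on (e(x := a)) g (set xs)"
        by (auto simp: override_on_def fun_eq_iff)
      ultimately show ?thesis using R by metis
    qed
    then have "sat M (foldr FAll xs \<psi>) (e(x := a))" if "a \<in> fst M" for a
      using that Cons.IH by blast
    then show "sat M (foldr FAll (x # xs) \<psi>) e" by simp
  qed
qed

lemma sat_foldr_FEx:
  "sat M (foldr FEx xs \<psi>) e \<longleftrightarrow> \<not> sat M (foldr FAll xs (Neg \<psi>)) e"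
  by (induction xs arbitrary: e) auto

lemma fv_foldr [simp]:
  "fv (foldr FEx xs \<psi>) = fv \<psi> - set xs" "fv (foldr FAll xs \<psi>) = fv \<psi> - set xs"
  by (induction xs) auto

text \<open>Complexity is attached to semantic predicates, so that closure properties hold although
  the syntactic classes are closed under connectives only up to equivalence. The set
  \<open>F\<close> bounds the free variables; it shrinks with each quantifier until a sentence is
  left.\<close>

definition sdef :: "nat \<Rightarrow> nat set \<Rightarrow> (struc \<Rightarrow> (nat \<Rightarrow> nat) \<Rightarrow> bool) \<Rightarrow> bool" where
  "sdef k F P \<longleftrightarrow>
    (\<exists>\<phi>. is_Sigma (fin_ord k) \<phi> \<and> fv \<phi> \<subseteq> F \<and> (\<forall>M e. sat M \<phi> e = P M e))"

definition pdef :: "nat \<Rightarrow> nat set \<Rightarrow> (struc \<Rightarrow> (nat \<Rightarrow> nat) \<Rightarrow> bool) \<Rightarrow> bool" where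
  "pdef k F P \<longleftrightarrow>
    (\<exists>\<phi>. is_Pi (fin_ord k) \<phi> \<and> fv \<phi> \<subseteq> F \<and> (\<forall>M e. sat M \<phi> e = P M e))"

lemma is_Sigma_0_iff: "is_Sigma 0 \<phi> \<longleftrightarrow> fin_qf \<phi>"
  by (auto elim: is_Sigma.cases intro: is_Sigma_is_Pi.intros)

lemma is_Pi_0_iff: "is_Pi 0 \<phi> \<longleftrightarrow> fin_qf \<phi>"
  by (auto elim: is_Pi.cases intro: is_Sigma_is_Pi.intros)

text \<open>Negation is pushed inwards by a simultaneous induction that keeps variables and
  prefixes; \<open>Neg\<close> is added at level 0 only. Closure facts for \<open>sdef\<close>
  thereby follow from those for \<open>pdef\<close>.\<close>

lemma is_Sigma_is_Pi_dual:
  "is_Sigma \<alpha> \<phi> \<Longrightarrow> \<exists>\<psi>. is_Pi \<alpha> \<psi> \<and> fv \<psi> = fv \<phi> \<and> (\<forall>M e. sat M \<psi> e = (\<not> sat M \<phi> e))"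
  "is_Pi \<alpha> \<phi> \<Longrightarrow> \<exists>\<psi>. is_Sigma \<alpha> \<psi> \<and> fv \<psi> = fv \<phi> \<and> (\<forall>M e. sat M \<psi> e = (\<not> sat M \<phi> e))"
proof (induction rule: is_Sigma_is_Pi.inducts)
  case (1 \<phi>)
  then show ?case
    by (intro exI[of _ "Neg \<phi>"]) (auto simp: is_Pi_0_iff intro: fin_qf.intros)
next
  case (2 \<phi>)
  then show ?case
    by (intro exI[of _ "Neg \<phi>"]) (auto simp: is_Sigma_0_iff intro: fin_qf.intros)
next
  case (3 \<alpha> I f)
  have "\<forall>i\<in>I. \<exists>\<chi>. (\<exists>xs \<beta> \<psi>. \<beta> < \<alpha> \<and> is_Sigma \<beta> \<psi> \<and> \<chi> = foldr FAll xs \<psi>) \<and>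
      fv \<chi> = fv (f i) \<and> (\<forall>M e. sat M \<chi> e = (\<not> sat M (f i) e))"
  proof
    fix i assume "i \<in> I"
    then obtain xs \<beta> \<psi> \<psi>' where "\<beta> < \<alpha>" "f i = foldr FEx xs \<psi>" "is_Sigma \<beta> \<psi>'"
      "fv \<psi>' = fv \<psi>" and s: "\<And>M e. sat M \<psi>' e = (\<not> sat M \<psi> e)"
      using 3(2) by blast
    moreover have "sat M (foldr FAll xs \<psi>') e = (\<not> sat M (foldr FEx xs \<psi>) e)" for M e
      by (induction xs arbitrary: e) (auto simp: s)
    ultimately show "\<exists>\<chi>. (\<exists>xs \<beta> \<psi>. \<beta> < \<alpha> \<and> is_Sigma \<beta> \<psi> \<and> \<chi> = foldr FAll xs \<psi>) \<and>
      fv \<chi> = fv (f i) \<and> (\<forall>M e. sat M \<chi> e = (\<not> sat M (f i) e))"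
      by (intro exI[of _ "foldr FAll xs \<psi>'"]) auto
  qed
  then obtain g where g: "\<And>i. i \<in> I \<Longrightarrow> (\<exists>xs \<beta> \<psi>. \<beta> < \<alpha> \<and> is_Sigma \<beta> \<psi> \<and> g i = foldr FAll xs \<psi>) \<and>
      fv (g i) = fv (f i) \<and> (\<forall>M e. sat M (g i) e = (\<not> sat M (f i) e))"
    by metis
  have "is_Pi \<alpha> (Conj I g)" using 3(1) g by (auto intro!: is_Sigma_is_Pi.intros(4))
  then show ?case using g by (intro exI[of _ "Conj I g"]) auto
next
  case (4 \<alpha> I f)
  have "\<forall>i\<in>I. \<exists>\<chi>. (\<exists>xs \<beta> \<psi>. \<beta> < \<alpha> \<and> is_Pi \<beta> \<psi> \<and> \<chi> = foldr FEx xs \<psi>) \<and>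
      fv \<chi> = fv (f i) \<and> (\<forall>M e. sat M \<chi> e = (\<not> sat M (f i) e))"
  proof
    fix i assume "i \<in> I"
    then obtain xs \<beta> \<psi> \<psi>' where "\<beta> < \<alpha>" "f i = foldr FAll xs \<psi>" "is_Pi \<beta> \<psi>'"
      "fv \<psi>' = fv \<psi>" and s: "\<And>M e. sat M \<psi>' e = (\<not> sat M \<psi> e)"
      using 4(2) by blast
    moreover have "sat M (foldr FEx xs \<psi>') e = (\<not> sat M (foldr FAll xs \<psi>) e)" for M e
      by (induction xs arbitrary: e) (auto simp: s)
    ultimately show "\<exists>\<chi>. (\<exists>xs \<beta> \<psi>. \<beta> < \<alpha> \<and> is_Pi \<beta> \<psi> \<and> \<chi> = foldr FEx xs \<psi>) \<and>
      fv \<chi> = fv (f i) \<and> (\<forall>M e. sat M \<chi> e = (\<not> sat M (f i) e))"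
      by (intro exI[of _ "foldr FEx xs \<psi>'"]) auto
  qed
  then obtain g where g: "\<And>i. i \<in> I \<Longrightarrow> (\<exists>xs \<beta> \<psi>. \<beta> < \<alpha> \<and> is_Pi \<beta> \<psi> \<and> g i = foldr FEx xs \<psi>) \<and>
      fv (g i) = fv (f i) \<and> (\<forall>M e. sat M (g i) e = (\<not> sat M (f i) e))"
    by metis
  have "is_Sigma \<alpha> (Disj I g)" using 4(1) g by (auto intro!: is_Sigma_is_Pi.intros(3))
  then show ?case using g by (intro exI[of _ "Disj I g"]) auto
qed

lemma pdef_Not_iff: "pdef k F (\<lambda>M e. \<not> P M e) \<longleftrightarrow> sdef k F P"
proof
  assume "pdef k F (\<lambda>M e. \<not> P M e)"
  then obtain \<phi> where "is_Pi (fin_ord k) \<phi>" "fv \<phi> \<subseteq> F" "\<forall>M e. sat M \<phi> e = (\<not> P M e)"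
    by (auto simp: pdef_def)
  moreover from is_Sigma_is_Pi_dual(2)[OF this(1)] obtain \<psi> where
    "is_Sigma (fin_ord k) \<psi>" "fv \<psi> = fv \<phi>" "\<forall>M e. sat M \<psi> e = (\<not> sat M \<phi> e)"
    by blast
  ultimately show "sdef k F P" unfolding sdef_def by (intro exI[of _ \<psi>]) simp
next
  assume "sdef k F P"
  then obtain \<phi> where "is_Sigma (fin_ord k) \<phi>" "fv \<phi> \<subseteq> F" "\<forall>M e. sat M \<phi> e = P M e"
    by (auto simp: sdef_def)
  moreover from is_Sigma_is_Pi_dual(1)[OF this(1)] obtain \<psi> where
    "is_Pi (fin_ord k) \<psi>" "fv \<psi> = fv \<phi>" "\<forall>M e. sat M \<psi> e = (\<not> sat M \<phi> e)"
    by blast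
  ultimately show "pdef k F (\<lambda>M e. \<not> P M e)" unfolding pdef_def by (intro exI[of _ \<psi>]) simp
qed

lemma sdef_Not_iff: "sdef k F (\<lambda>M e. \<not> P M e) \<longleftrightarrow> pdef k F P"
  using pdef_Not_iff[of k F "\<lambda>M e. \<not> P M e"] by simp

lemma pdef_cong: "pdef k F P \<Longrightarrow> (\<And>M e. P M e = Q M e) \<Longrightarrow> pdef k F Q"
  by (simp add: pdef_def)

lemma sdef_cong: "sdef k F P \<Longrightarrow> (\<And>M e. P M e = Q M e) \<Longrightarrow> sdef k F Q"
  by (simp add: sdef_def)

lemma sdef_imp_pdef_Suc:
  assumes "sdef k F P" shows "pdef (Suc k) F P"
proof -
  obtain \<phi> where \<phi>: "is_Sigma (fin_ord k) \<phi>" "fv \<phi> \<subseteq> F" "\<And>M e. sat M \<phi> e = P M e"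
    using assms by (auto simp: sdef_def)
  have "is_Pi (fin_ord (Suc k)) (Conj {0} (\<lambda>_. \<phi>))"
    by (rule is_Sigma_is_Pi.intros(4)[OF fin_ord_Suc_pos], rule exI[of _ "[]"])
      (use \<phi>(1) fin_ord_less_Suc in auto)
  then show ?thesis unfolding pdef_def using \<phi> by (intro exI[of _ "Conj {0} (\<lambda>_. \<phi>)"]) auto
qed

lemma pdef_imp_sdef_Suc: "pdef k F P \<Longrightarrow> sdef (Suc k) F P"
  using sdef_imp_pdef_Suc[of k F "\<lambda>M e. \<not> P M e"] by (simp add: pdef_Not_iff sdef_Not_iff)

lemma sdef_0_iff: "sdef 0 F P \<longleftrightarrow> pdef 0 F P"
  by (simp add: sdef_def pdef_def is_Sigma_0_iff is_Pi_0_iff)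

text \<open>At a positive level the formula itself serves, as the bound on its components only gets
  weaker. A formula of level 0 need not be a conjunction and is wrapped into one.\<close>

lemma pdef_SucI:
  assumes "pdef k F P" shows "pdef (Suc k) F P"
proof (cases k)
  case 0
  then show ?thesis using assms sdef_imp_pdef_Suc sdef_0_iff by simp
next
  case (Suc j)
  obtain \<phi> where \<phi>: "is_Pi (fin_ord k) \<phi>" "fv \<phi> \<subseteq> F" "\<And>M e. sat M \<phi> e = P M e"
    using assms by (auto simp: pdef_def)
  from \<phi>(1)[unfolded Suc] obtain I f where If: "\<phi> = Conj I f"
    "\<And>i. i \<in> I \<Longrightarrow> \<exists>xs \<beta> \<psi>. \<beta> < fin_ord k \<and> is_Sigma \<beta> \<psi> \<and> f i = foldr FAll xs \<psi>"
    by (rule is_Pi_fin_ord_SucE) (use Suc in blast)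
  have "is_Pi (fin_ord (Suc k)) \<phi>"
    unfolding If(1)
    by (rule is_Sigma_is_Pi.intros(4)[OF fin_ord_Suc_pos])
      (use If(2) order.strict_trans[OF _ fin_ord_less_Suc] in blast)
  then show ?thesis using \<phi> by (auto simp: pdef_def)
qed

lemma sdef_SucI: "sdef k F P \<Longrightarrow> sdef (Suc k) F P"
  using pdef_SucI[of k F "\<lambda>M e. \<not> P M e"] by (simp add: pdef_Not_iff)

lemma pdef_INF:
  assumes "\<And>i::nat. pdef (Suc k) F (P i)"
  shows "pdef (Suc k) F (\<lambda>M e. \<forall>i. P i M e)"
proof -
  obtain \<phi> where \<phi>: "\<And>i. is_Pi (fin_ord (Suc k)) (\<phi> i)" "\<And>i. fv (\<phi> i) \<subseteq> F"
    "\<And>i M e. sat M (\<phi> i) e = P i M e"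
    using assms unfolding pdef_def by metis
  have "\<forall>i. \<exists>I f. \<phi> i = Conj I f \<and>
     (\<forall>j\<in>I. \<exists>xs \<beta> \<psi>. \<beta> < fin_ord (Suc k) \<and> is_Sigma \<beta> \<psi> \<and> f j = foldr FAll xs \<psi>)"
    using \<phi>(1) is_Pi_fin_ord_SucE by metis
  then obtain I f where If: "\<And>i. \<phi> i = Conj (I i) (f i)"
     "\<And>i j. j \<in> I i \<Longrightarrow> \<exists>xs \<beta> \<psi>. \<beta> < fin_ord (Suc k) \<and> is_Sigma \<beta> \<psi> \<and> f i j = foldr FAll xs \<psi>"
    by metis
  \<comment> \<open>Each conjunct must be a prefix over a formula of smaller level, so the nested
    conjunctions are flattened by the pairing function.\<close>
  define J where "J = prod_encode ` (SIGMA i:UNIV. I i)"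
  define g where "g n = (case prod_decode n of (i, j) \<Rightarrow> f i j)" for n
  have "is_Pi (fin_ord (Suc k)) (Conj J g)"
    using If(2) by (auto intro!: is_Sigma_is_Pi.intros(4) fin_ord_Suc_pos simp: J_def g_def)
  moreover have "fv (Conj J g) \<subseteq> F"
    using \<phi>(2) by (force simp: J_def g_def If)
  moreover have "sat M (Conj J g) e = (\<forall>i. P i M e)" for M e
    by (auto simp: J_def g_def If \<phi>(3)[symmetric])
  ultimately show ?thesis unfolding pdef_def by blast
qed

lemma sdef_SUP:
  assumes "\<And>i::nat. sdef (Suc k) F (P i)"
  shows "sdef (Suc k) F (\<lambda>M e. \<exists>i. P i M e)"
  unfolding pdef_Not_iff[symmetric] not_ex
  by (rule pdef_INF) (use assms in \<open>simp add: pdef_Not_iff\<close>)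

lemma pdef_conj:
  assumes "pdef k F P" "pdef k F Q"
  shows "pdef k F (\<lambda>M e. P M e \<and> Q M e)"
proof (cases k)
  case 0
  obtain \<phi> \<psi> where "fin_qf \<phi>" "fv \<phi> \<subseteq> F" "\<And>M e. sat M \<phi> e = P M e"
    "fin_qf \<psi>" "fv \<psi> \<subseteq> F" "\<And>M e. sat M \<psi> e = Q M e"
    using assms 0 unfolding pdef_def by (auto simp: is_Pi_0_iff)
  then show ?thesis unfolding pdef_def 0
    by (intro exI[of _ "Conj {0,1::nat} (\<lambda>i. if i = 0 then \<phi> else \<psi>)"])
      (auto simp: is_Pi_0_iff intro!: fin_qf.intros)
next
  case (Suc j)
  \<comment> \<open>A binary conjunction is an infinite one with a single exceptional member, so the
    flattening above can be reused.\<close>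
  have "pdef (Suc j) F (\<lambda>M e. \<forall>i::nat. (if i = 0 then P else Q) M e)"
    by (rule pdef_INF) (use assms Suc in auto)
  then show ?thesis unfolding Suc
    by (rule pdef_cong) (force split: if_splits)
qed

lemma sdef_disj:
  assumes "sdef k F P" "sdef k F Q"
  shows "sdef k F (\<lambda>M e. P M e \<or> Q M e)"
  unfolding pdef_Not_iff[symmetric] de_Morgan_disj
  by (rule pdef_conj) (use assms in \<open>simp_all add: pdef_Not_iff\<close>)

text \<open>The quantifier distributes over the outer conjunction and joins the prefix of each
  conjunct, so the level does not rise.\<close>

lemma pdef_ball:
  assumes "pdef (Suc k) (insert x F) P"
  shows "pdef (Suc k) F (\<lambda>M e. \<forall>a\<in>fst M. P M (e(x := a)))"
proof -
  obtain \<phi> where \<phi>: "is_Pi (fin_ord (Suc k)) \<phi>" "fv \<phi> \<subseteq> insert x F" "\<And>M e. sat M \<phi> e = P M e"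
    using assms by (auto simp: pdef_def)
  from \<phi>(1) obtain I f where If: "\<phi> = Conj I f"
    "\<And>i. i \<in> I \<Longrightarrow> \<exists>xs \<beta> \<psi>. \<beta> < fin_ord (Suc k) \<and> is_Sigma \<beta> \<psi> \<and> f i = foldr FAll xs \<psi>"
    by (rule is_Pi_fin_ord_SucE) blast
  have "\<exists>xs \<beta> \<psi>. \<beta> < fin_ord (Suc k) \<and> is_Sigma \<beta> \<psi> \<and> FAll x (f i) = foldr FAll xs \<psi>"
    if i: "i \<in> I" for i
  proof -
    obtain xs \<beta> \<psi> where "\<beta> < fin_ord (Suc k)" "is_Sigma \<beta> \<psi>" "f i = foldr FAll xs \<psi>"
      using If(2)[OF i] by blast
    then show ?thesis by (intro exI[of _ "x # xs"] exI[of _ \<beta>] exI[of _ \<psi>]) simp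
  qed
  then have "is_Pi (fin_ord (Suc k)) (Conj I (\<lambda>i. FAll x (f i)))"
    by (auto intro!: is_Sigma_is_Pi.intros(4) fin_ord_Suc_pos)
  moreover have "fv (Conj I (\<lambda>i. FAll x (f i))) \<subseteq> F" using \<phi>(2) If(1) by auto
  moreover have "sat M (Conj I (\<lambda>i. FAll x (f i))) e = (\<forall>a\<in>fst M. P M (e(x := a)))" for M e
    by (auto simp: \<phi>(3)[symmetric] If(1))
  ultimately show ?thesis unfolding pdef_def by blast
qed

lemma sdef_bex:
  assumes "sdef (Suc k) (insert x F) P"
  shows "sdef (Suc k) F (\<lambda>M e. \<exists>a\<in>fst M. P M (e(x := a)))"
  unfolding pdef_Not_iff[symmetric] bex_simps
  using pdef_ball[of k x F "\<lambda>M e. \<not> P M e"] assms by (simp only: pdef_Not_iff)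

lemma pdef_Eq: "x \<in> F \<Longrightarrow> y \<in> F \<Longrightarrow> pdef 0 F (\<lambda>M e. e x = e y)"
  unfolding pdef_def by (intro exI[of _ "Eq x y"]) (auto simp: is_Pi_0_iff intro: fin_qf.intros)

lemma pdef_Le: "x \<in> F \<Longrightarrow> y \<in> F \<Longrightarrow> pdef 0 F (\<lambda>M e. (e x, e y) \<in> snd M)"
  unfolding pdef_def by (intro exI[of _ "Le x y"]) (auto simp: is_Pi_0_iff intro: fin_qf.intros)

section \<open>Back-and-forth relations\<close>

text \<open>The usual relation \<open>(X, x) \<le>\<^sub>k (Y, y)\<close>, with the pair of tuples \<open>x\<close>, \<open>y\<close> given as the
  set \<open>p\<close> of pairs of corresponding entries.\<close>

primrec bf :: "nat \<Rightarrow> 'a::linorder set \<Rightarrow> 'a set \<Rightarrow> ('a \<times> 'a) set \<Rightarrow> bool" where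
  "bf 0 X Y p \<longleftrightarrow> p \<subseteq> X \<times> Y \<and> 
    (\<forall>x y x' y'. (x, y) \<in> p \<longrightarrow> (x', y') \<in> p \<longrightarrow> (x < x' \<longleftrightarrow> y < y'))"
| "bf (Suc k) X Y p \<longleftrightarrow>
    (\<forall>B. finite B \<and> B \<subseteq> Y \<longrightarrow> (\<exists>q. p\<inverse> \<subseteq> q \<and> B \<subseteq> Domain q \<and> bf k Y X q))"

lemma bf_subset: "bf k X Y p \<Longrightarrow> p' \<subseteq> p \<Longrightarrow> bf k X Y p'"
proof (induction k arbitrary: X Y p p')
  case 0
  have "(x, y) \<in> p" if "(x, y) \<in> p'" for x y using 0(2) that by blast
  then show ?case using 0(1) by simp (meson 0(2) order_trans)
next
  case (Suc k)
  have "p'\<inverse> \<subseteq> p\<inverse>" using Suc.prems(2) by auto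
  then show ?case using Suc.prems(1) unfolding bf.simps by (meson order_trans)
qed

lemma bf_imp_bf_0: "bf k X Y p \<Longrightarrow> bf 0 X Y p"
proof (induction k arbitrary: X Y p)
  case (Suc k)
  then obtain q where "p\<inverse> \<subseteq> q" "bf k Y X q" by (auto dest: spec[of _ "{}"])
  then have "bf 0 Y X (p\<inverse>)" using Suc.IH bf_subset by blast
  then have "p \<subseteq> X \<times> Y" and
    *: "\<And>x y x' y'. (y, x) \<in> p\<inverse> \<Longrightarrow> (y', x') \<in> p\<inverse> \<Longrightarrow> y < y' \<longleftrightarrow> x < x'" by auto
  then show ?case using *[OF converseI converseI] by simp
qed

text \<open>Used to replace \<open>LO q\<close> by its scaled copy \<open>LO 1\<close>.\<close>

lemma bf_image:
  assumes "bf k X Y p" "strict_mono_on X f" "strict_mono_on Y g"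
  shows "bf k (f ` X) (g ` Y) (map_prod f g ` p)"
  using assms
proof (induction k arbitrary: X Y f g p)
  case 0
  have sub: "p \<subseteq> X \<times> Y" and ord: "\<And>x y x' y'. (x, y) \<in> p \<Longrightarrow> (x', y') \<in> p \<Longrightarrow> x < x' \<longleftrightarrow> y < y'"
    using 0(1) by simp_all
  have "f x < f x' \<longleftrightarrow> g y < g y'" if "(x, y) \<in> p" "(x', y') \<in> p" for x y x' y'
    using ord[OF that] sub that strict_mono_on_less[OF 0(2)] strict_mono_on_less[OF 0(3)] by blast
  then show ?case using sub by (auto simp: map_prod_def split: prod.splits)
next
  case (Suc k)
  show ?case unfolding bf.simps
  proof (intro allI impI)
    fix B assume "finite B \<and> B \<subseteq> g ` Y"
    then obtain C where C: "C \<subseteq> Y" "finite C" "B = g ` C"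
      by (meson finite_subset_image)
    then obtain q where q: "p\<inverse> \<subseteq> q" "C \<subseteq> Domain q" "bf k Y X q"
      using Suc.prems(1) by auto
    have "bf k (g ` Y) (f ` X) (map_prod g f ` q)"
      by (rule Suc.IH[OF q(3) Suc.prems(3,2)])
    moreover have "(map_prod f g ` p)\<inverse> \<subseteq> map_prod g f ` q" using q(1) by force
    moreover have "B \<subseteq> Domain (map_prod g f ` q)" using q(2) C(3) by force
    ultimately show "\<exists>q. (map_prod f g ` p)\<inverse> \<subseteq> q \<and> B \<subseteq> Domain q \<and> bf k (g ` Y) (f ` X) q"
      by blast
  qed
qed

definition order_struc :: "'a::{countable,linorder} set \<Rightarrow> struc" where
  "order_struc X = (to_nat ` X, {(to_nat x, to_nat y) | x y. x \<in> X \<and> y \<in> X \<and> x \<le> y})"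

lemma fst_order_struc [simp]: "fst (order_struc X) = to_nat ` X"
  by (simp add: order_struc_def)

lemma order_struc_le_iff [simp]:
  "(to_nat x, to_nat y) \<in> snd (order_struc X) \<longleftrightarrow> x \<in> X \<and> y \<in> X \<and> x \<le> y"
  by (auto simp: order_struc_def)

lemma bf_0_fin_qf_sat:
  assumes "fin_qf \<phi>" "bf 0 X Y p"
    and "\<And>v. v \<in> fv \<phi> \<Longrightarrow> \<exists>(x, y)\<in>p. e v = to_nat x \<and> e' v = to_nat y"
  shows "sat (order_struc X) \<phi> e = sat (order_struc Y) \<phi> e'"
  using assms(1,3)
proof (induction rule: fin_qf.induct)
  case (1 u v)
  obtain x y x' y' where "(x, y) \<in> p" "(x', y') \<in> p" "e u = to_nat x" "e' u = to_nat y"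
    "e v = to_nat x'" "e' v = to_nat y'" using 1[of u] 1[of v] by auto
  moreover from this(1,2) assms(2) have "x < x' \<longleftrightarrow> y < y'" "x' < x \<longleftrightarrow> y' < y"
    unfolding bf.simps by blast+
  \<comment> \<open>\<open>bf 0\<close> speaks of \<open><\<close> alone; read for both orders of
    the two pairs it also yields equality, by linearity.\<close>
  moreover from this have "x = x' \<longleftrightarrow> y = y'" by (metis linorder_less_linear order.irrefl)
  ultimately show ?case by simp
next
  case (2 u v)
  obtain x y x' y' where "(x, y) \<in> p" "(x', y') \<in> p" "e u = to_nat x" "e' u = to_nat y"
    "e v = to_nat x'" "e' v = to_nat y'" using 2[of u] 2[of v] by auto
  moreover from this(1,2) assms(2) have "x < x' \<longleftrightarrow> y < y'" "x' < x \<longleftrightarrow> y' < y"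
    "x \<in> X" "y \<in> Y" "x' \<in> X" "y' \<in> Y"
    unfolding bf.simps by blast+
  ultimately show ?case by (simp add: linorder_not_less[symmetric])
next
  case (4 I f)
  then show ?case by simp blast
next
  case (5 I f)
  then show ?case by simp blast
qed auto

text \<open>Both directions are proved together, since \<open>\<Pi>\<close> formulas are built from
  \<open>\<Sigma>\<close> formulas and \<open>bf\<close> exchanges the two orders at each step. The
  components of a formula have levels that are merely bounded, hence the assumption
  \<open>\<alpha> \<le> fin_ord k\<close> instead of an equation.\<close>

lemma bf_preserves:
  assumes "bf k X Y p" "\<alpha> \<le> fin_ord k" "X \<noteq> {}" "Y \<noteq> {}"
    and "\<And>v. v \<in> fv \<phi> \<Longrightarrow> \<exists>(x, y)\<in>p. e v = to_nat x \<and> e' v = to_nat y"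
  shows "is_Pi \<alpha> \<phi> \<Longrightarrow> sat (order_struc X) \<phi> e \<Longrightarrow> sat (order_struc Y) \<phi> e'"
    and "is_Sigma \<alpha> \<phi> \<Longrightarrow> sat (order_struc Y) \<phi> e' \<Longrightarrow> sat (order_struc X) \<phi> e"
proof -
  have "(is_Pi \<alpha> \<phi> \<and> sat (order_struc X) \<phi> e \<longrightarrow> sat (order_struc Y) \<phi> e') \<and>
    (is_Sigma \<alpha> \<phi> \<and> sat (order_struc Y) \<phi> e' \<longrightarrow> sat (order_struc X) \<phi> e)"
    using assms
  proof (induction k arbitrary: X Y p \<alpha> \<phi> e e')
    case 0
    then have "\<alpha> = 0" using omega1_zero_le[of \<alpha>] by simp
    then show ?case using bf_0_fin_qf_sat[of \<phi> X Y p e e'] 0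
      by (auto simp: is_Pi_0_iff is_Sigma_0_iff)
  next
    case (Suc k)
    show ?case
    proof (cases "\<alpha> = 0")
      case True
      then show ?thesis using bf_0_fin_qf_sat[of \<phi> X Y p e e'] Suc.prems bf_imp_bf_0
        by (fastforce simp: is_Pi_0_iff is_Sigma_0_iff)
    next
      case False
      have lt: "\<beta> \<le> fin_ord k" if "\<beta> < \<alpha>" for \<beta>
        using that Suc.prems(2) less_fin_ord_Suc_iff order.strict_trans2 by blast
      \<comment> \<open>A choice of values in \<open>Y\<close> is answered in \<open>X\<close>: the
        values of the variables in \<open>xs\<close> form the finite set to which the definition of
        \<open>bf\<close> is applied.\<close>
      have key: "\<exists>g'. range g' \<subseteq> to_nat ` X \<and>
          (is_Sigma \<beta> \<psi> \<and> sat (order_struc X) \<psi> (override_on e g' (set xs)) \<longrightarrow>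
             sat (order_struc Y) \<psi> (override_on e' g (set xs))) \<and>
          (is_Pi \<beta> \<psi> \<and> sat (order_struc Y) \<psi> (override_on e' g (set xs)) \<longrightarrow>
             sat (order_struc X) \<psi> (override_on e g' (set xs)))"
        if \<beta>: "\<beta> < \<alpha>" and fv: "fv \<psi> - set xs \<subseteq> fv \<phi>" and g: "range g \<subseteq> to_nat ` Y"
        for \<beta> \<psi> xs g
      proof -
        define G where "G v = (from_nat (g v) :: 'a)" for v
        have G: "g v = to_nat (G v)" "G v \<in> Y" for v
        proof -
          obtain y where "y \<in> Y" "g v = to_nat y" using g by blast
          then show "g v = to_nat (G v)" "G v \<in> Y" by (simp_all add: G_def)
        qed
        obtain q where q: "p\<inverse> \<subseteq> q" "G ` set xs \<subseteq> Domain q" "bf k Y X q"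
          using Suc.prems(1)[unfolded bf.simps, rule_format, of "G ` set xs"] G(2) by blast
        \<comment> \<open>Assignments are total, so variables outside the prefix receive some value
          in \<open>X\<close> too.\<close>
        have "\<exists>x\<in>X. v \<in> set xs \<longrightarrow> (G v, x) \<in> q" for v
          using q(2) bf_imp_bf_0[OF q(3)] \<open>X \<noteq> {}\<close> unfolding bf.simps by blast
        then obtain H where H: "\<And>v. H v \<in> X" "\<And>v. v \<in> set xs \<Longrightarrow> (G v, H v) \<in> q"
          by metis
        have "\<exists>(y, x)\<in>q. override_on e' g (set xs) v = to_nat y \<and>
            override_on e (to_nat \<circ> H) (set xs) v = to_nat x" if "v \<in> fv \<psi>" for v
        proof (cases "v \<in> set xs")
          case True
          then show ?thesis using H(2) G(1) by (auto simp: override_on_def intro!: bexI[of _ "(G v, H v)"])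
        next
          case False
          then have "v \<in> fv \<phi>" using fv that by auto
          then obtain x y where "(x, y) \<in> p" "e v = to_nat x" "e' v = to_nat y"
            using Suc.prems(5) by blast
          then show ?thesis using q(1) False by (auto simp: override_on_def intro!: bexI[of _ "(y, x)"])
        qed
        from Suc.IH[OF q(3) lt[OF \<beta>] \<open>Y \<noteq> {}\<close> \<open>X \<noteq> {}\<close> this] show ?thesis
          using H(1) by (intro exI[of _ "to_nat \<circ> H"]) auto
      qed
      have "sat (order_struc Y) \<phi> e'" if pi: "is_Pi \<alpha> \<phi>" and sX: "sat (order_struc X) \<phi> e"
      proof -
        obtain I f where If: "\<phi> = Conj I f"
          "\<And>i. i \<in> I \<Longrightarrow> \<exists>xs \<beta> \<psi>. \<beta> < \<alpha> \<and> is_Sigma \<beta> \<psi> \<and> f i = foldr FAll xs \<psi>"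
          using pi False by (cases rule: is_Pi.cases) auto
        have "sat (order_struc Y) (f i) e'" if i: "i \<in> I" for i
        proof -
          obtain xs \<beta> \<psi> where *: "\<beta> < \<alpha>" "is_Sigma \<beta> \<psi>" "f i = foldr FAll xs \<psi>"
            using If(2)[OF i] by blast
          then have "fv \<psi> - set xs \<subseteq> fv \<phi>" using If(1) i by (auto intro!: bexI[of _ i])
          moreover have "sat (order_struc X) (foldr FAll xs \<psi>) e" using sX If(1) i *(3) by auto
          ultimately have "sat (order_struc Y) \<psi> (override_on e' g (set xs))"
            if "range g \<subseteq> to_nat ` Y" for g
            using key[OF *(1) _ that, of \<psi> xs] *(2) sat_foldr_FAll[of "order_struc X" xs \<psi> e]
              \<open>X \<noteq> {}\<close> by auto
          then show ?thesis
            using *(3) sat_foldr_FAll[of "order_struc Y" xs \<psi> e'] \<open>Y \<noteq> {}\<close> by simp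
        qed
        then show ?thesis using If(1) by simp
      qed
      moreover have "sat (order_struc X) \<phi> e" if sig: "is_Sigma \<alpha> \<phi>" and sY: "sat (order_struc Y) \<phi> e'"
      proof -
        obtain I f where If: "\<phi> = Disj I f"
          "\<And>i. i \<in> I \<Longrightarrow> \<exists>xs \<beta> \<psi>. \<beta> < \<alpha> \<and> is_Pi \<beta> \<psi> \<and> f i = foldr FEx xs \<psi>"
          using sig False by (cases rule: is_Sigma.cases) auto
        obtain i where i: "i \<in> I" "sat (order_struc Y) (f i) e'" using sY If(1) by auto
        obtain xs \<beta> \<psi> where *: "\<beta> < \<alpha>" "is_Pi \<beta> \<psi>" "f i = foldr FEx xs \<psi>"
          using If(2)[OF i(1)] by blast
        then have "fv \<psi> - set xs \<subseteq> fv \<phi>" using If(1) i(1) by (auto intro!: bexI[of _ i])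
        moreover obtain g where "range g \<subseteq> to_nat ` Y" "sat (order_struc Y) \<psi> (override_on e' g (set xs))"
          using i(2) *(3) \<open>Y \<noteq> {}\<close> by (auto simp: sat_foldr_FAll sat_foldr_FEx)
        ultimately obtain g' where "range g' \<subseteq> to_nat ` X" "sat (order_struc X) \<psi> (override_on e g' (set xs))"
          using key[of \<beta> \<psi> xs g] * by blast
        then have "sat (order_struc X) (f i) e"
          using \<open>X \<noteq> {}\<close> *(3) by (auto simp: sat_foldr_FAll sat_foldr_FEx)
        then show ?thesis using If(1) i(1) by auto
      qed
      ultimately show ?thesis by blast
    qed
  qed
  then show "is_Pi \<alpha> \<phi> \<Longrightarrow> sat (order_struc X) \<phi> e \<Longrightarrow> sat (order_struc Y) \<phi> e'"
    and "is_Sigma \<alpha> \<phi> \<Longrightarrow> sat (order_struc Y) \<phi> e' \<Longrightarrow> sat (order_struc X) \<phi> e"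
    by blast+
qed

section \<open>The two orders\<close>

lemma finite_embedding:
  fixes B :: "'a::linorder set" and G :: "'b::linorder set"
  assumes "finite B" "infinite G \<or> card B \<le> card G"
  shows "\<exists>f. strict_mono_on B f \<and> f ` B \<subseteq> G"
proof -
  obtain H where H: "finite H" "card H = card B" "H \<subseteq> G"
    using assms(2) obtain_subset_with_card_n infinite_arbitrarily_large by metis
  have "\<exists>f. strict_mono_on B f \<and> f ` B \<subseteq> H"
    using assms(1) H(1,2)
  proof (induction B arbitrary: H rule: finite_linorder_max_induct)
    case empty
    then show ?case by (simp add: monotone_on_def)
  next
    case (insert b B)
    have ne: "H \<noteq> {}" using insert.prems insert.hyps by auto
    have "b \<notin> B" using insert.hyps(2) by auto
    then have "card (H - {Max H}) = card B" using insert.prems insert.hyps(1) ne by simp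
    then obtain f where f: "strict_mono_on B f" "f ` B \<subseteq> H - {Max H}"
      using insert.IH[of "H - {Max H}"] insert.prems(1) by auto
    have "f x < Max H" if "x \<in> B" for x
      using f(2) that insert.prems(1) by (metis Diff_iff Max_ge image_subset_iff insertI1 le_neq_trans)
    then have "strict_mono_on (insert b B) (f(b := Max H))"
      using f(1) insert.hyps(2) by (fastforce simp: monotone_on_def)
    moreover have "f(b := Max H) ` insert b B \<subseteq> H" using f(2) ne insert.prems(1) by auto
    ultimately show ?case by blast
  qed
  then show ?thesis using H(3) by blast
qed

text \<open>The image of \<open>X\<close> cuts a finite \<open>B\<close> into gaps. Comparisons
  between different gaps are forced, so the content of each gap may be embedded on its own into the
  corresponding gap of \<open>U\<close>. An infinite gap takes any finite set; otherwise it is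
  enough to compare cardinalities.\<close>

lemma bf_1_graphI:
  fixes U V :: "'a::linorder set"
  assumes "X \<subseteq> U" "g ` X \<subseteq> V" and g: "strict_mono_on X g"
    and gap: "\<And>y. y \<in> V - g ` X \<Longrightarrow>
       infinite {u\<in>U. \<forall>x\<in>X. (x < u \<longleftrightarrow> g x < y) \<and> u \<noteq> x} \<or>
       finite {z\<in>V - g ` X. \<forall>x\<in>X. g x < z \<longleftrightarrow> g x < y} \<and>
       card {z\<in>V - g ` X. \<forall>x\<in>X. g x < z \<longleftrightarrow> g x < y} \<le>
       card {u\<in>U. \<forall>x\<in>X. (x < u \<longleftrightarrow> g x < y) \<and> u \<noteq> x}"
  shows "bf 1 U V ((\<lambda>x. (x, g x)) ` X)"
  unfolding One_nat_def bf.simps(2)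
proof (intro allI impI)
  fix B assume B: "finite B \<and> B \<subseteq> V"
  \<comment> \<open>A gap is named by the elements of \<open>X\<close> whose images lie below it:
    two points share a gap exactly when \<open>lo\<close> agrees.\<close>
  define lo where "lo y = {x\<in>X. g x < y}" for y
  define C where "C S = {y\<in>B - g ` X. lo y = S}" for S
  define G where "G S = {u\<in>U. \<forall>x\<in>X. (x < u \<longleftrightarrow> x \<in> S) \<and> u \<noteq> x}" for S
  have "\<exists>f. strict_mono_on (C S) f \<and> f ` C S \<subseteq> G S" for S
  proof (cases "C S = {}")
    case False
    then obtain y where y: "y \<in> C S" by blast
    have *: "y \<in> V - g ` X" "S = lo y" using y B by (auto simp: C_def)
    have Geq: "G S = {u\<in>U. \<forall>x\<in>X. (x < u \<longleftrightarrow> g x < y) \<and> u \<noteq> x}"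
      using *(2) by (auto simp: G_def lo_def)
    have Csub: "C S \<subseteq> {z\<in>V - g ` X. \<forall>x\<in>X. g x < z \<longleftrightarrow> g x < y}"
      using *(2) B by (auto simp: C_def lo_def)
    have "infinite (G S) \<or> card (C S) \<le> card (G S)"
      using gap[OF *(1)] card_mono[OF _ Csub] unfolding Geq by linarith
    moreover have "finite (C S)" using B by (simp add: C_def)
    ultimately show ?thesis by (rule finite_embedding[rotated])
  qed (simp add: monotone_on_def)
  then obtain F where F: "\<And>S. strict_mono_on (C S) (F S)" "\<And>S. F S ` C S \<subseteq> G S" by metis
  define h where "h y = F (lo y) y" for y
  have h: "h y \<in> U" "x < h y \<longleftrightarrow> g x < y" "h y \<noteq> x" "h y < x \<longleftrightarrow> y < g x"
    if "y \<in> B - g ` X" "x \<in> X" for y x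
  proof -
    have "h y \<in> G (lo y)" using F(2)[of "lo y"] that by (auto simp: h_def C_def)
    then show "h y \<in> U" "x < h y \<longleftrightarrow> g x < y" "h y \<noteq> x"
      using that by (auto simp: G_def lo_def)
    then show "h y < x \<longleftrightarrow> y < g x"
      using that by (metis DiffE imageI linorder_less_linear order_less_asym)
  qed
  have hU: "h y \<in> U" if "y \<in> B - g ` X" for y
    using F(2)[of "lo y"] that by (auto simp: h_def C_def G_def)
  have mono: "h y < h y'" if "y \<in> B - g ` X" "y' \<in> B - g ` X" "y < y'" for y y'
  proof (cases "lo y = lo y'")
    case True
    then have "y \<in> C (lo y)" "y' \<in> C (lo y)" using that by (auto simp: C_def)
    then show ?thesis using F(1)[of "lo y"] that(3) True by (simp add: h_def strict_mono_onD)
  next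
    case False
    moreover have "lo y \<subseteq> lo y'" using that(3) by (auto simp: lo_def)
    ultimately obtain x where x: "x \<in> X" "g x < y'" "\<not> g x < y" by (auto simp: lo_def)
    have "y < g x" using x that(1) by (metis DiffE imageI linorder_less_linear)
    then have "h y < x" using h(4)[OF that(1) x(1)] by simp
    also have "x < h y'" using h(2)[OF that(2) x(1)] x(2) by simp
    finally show ?thesis .
  qed
  have mono_iff: "y < y' \<longleftrightarrow> h y < h y'" if "y \<in> B - g ` X" "y' \<in> B - g ` X" for y y'
    using mono that by (metis linorder_less_linear order_less_asym)
  have g_iff: "g x < g x' \<longleftrightarrow> x < x'" if "x \<in> X" "x' \<in> X" for x x'
    using strict_mono_on_less[OF g that] .
  define q where "q = (\<lambda>x. (g x, x)) ` X \<union> (\<lambda>y. (y, h y)) ` (B - g ` X)"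
  have "bf 0 V U q"
    unfolding bf.simps
  proof (intro conjI allI impI)
    show "q \<subseteq> V \<times> U" using assms(1,2) B hU by (auto simp: q_def)
    fix y u y' u' assume "(y, u) \<in> q" "(y', u') \<in> q"
    then show "y < y' \<longleftrightarrow> u < u'"
      unfolding q_def using g_iff mono_iff h(2,4) by auto
  qed
  moreover have "((\<lambda>x. (x, g x)) ` X)\<inverse> \<subseteq> q" by (auto simp: q_def)
  moreover have "B \<subseteq> Domain q"
  proof
    fix y assume "y \<in> B"
    then show "y \<in> Domain q"
    proof (cases "y \<in> g ` X")
      case True
      then show ?thesis by (auto simp: q_def intro: DomainI)
    next
      case False
      then have "(y, h y) \<in> q" using \<open>y \<in> B\<close> by (simp add: q_def)
      then show ?thesis by blast
    qed
  qed
  ultimately show "\<exists>q. ((\<lambda>x. (x, g x)) ` X)\<inverse> \<subseteq> q \<and> B \<subseteq> Domain q \<and> bf 0 V U q" by blast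
qed

text \<open>One more than the 2-adic valuation of the denominator of \<open>t\<close>.\<close>

definition block_size :: "rat \<Rightarrow> nat" where
  "block_size t = Suc (LEAST n. \<exists>a b :: int. odd b \<and> of_int b * 2 ^ n * t = of_int a)"

text \<open>A fraction with odd numerator and denominator \<open>2 ^ n * 3 ^ i\<close> has block
  size \<open>Suc n\<close> whatever \<open>i\<close> is; a large \<open>i\<close> makes these
  fractions fine enough to hit the interval.\<close>

lemma block_size_dense:
  assumes "a < b" "0 < c"
  shows "\<exists>t. a < t \<and> t < b \<and> block_size t = c"
proof -
  obtain n where n: "c = Suc n" using assms(2) gr0_implies_Suc by blast
  obtain i where i: "2 / (b - a) < of_nat i" using reals_Archimedean2 by blast
  define d :: int where "d = 2 ^ n * 3 ^ i"
  have "i < 3 ^ i" by (rule power_gt_expt) simp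
  also have "(3::nat) ^ i \<le> 2 ^ n * 3 ^ i" by simp
  finally have "int i \<le> int (2 ^ n * 3 ^ i)" by (simp only: of_nat_le_iff)
  then have "int i \<le> d" by (simp add: d_def)
  then have "of_nat i \<le> (of_int d :: rat)" by (metis of_int_le_iff of_int_of_nat_eq)
  then have "2 / (b - a) < of_int d" using i by linarith
  then have db: "of_int d * a + 2 < of_int d * b" using assms(1) by (simp add: field_simps)
  have d: "0 < d" by (simp add: d_def)
  define f where "f = \<lfloor>of_int d * a\<rfloor>"
  \<comment> \<open>The interval scaled by \<open>d\<close> is longer than 2, so both integers
    following \<open>f\<close> lie in it, and one of them is odd.\<close>
  define e where "e = (if odd f then f + 2 else f + 1)"
  have e: "odd e" "of_int d * a < of_int e" "of_int e < of_int d * b"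
    using db by (auto simp: e_def f_def) linarith+
  define t :: rat where "t = of_int e / of_int d"
  have "a < t" "t < b" using e(2,3) d by (simp_all add: t_def field_simps)
  moreover have "(LEAST n. \<exists>a b :: int. odd b \<and> of_int b * 2 ^ n * t = of_int a) = n"
  proof (rule Least_equality)
    have "of_int (3 ^ i) * 2 ^ n * t = of_int e" using d by (simp add: t_def d_def)
    then show "\<exists>a b :: int. odd b \<and> of_int b * 2 ^ n * t = of_int a"
      by (intro exI[of _ e] exI[of _ "3 ^ i"]) simp
  next
    fix m assume "\<exists>a b :: int. odd b \<and> of_int b * 2 ^ m * t = of_int a"
    then obtain x y :: int where xy: "odd y" "of_int y * 2 ^ m * t = of_int x" by blast
    have "(of_int (y * 2 ^ m * e) :: rat) = of_int (x * d)"
      using xy(2) d by (simp add: t_def field_simps)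
    then have eq: "y * 2 ^ m * e = x * (2 ^ n * 3 ^ i)" unfolding of_int_eq_iff d_def .
    show "n \<le> m"
    proof (rule ccontr)
      assume "\<not> n \<le> m"
      then obtain k where "n = m + Suc k" by (metis add_Suc_right less_imp_Suc_add not_le)
      then have "2 ^ m * (y * e) = 2 ^ m * (2 * (x * 2 ^ k * 3 ^ i))"
        using eq by (simp add: power_add ac_simps)
      then have "y * e = 2 * (x * 2 ^ k * 3 ^ i)" by simp
      then show False using xy(1) e(1) by (metis dvd_triv_left even_mult_iff)
    qed
  qed
  ultimately show ?thesis by (auto simp: block_size_def n)
qed

text \<open>The point \<open>(t, m)\<close> is the \<open>m\<close>-th element of the block with index \<open>t\<close>. The blocks with
  negative index are finite; for \<open>q > 0\<close> the upper part of \<open>LO q\<close> is a copy of \<open>\<omega>\<cdot>(1 + \<eta>)\<close>, that of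
  \<open>LO_lim\<close> a copy of \<open>\<omega>\<cdot>\<eta>\<close>.\<close>

definition shuf :: "(rat \<times> nat) set" where
  "shuf = {(t, m). t < 0 \<and> m < block_size t}"

definition LO :: "rat \<Rightarrow> (rat \<times> nat) set" where
  "LO q = shuf \<union> {q..} \<times> UNIV"

definition LO_lim :: "(rat \<times> nat) set" where
  "LO_lim = shuf \<union> {0<..} \<times> UNIV"

section \<open>Gaps in the order and their sizes\<close>

lemma infinite_gap_rat:
  fixes A B :: "rat set"
  assumes "finite A" "finite B" "B \<noteq> {}" "\<And>a b. a \<in> A \<Longrightarrow> b \<in> B \<Longrightarrow> a < b"
  shows "infinite {s. (\<forall>a\<in>A. a < s) \<and> (\<forall>b\<in>B. s < b)}"
proof -
  define l where "l = (if A = {} then Min B - 1 else Max A)"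
  have "l < Min B" using assms by (simp add: l_def del: Min_gr_iff Max_less_iff)
  moreover have "{l<..<Min B} \<subseteq> {s. (\<forall>a\<in>A. a < s) \<and> (\<forall>b\<in>B. s < b)}"
  proof clarify
    fix s assume s: "s \<in> {l<..<Min B}"
    have "a \<le> l" if "a \<in> A" for a using assms(1) that by (auto simp: l_def)
    moreover have "Min B \<le> b" if "b \<in> B" for b using assms(2) that by simp
    ultimately show "(\<forall>a\<in>A. a < s) \<and> (\<forall>b\<in>B. s < b)" using s by fastforce
  qed
  ultimately show ?thesis using infinite_Ioo infinite_super by blast
qed

text \<open>Above a point of an \<open>\<omega>\<close>-block the rest of that block lies in the
  gap; otherwise infinitely many finite blocks start in it. Thus a finite gap can only occur between
  two points of one block.\<close>

lemma LO_infinite_gap: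
  assumes "0 < q" "finite A" "finite B" "A \<subseteq> LO q" "B \<subseteq> LO q"
    and lt: "\<And>x y. x \<in> A \<Longrightarrow> y \<in> B \<Longrightarrow> fst x < fst y"
  shows "infinite {u\<in>LO q. (\<forall>x\<in>A. x < u) \<and> (\<forall>y\<in>B. u < y)}"
proof (cases "\<exists>x\<in>A. q \<le> fst x")
  case True
  define t where "t = Max (fst ` A)"
  have tA: "t \<in> fst ` A" unfolding t_def using assms(2) True by (intro Max_in) auto
  have t: "q \<le> t" using True assms(2) unfolding t_def by (metis Max_ge finite_imageI imageI order_trans)
  define m where "m = Max (snd ` A)"
  have "(\<lambda>i. (t, m + Suc i)) ` UNIV \<subseteq> {u\<in>LO q. (\<forall>x\<in>A. x < u) \<and> (\<forall>y\<in>B. u < y)}"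
  proof clarsimp
    fix i
    have "(a, b) < (t, Suc (m + i))" if "(a, b) \<in> A" for a b
    proof -
      have "a \<le> t" unfolding t_def using assms(2) that by (intro Max_ge) force+
      moreover have "b \<le> m" unfolding m_def using assms(2) that by (intro Max_ge) force+
      ultimately show ?thesis by auto
    qed
    moreover have "(t, Suc (m + i)) < (a, b)" if "(a, b) \<in> B" for a b
      using lt tA that by fastforce
    ultimately show "(t, Suc (m + i)) \<in> LO q \<and>
      (\<forall>x\<in>A. x < (t, Suc (m + i))) \<and> (\<forall>y\<in>B. (t, Suc (m + i)) < y)"
      using t by (auto simp: LO_def)
  qed
  moreover have "infinite (range (\<lambda>i. (t, m + Suc i)))"
    by (intro range_inj_infinite) (simp add: inj_on_def)
  ultimately show ?thesis using infinite_super by blast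
next
  case False
  then have neg: "fst x < 0" if "x \<in> A" for x using that assms(4) by (force simp: LO_def shuf_def)
  \<comment> \<open>The extra bound 0 keeps the new blocks inside \<open>shuf\<close>, also when
    \<open>B\<close> is empty.\<close>
  let ?S = "{s. (\<forall>a\<in>fst ` A. a < s) \<and> (\<forall>b\<in>insert 0 (fst ` B). s < b)}"
  have "infinite ?S"
    by (rule infinite_gap_rat) (use assms neg in auto)
  then have "infinite ((\<lambda>s. (s, 0::nat)) ` ?S)"
    by (simp add: finite_image_iff inj_on_def)
  moreover have "(\<lambda>s. (s, 0)) ` ?S \<subseteq> {u\<in>LO q. (\<forall>x\<in>A. x < u) \<and> (\<forall>y\<in>B. u < y)}"
    by (force simp: LO_def shuf_def block_size_def less_prod_def)
  ultimately show ?thesis using infinite_super by blast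
qed


text \<open>\<open>f\<close> moves the \<open>\<omega>\<close>-blocks with index in \<open>R\<close>
  to finite blocks of size \<open>K\<close>, long enough for all points of \<open>Y\<close>. The
  answer \<open>g\<close> to a set \<open>A\<close> goes back: the part of \<open>shuf\<close> from
  \<open>\<sigma> (Min R)\<close> on is spread over the \<open>\<omega>\<close>-blocks in
  \<open>R\<close>, the block \<open>r\<close> taking everything from \<open>\<sigma> r\<close> up
  to the next value of \<open>\<sigma>\<close>. Points of the block \<open>\<sigma> r\<close> keep
  their places below \<open>K\<close>, all others go to places from \<open>K\<close> on.\<close>

lemma bf_2_LO:
  assumes q: "0 < q" and R: "finite R" "R \<noteq> {}" "R \<subseteq> {0<..<q}"
    and \<sigma>: "strict_mono_on R \<sigma>" "\<And>r. r \<in> R \<Longrightarrow> \<sigma> r < 0" "\<And>r. r \<in> R \<Longrightarrow> block_size (\<sigma> r) = K"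
    and Y: "finite Y" "Y \<subseteq> LO_lim" "\<And>t m. (t, m) \<in> Y \<Longrightarrow> t < 0 \<Longrightarrow> t < \<sigma> (Min R)"
      "\<And>t m. (t, m) \<in> Y \<Longrightarrow> 0 < t \<Longrightarrow> t < q \<Longrightarrow> t \<in> R \<and> m < K"
  defines "f \<equiv> \<lambda>(t, m). (if 0 < t \<and> t < q then \<sigma> t else t, m)"
  shows "bf 2 LO_lim (LO q) ((\<lambda>y. (y, f y)) ` Y)"
  unfolding numeral_2_eq_2 bf.simps(2)[of "Suc 0"]
proof (intro allI impI)
  fix A assume A: "finite A \<and> A \<subseteq> LO q"
  define X where "X = A \<union> f ` Y"
  have fY: "f ` Y \<subseteq> LO q"
    using Y(2,4) \<sigma>(2,3) by (fastforce simp: f_def LO_def LO_lim_def shuf_def split: if_splits)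
  have X: "finite X" "X \<subseteq> LO q" using A Y(1) fY by (auto simp: X_def)
  define s where "s = \<sigma> (Min R)"
  have s0: "s < 0" using \<sigma>(2) R by (simp add: s_def)
  \<comment> \<open>\<open>top t\<close> is the index of the \<open>\<omega>\<close>-block that will
    receive the block \<open>t\<close>.\<close>
  define top where "top t = Max {r\<in>R. \<sigma> r \<le> t}" for t
  have top: "top t \<in> R" "\<sigma> (top t) \<le> t" "\<And>r. r \<in> R \<Longrightarrow> \<sigma> r \<le> t \<Longrightarrow> r \<le> top t" if "s \<le> t" for t
  proof -
    have "Min R \<in> {r\<in>R. \<sigma> r \<le> t}" using that R by (simp add: s_def)
    then have "top t \<in> {r\<in>R. \<sigma> r \<le> t}" unfolding top_def using R(1) by (intro Max_in) auto
    then show "top t \<in> R" "\<sigma> (top t) \<le> t" by auto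
    show "r \<le> top t" if "r \<in> R" "\<sigma> r \<le> t" for r
      unfolding top_def using R(1) that by (intro Max_ge) auto
  qed
  \<comment> \<open>Counting the smaller points of \<open>X\<close> gives strictly increasing
    places, and neighbours in \<open>X\<close> receive adjacent ones, so that no new points lie
    between their images.\<close>
  define g where "g = (\<lambda>(t, m). if t < s \<or> q \<le> t then (t, m) else if t = \<sigma> (top t) then (top t, m)
     else (top t, K + card {x\<in>X. x < (t, m)}))"
  have gf: "g (f y) = y" if "y \<in> Y" for y
  proof (cases y)
    case (Pair t m)
    have "t < 0 \<or> 0 < t" using that Y(2) Pair by (auto simp: LO_lim_def shuf_def)
    moreover have ?thesis if "t < 0"
      using Y(3)[of t m] \<open>y \<in> Y\<close> that by (simp add: g_def f_def Pair s_def)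
    moreover have ?thesis if "0 < t" "t < q"
    proof -
      have r: "t \<in> R" using Y(4)[of t m] \<open>y \<in> Y\<close> that Pair by simp
      have le: "s \<le> \<sigma> t" using R(1,2) r \<sigma>(1) by (simp add: s_def strict_mono_on_leD)
      have "top (\<sigma> t) = t"
        using top[OF le] r strict_mono_on_less_eq[OF \<sigma>(1)] by (metis order_antisym order_refl)
      then show ?thesis using that le \<sigma>(2)[OF r] q by (simp add: g_def f_def Pair)
    qed
    moreover have ?thesis if "q \<le> t"
      using that q by (simp add: g_def f_def Pair)
    ultimately show ?thesis by linarith
  qed
  have fst_g: "fst (g x) = (if fst x < s \<or> q \<le> fst x then fst x else top (fst x))" for x
    by (simp add: g_def split: prod.splits)
  have zone: "fst x < s \<or> s \<le> fst x \<and> fst x < 0 \<or> q \<le> fst x" if "x \<in> X" for x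
    using that X(2) by (force simp: LO_def shuf_def)
  have gV: "g ` X \<subseteq> LO_lim"
  proof
    fix y assume "y \<in> g ` X"
    then obtain x where x: "x \<in> X" "y = g x" by blast
    obtain t m where tm: "x = (t, m)" by fastforce
    have "(t, m) \<in> LO q" using x(1) X(2) tm by blast
    moreover have "0 < top t" if "s \<le> t" using top(1)[OF that] R(3) by auto
    ultimately show "y \<in> LO_lim"
      using x(2) tm q s0 by (auto simp: g_def LO_def LO_lim_def)
  qed
  have mono: "g x < g x'" if x: "x \<in> X" and x': "x' \<in> X" and lt: "x < x'" for x x'
  proof -
    obtain t m t' m' where tm: "x = (t, m)" "x' = (t', m')" by (metis surj_pair)
    have tt: "t < t' \<or> t = t' \<and> m < m'" using lt tm by auto
    have R': "0 < top u \<and> top u < q" if "s \<le> u" for u using top(1)[OF that] R(3) by auto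
    have mid: ?thesis if "s \<le> t" "t < 0" "s \<le> t'" "t' < 0"
    proof -
      have "top t \<le> top t'" using top[OF that(1)] top(3)[OF that(3)] tt by force
      then consider "top t < top t'" | "top t = top t'" by linarith
      then show ?thesis
      proof cases
        case 1
        then show ?thesis using fst_g[of x] fst_g[of x'] that q by (simp add: tm less_prod_def)
      next
        case 2
        \<comment> \<open>Among the blocks with the same \<open>top\<close> the block
          \<open>\<sigma> (top t)\<close> comes first, and its images lie below place
          \<open>K\<close>.\<close>
        have mK: "m < K" if "t = \<sigma> (top t)"
          using x X(2) tm \<open>t < 0\<close> q \<sigma>(3)[OF top(1)[OF \<open>s \<le> t\<close>]] that by (auto simp: LO_def shuf_def)
        have "{z\<in>X. z < x} \<subset> {z\<in>X. z < x'}" using x lt by auto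
        then have "card {z\<in>X. z < x} < card {z\<in>X. z < x'}" using X(1) by (intro psubset_card_mono) auto
        moreover have "t' \<noteq> \<sigma> (top t')" if "t \<noteq> \<sigma> (top t)"
          using top(2)[OF \<open>s \<le> t\<close>] that tt 2 by auto
        ultimately show ?thesis using that tt 2 mK q by (auto simp: g_def tm)
      qed
    qed
    have z: "t < s \<or> s \<le> t \<and> t < 0 \<or> q \<le> t" "t' < s \<or> s \<le> t' \<and> t' < 0 \<or> q \<le> t'"
      using zone[OF x] zone[OF x'] by (simp_all add: tm)
    consider "t < s \<or> q \<le> t" "t' < s \<or> q \<le> t'" | "s \<le> t" "t < 0" "s \<le> t'" "t' < 0"
      | "t < s" "s \<le> t'" "t' < 0" | "s \<le> t" "t < 0" "q \<le> t'"
      using z tt q s0 by linarith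
    then show ?thesis
    proof cases
      case 1
      then show ?thesis using lt by (simp add: tm g_def)
    next
      case 2
      then show ?thesis by (rule mid)
    next
      case 3
      then have "fst (g x) < fst (g x')" using fst_g[of x] fst_g[of x'] R'[of t'] q s0 by (simp add: tm)
      then show ?thesis by (simp add: less_prod_def)
    next
      case 4
      then have "fst (g x) < fst (g x')" using fst_g[of x] fst_g[of x'] R'[of t] q s0 by (simp add: tm)
      then show ?thesis by (simp add: less_prod_def)
    qed
  qed
  have smono: "strict_mono_on X g" using mono by (simp add: monotone_on_def)
  have "bf 1 (LO q) LO_lim ((\<lambda>x. (x, g x)) ` X)"
  proof (rule bf_1_graphI[OF X(2) gV smono])
    fix y assume y: "y \<in> LO_lim - g ` X"
    define lo where "lo = {x\<in>X. g x < y}"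
    define up where "up = {x\<in>X. y < g x}"
    have split: "X = lo \<union> up" using y by (force simp: lo_def up_def)
    have lu: "x < x'" if "x \<in> lo" "x' \<in> up" for x x'
    proof -
      have "g x < g x'" using that by (auto simp: lo_def up_def)
      then show ?thesis using that strict_mono_on_less[OF smono] by (auto simp: lo_def up_def)
    qed
    have fin: "finite lo" "finite up" using X(1) by (auto simp: lo_def up_def)
    let ?G = "{u\<in>LO q. \<forall>x\<in>X. (x < u \<longleftrightarrow> g x < y) \<and> u \<noteq> x}"
    let ?H = "{z\<in>LO_lim - g ` X. \<forall>x\<in>X. g x < z \<longleftrightarrow> g x < y}"
    have G: "?G = {u\<in>LO q. (\<forall>x\<in>lo. x < u) \<and> (\<forall>x\<in>up. u < x)}"
    proof -
      have "(\<forall>x\<in>X. (x < u \<longleftrightarrow> g x < y) \<and> u \<noteq> x) \<longleftrightarrow> (\<forall>x\<in>lo. x < u) \<and> (\<forall>x\<in>up. u < x)" for u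
      proof
        assume *: "\<forall>x\<in>X. (x < u \<longleftrightarrow> g x < y) \<and> u \<noteq> x"
        have "u < x" if "x \<in> up" for x
          using * that order_less_asym[of y "g x"] by (auto simp: up_def linorder_neq_iff)
        then show "(\<forall>x\<in>lo. x < u) \<and> (\<forall>x\<in>up. u < x)" using * by (simp add: lo_def)
      next
        assume *: "(\<forall>x\<in>lo. x < u) \<and> (\<forall>x\<in>up. u < x)"
        show "\<forall>x\<in>X. (x < u \<longleftrightarrow> g x < y) \<and> u \<noteq> x"
        proof
          fix x assume "x \<in> X"
          then consider "x \<in> lo" | "x \<in> up" using split by blast
          then show "(x < u \<longleftrightarrow> g x < y) \<and> u \<noteq> x"
          proof cases
            case 1
            then have "x < u" "g x < y" using * by (blast, simp add: lo_def)
            then show ?thesis by simp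
          next
            case 2
            then have "u < x" "y < g x" using * by (blast, simp add: up_def)
            then show ?thesis by (metis order_less_asym order_less_irrefl)
          qed
        qed
      qed
      then show ?thesis by auto
    qed
    \<comment> \<open>If no block meets both sides of the cut, the gap in \<open>LO q\<close> is
      infinite. Otherwise the cut separates two neighbours in one block, and sizes are
      compared.\<close>
    show "infinite ?G \<or> finite ?H \<and> card ?H \<le> card ?G"
    proof (cases "\<exists>x\<in>lo. \<exists>x'\<in>up. fst x = fst x'")
      case False
      then have "fst x < fst x'" if "x \<in> lo" "x' \<in> up" for x x'
        using lu[OF that] that by (force simp: less_prod_def)
      then have "infinite ?G" unfolding G
        by (intro LO_infinite_gap[OF q fin]) (use X(2) in \<open>auto simp: lo_def up_def\<close>)
      then show ?thesis by simp
    next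
      case True
      then obtain a b where ab: "a \<in> lo" "b \<in> up" "fst a = fst b" by blast
      define x where "x = Max lo"
      define x' where "x' = Min up"
      have x: "x \<in> lo" "a \<le> x" "x' \<in> up" "x' \<le> b"
        unfolding x_def x'_def using ab fin by (blast intro: Max_in Min_in Max_ge Min_le)+
      have xx': "x < x'" using lu x by blast
      obtain t m t' m' where tm: "x = (t, m)" "x' = (t', m')" by (metis surj_pair)
      have tt: "t = t'" "m < m'" using xx' x(2,4) ab(3) by (cases a; cases b; auto simp: tm)+
      have LOj: "(t, j) \<in> LO q" if "j < m'" for j
        using x(3) X(2) that tm tt by (auto simp: up_def LO_def shuf_def)
      have sub: "Pair t ` {m<..<m'} \<subseteq> ?G"
      proof -
        have "z < (t, j)" if "z \<in> lo" "m < j" for z j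
          using Max_ge[OF fin(1) that(1)] that(2) unfolding x_def[symmetric] tm by (cases z) auto
        moreover have "(t, j) < z" if "z \<in> up" "j < m'" for z j
          using Min_le[OF fin(2) that(1)] that(2) tt unfolding x'_def[symmetric] tm by (cases z) auto
        ultimately show ?thesis unfolding G using LOj by auto
      qed
      \<comment> \<open>\<open>x\<close> and \<open>x'\<close> are neighbours in \<open>X\<close>,
        so the counts used in \<open>g\<close> differ by one.\<close>
      have cons: "{z\<in>X. z < x'} = insert x {z\<in>X. z < x}"
      proof -
        have "z \<le> x \<or> x' \<le> z" if "z \<in> X" for z
          using that fin unfolding split x_def x'_def by auto
        then show ?thesis using x xx' by (force simp: lo_def)
      qed
      have "x \<notin> {z\<in>X. z < x}" by simp
      then have cc: "card {z\<in>X. z < x'} = Suc (card {z\<in>X. z < x})"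
        unfolding cons using X(1) by simp
      \<comment> \<open>Inside one block \<open>g\<close> either keeps distances or makes the images
        adjacent; a gap never grows.\<close>
      have "fst (g x) = fst (g x')" "snd (g x') - Suc (snd (g x)) \<le> m' - Suc m"
        using cc tt unfolding tm g_def by auto
      then obtain r j j' where gx: "g x = (r, j)" "g x' = (r, j')" "j' - Suc j \<le> m' - Suc m"
        by (metis prod.collapse)
      have "?H \<subseteq> Pair r ` {j<..<j'}"
      proof
        fix z assume z: "z \<in> ?H"
        have "g x < z" "\<not> g x' < z" "z \<noteq> g x'" using z x by (auto simp: lo_def up_def)
        then show "z \<in> Pair r ` {j<..<j'}" by (cases z) (auto simp: gx)
      qed
      moreover have "finite (Pair r ` {j<..<j'})" by simp
      ultimately have H: "finite ?H" "card ?H \<le> card (Pair r ` {j<..<j'})"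
        by (auto intro: finite_subset card_mono)
      have "card (Pair r ` {j<..<j'}) \<le> card (Pair t ` {m<..<m'})"
        using gx(3) by (simp add: card_image inj_on_def)
      also have "\<dots> \<le> card ?G" if "finite ?G" using card_mono[OF that sub] .
      finally show ?thesis using H by linarith
    qed
  qed
  moreover have "((\<lambda>y. (y, f y)) ` Y)\<inverse> \<subseteq> (\<lambda>x. (x, g x)) ` X"
    using gf by (force simp: X_def)
  moreover have "A \<subseteq> Domain ((\<lambda>x. (x, g x)) ` X)"
    unfolding X_def Domain_fst by (simp add: image_image)
  ultimately show "\<exists>p. ((\<lambda>y. (y, f y)) ` Y)\<inverse> \<subseteq> p \<and> A \<subseteq> Domain p \<and> bf (Suc 0) (LO q) LO_lim p"
    unfolding One_nat_def by blast
qed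


text \<open>Density of the block sizes leaves infinitely many blocks of size \<open>K\<close>
  between \<open>b\<close> and 0, enough for any finite order.\<close>

lemma block_embedding:
  fixes R :: "'a::linorder set"
  assumes "finite R" "b < 0" "0 < K"
  shows "\<exists>\<sigma>. strict_mono_on R \<sigma> \<and> (\<forall>r\<in>R. b < \<sigma> r \<and> \<sigma> r < 0 \<and> block_size (\<sigma> r) = K)"
proof -
  let ?G = "{t. b < t \<and> t < 0 \<and> block_size t = K}"
  have "infinite ?G"
  proof
    assume fin: "finite ?G"
    have "?G \<noteq> {}" using block_size_dense[OF assms(2,3)] by blast
    then have M: "Min ?G \<in> ?G" using fin Min_in by blast
    then obtain t where t: "b < t" "t < Min ?G" "block_size t = K"
      using block_size_dense[OF _ assms(3), of b "Min ?G"] by blast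
    then have "t \<in> ?G" using M by auto
    then show False using Min_le[OF fin] t(2) by fastforce
  qed
  then obtain \<sigma> where "strict_mono_on R \<sigma>" "\<sigma> ` R \<subseteq> ?G"
    using finite_embedding[OF assms(1)] by blast
  then show ?thesis by (intro exI[of _ \<sigma>]) auto
qed

text \<open>\<open>LO q\<close> lacks the blocks with index between 0 and \<open>q\<close>. The
  finitely many points of \<open>B\<close> in them are moved into sufficiently long finite blocks
  below 0 but above the other points of \<open>shuf\<close> in question; all remaining points stay
  fixed.\<close>

lemma bf_3_LO:
  assumes q: "0 < q" and Z: "finite Z" "Z \<subseteq> LO q"
  shows "bf 3 (LO q) LO_lim (Id_on Z)"
  unfolding numeral_3_eq_3 bf.simps(2)[of "Suc (Suc 0)"]
proof (intro allI impI)
  fix B assume B: "finite B \<and> B \<subseteq> LO_lim"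
  define Y where "Y = B \<union> Z"
  have Y: "finite Y" "Y \<subseteq> LO_lim" using B Z q by (auto simp: Y_def LO_def LO_lim_def)
  \<comment> \<open>The point \<open>q / 2\<close> keeps \<open>R\<close> nonempty, so that
    \<open>Min R\<close> is meaningful.\<close>
  define R where "R = insert (q / 2) {t\<in>fst ` Y. 0 < t \<and> t < q}"
  have R: "finite R" "R \<noteq> {}" "R \<subseteq> {0<..<q}" using Y(1) q by (auto simp: R_def)
  obtain K where K: "\<And>n. n \<in> snd ` Y \<Longrightarrow> n < K"
    using Y(1) finite_nat_set_iff_bounded[of "snd ` Y"] by auto
  \<comment> \<open>All points of \<open>Y\<close> in \<open>shuf\<close> have index at most
    \<open>b\<close>; -1 is the default if there are none.\<close>
  define b where "b = Max (insert (-1) {t\<in>fst ` Y. t < 0})"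
  have "b \<in> insert (-1) {t\<in>fst ` Y. t < 0}" unfolding b_def using Y(1) by (intro Max_in) auto
  then have b: "b < 0" by auto
  have bY: "t \<le> b" if "(t, m) \<in> Y" "t < 0" for t m
    unfolding b_def using Y(1) that by (intro Max_ge) force+
  \<comment> \<open>\<open>Suc K\<close> instead of \<open>K\<close>, as a block size must be
    positive even if \<open>Y\<close> is empty.\<close>
  obtain \<sigma> where \<sigma>: "strict_mono_on R \<sigma>" "\<And>r. r \<in> R \<Longrightarrow> b < \<sigma> r"
    "\<And>r. r \<in> R \<Longrightarrow> \<sigma> r < 0" "\<And>r. r \<in> R \<Longrightarrow> block_size (\<sigma> r) = Suc K"
    using block_embedding[OF R(1) b zero_less_Suc[of K]] by metis
  let ?f = "\<lambda>(t, m). (if 0 < t \<and> t < q then \<sigma> t else t, m)"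
  have "bf 2 LO_lim (LO q) ((\<lambda>y. (y, ?f y)) ` Y)"
  proof (rule bf_2_LO[OF q R \<sigma>(1,3,4) Y])
    fix t m assume tm: "(t, m) \<in> Y"
    show "t < \<sigma> (Min R)" if "t < 0"
      using bY[OF tm that] \<sigma>(2)[of "Min R"] Min_in[OF R(1,2)] by simp
    show "t \<in> R \<and> m < Suc K" if "0 < t" "t < q"
      using K[of m] tm that by (force simp: R_def)
  qed
  moreover have "(Id_on Z)\<inverse> \<subseteq> (\<lambda>y. (y, ?f y)) ` Y"
  proof -
    have "?f z = z" if "z \<in> Z" for z using that Z(2) by (force simp: LO_def shuf_def)
    then show ?thesis by (force simp: Y_def)
  qed
  moreover have "B \<subseteq> Domain ((\<lambda>y. (y, ?f y)) ` Y)"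
    unfolding Y_def Domain_fst image_image fst_conv by simp
  ultimately show "\<exists>p. (Id_on Z)\<inverse> \<subseteq> p \<and> B \<subseteq> Domain p \<and> bf (Suc (Suc 0)) LO_lim (LO q) p"
    unfolding numeral_2_eq_2 by blast
qed

text \<open>\<open>LO_lim\<close> is the union of the sets \<open>LO q\<close> for \<open>q > 0\<close>, each a copy of \<open>LO 1\<close>.\<close>

lemma bf_5_LO: "bf 5 (LO 1) LO_lim {}"
proof -
  have "\<exists>p. B \<subseteq> Domain p \<and> bf 4 LO_lim (LO 1) p" if B: "finite B" "B \<subseteq> LO_lim" for B
  proof -
    \<comment> \<open>The default 1 covers the case that \<open>B\<close> lies in
      \<open>shuf\<close>.\<close>
    define q where "q = Min (insert 1 {t\<in>fst ` B. 0 < t})"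
    have "q \<in> insert 1 {t\<in>fst ` B. 0 < t}" unfolding q_def using B(1) by (intro Min_in) auto
    then have q: "0 < q" by auto
    have "q \<le> t" if "(t, m) \<in> B" "0 < t" for t m
      unfolding q_def using B(1) that by (intro Min_le) force+
    then have Bq: "B \<subseteq> LO q" using B(2) by (fastforce simp: LO_def LO_lim_def)
    \<comment> \<open>Scaling the positive indices carries \<open>LO q\<close> onto
      \<open>LO 1\<close> and fixes \<open>shuf\<close>; \<open>h\<close> is the inverse.\<close>
    define f :: "rat \<times> nat \<Rightarrow> rat \<times> nat" where "f = (\<lambda>(t, m). (if t < 0 then t else t / q, m))"
    define h :: "rat \<times> nat \<Rightarrow> rat \<times> nat" where "h = (\<lambda>(t, m). (if t < 0 then t else t * q, m))"
    have fh: "f (h x) = x" "h (f x) = x" for x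
      using q by (auto simp: f_def h_def field_simps mult_less_0_iff split: prod.splits)
    have f1: "f x \<in> LO 1" if "x \<in> LO q" for x
      using that q by (auto simp: f_def LO_def shuf_def)
    have h1: "h x \<in> LO q" if "x \<in> LO 1" for x
      using that q by (auto simp: h_def LO_def shuf_def)
    have fim: "f ` LO q = LO 1" using f1 h1 fh by (metis image_subset_iff subsetI subset_antisym image_eqI)
    have fmono: "strict_mono_on (LO q) f"
    proof (rule strict_mono_onI)
      fix x y :: "rat \<times> nat" assume "x < y"
      then show "f x < f y"
        using q by (cases x; cases y)
          (auto simp: f_def divide_strict_right_mono divide_less_0_iff divide_le_cancel not_less intro: less_le_trans[of _ 0])
    qed
    \<comment> \<open>This is the inclusion of \<open>LO q\<close> in \<open>LO_lim\<close> read
      through the scaling.\<close>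
    have bf3: "bf 3 (LO 1) LO_lim ((\<lambda>x. (x, h x)) ` A)" if A: "finite A" "A \<subseteq> LO 1" for A
    proof -
      have "bf 3 (LO q) LO_lim (Id_on (h ` A))"
        by (rule bf_3_LO[OF q]) (use A h1 in auto)
      from bf_image[OF this fmono, of id] have "bf 3 (LO 1) LO_lim (map_prod f id ` Id_on (h ` A))"
        by (simp add: fim monotone_on_def)
      moreover have "map_prod f id ` Id_on (h ` A) = (\<lambda>x. (x, h x)) ` A"
        by (auto simp: Id_on_def fh image_iff)
      ultimately show ?thesis by simp
    qed
    \<comment> \<open>Points of \<open>A\<close> are answered by \<open>h\<close>, whose values on
      \<open>LO 1\<close> lie in \<open>LO q\<close>, hence in \<open>LO_lim\<close>.\<close>
    have "bf (Suc 3) LO_lim (LO 1) ((\<lambda>y. (y, f y)) ` B)"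
      unfolding bf.simps(2)[of 3]
    proof (intro allI impI)
      fix A assume A: "finite A \<and> A \<subseteq> LO 1"
      have "bf 3 (LO 1) LO_lim ((\<lambda>x. (x, h x)) ` (A \<union> f ` B))"
        by (rule bf3) (use A B(1) Bq f1 in auto)
      moreover have "((\<lambda>y. (y, f y)) ` B)\<inverse> \<subseteq> (\<lambda>x. (x, h x)) ` (A \<union> f ` B)"
        using fh(2) by force
      moreover have "A \<subseteq> Domain ((\<lambda>x. (x, h x)) ` (A \<union> f ` B))"
        unfolding Domain_fst image_image fst_conv by simp
      ultimately show "\<exists>p. ((\<lambda>y. (y, f y)) ` B)\<inverse> \<subseteq> p \<and> A \<subseteq> Domain p \<and> bf 3 (LO 1) LO_lim p"
        by blast
    qed
    moreover have "B \<subseteq> Domain ((\<lambda>y. (y, f y)) ` B)"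
      unfolding Domain_fst image_image fst_conv by simp
    ultimately show ?thesis by (metis Suc_numeral semiring_norm(2) semiring_norm(8))
  qed
  then have "bf (Suc 4) (LO 1) LO_lim {}" unfolding bf.simps(2)[of 4] by simp
  then show ?thesis by (simp only: Suc_numeral semiring_norm)
qed

section \<open>Uniqueness of the order over a parameter\<close>

text \<open>Two points belong to one block when the closed interval from the smaller to the larger
  is finite.\<close>

definition seg :: "'a set \<Rightarrow> ('a \<Rightarrow> 'a \<Rightarrow> bool) \<Rightarrow> 'a \<Rightarrow> 'a \<Rightarrow> 'a set" where
  "seg A lt x y = {z\<in>A. (x = z \<or> lt x z) \<and> (z = y \<or> lt z y)}"

text \<open>Marks the first elements of blocks; a least element would count as one too.\<close>

definition no_pred :: "'a set \<Rightarrow> ('a \<Rightarrow> 'a \<Rightarrow> bool) \<Rightarrow> 'a \<Rightarrow> bool" where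
  "no_pred A lt x \<longleftrightarrow> (\<forall>y\<in>A. lt y x \<longrightarrow> (\<exists>z\<in>A. lt y z \<and> lt z x))"

definition no_succ :: "'a set \<Rightarrow> ('a \<Rightarrow> 'a \<Rightarrow> bool) \<Rightarrow> 'a \<Rightarrow> bool" where
  "no_succ A lt x \<longleftrightarrow> (\<forall>y\<in>A. lt x y \<longrightarrow> (\<exists>z\<in>A. lt x z \<and> lt z y))"

text \<open>At the first element of a finite block \<open>n\<close> is the size of the block, at
  other points the number of elements left in it, the point included.\<close>

definition run :: "'a set \<Rightarrow> ('a \<Rightarrow> 'a \<Rightarrow> bool) \<Rightarrow> 'a \<Rightarrow> nat \<Rightarrow> bool" where
  "run A lt x n \<longleftrightarrow> (\<exists>l\<in>A. (x = l \<or> lt x l) \<and> no_succ A lt l \<and>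
     finite (seg A lt x l) \<and> card (seg A lt x l) = n)"

text \<open>The parameter \<open>a\<close> is the first element of the first infinite block: blocks below \<open>a\<close> are
  finite and every size is dense among them, blocks from \<open>a\<close> on have type \<open>\<omega>\<close> and are densely ordered.
  Every condition is at most \<open>\<Pi>\<^sub>4\<close>.\<close>

locale shuffle_model =
  fixes A :: "'a set" and lt :: "'a \<Rightarrow> 'a \<Rightarrow> bool" and a :: 'a
  assumes irrefl: "x \<in> A \<Longrightarrow> \<not> lt x x"
    and trans: "x \<in> A \<Longrightarrow> y \<in> A \<Longrightarrow> z \<in> A \<Longrightarrow> lt x y \<Longrightarrow> lt y z \<Longrightarrow> lt x z"
    and total: "x \<in> A \<Longrightarrow> y \<in> A \<Longrightarrow> lt x y \<or> x = y \<or> lt y x"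
    and a_in: "a \<in> A"
    and a_first: "no_pred A lt a"
    and blocks: "x \<in> A \<Longrightarrow> \<exists>d\<in>A. (d = x \<or> lt d x) \<and> no_pred A lt d \<and> finite (seg A lt d x)"
    and right_succ: "x \<in> A \<Longrightarrow> \<not> lt x a \<Longrightarrow> \<not> no_succ A lt x"
    and left_run: "x \<in> A \<Longrightarrow> lt x a \<Longrightarrow> \<exists>n. run A lt x n"
    and right_dense: "x \<in> A \<Longrightarrow> y \<in> A \<Longrightarrow> \<not> lt x a \<Longrightarrow> lt x y \<Longrightarrow> no_pred A lt y \<Longrightarrow>
      \<exists>z\<in>A. lt x z \<and> lt z y \<and> no_pred A lt z"
    and right_unbounded: "x \<in> A \<Longrightarrow> \<not> lt x a \<Longrightarrow> \<exists>z\<in>A. lt x z \<and> no_pred A lt z"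
    and left_unbounded: "y \<in> A \<Longrightarrow> \<exists>x\<in>A. lt x y"
    and left_dense: "x \<in> A \<Longrightarrow> y \<in> A \<Longrightarrow> lt x y \<Longrightarrow> \<not> lt a y \<Longrightarrow> no_pred A lt y \<Longrightarrow> 0 < n \<Longrightarrow>
      \<exists>z\<in>A. lt x z \<and> lt z y \<and> no_pred A lt z \<and> run A lt z n"
begin

section \<open>Finite segments and positions inside a block\<close>

lemma asym: "x \<in> A \<Longrightarrow> y \<in> A \<Longrightarrow> lt x y \<Longrightarrow> \<not> lt y x"
  using irrefl trans by blast

lemma finite_has_greatest:
  assumes "finite S" "S \<subseteq> A" "S \<noteq> {}"
  shows "\<exists>m\<in>S. \<forall>z\<in>S. z = m \<or> lt z m"
  using assms(1,3,2)
proof (induction rule: finite_ne_induct)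
  case (insert x S)
  then obtain m where m: "m \<in> S" "\<forall>z\<in>S. z = m \<or> lt z m" by auto
  have A: "m \<in> A" "x \<in> A" "\<forall>z\<in>S. z \<in> A" using m insert.prems by auto
  then consider "lt m x" | "x = m \<or> lt x m" using total by blast
  then show ?case
  proof cases
    case 1
    have "z = x \<or> lt z x" if "z \<in> S" for z
      using 1 m(2) that trans[OF _ A(1,2), of z] A(3) by metis
    then show ?thesis by (intro bexI[of _ x]) auto
  next
    case 2
    then show ?thesis using m A by (intro bexI[of _ m]) auto
  qed
qed simp

lemma finite_has_least:
  assumes "finite S" "S \<subseteq> A" "S \<noteq> {}"
  shows "\<exists>m\<in>S. \<forall>z\<in>S. z = m \<or> lt m z"
  using assms(1,3,2)
proof (induction rule: finite_ne_induct)
  case (insert x S)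
  then obtain m where m: "m \<in> S" "\<forall>z\<in>S. z = m \<or> lt m z" by auto
  have A: "m \<in> A" "x \<in> A" "\<forall>z\<in>S. z \<in> A" using m insert.prems by auto
  then consider "lt m x" | "x = m \<or> lt x m" using total by blast
  then show ?case
  proof cases
    case 1
    then show ?thesis using m A by (intro bexI[of _ m]) auto
  next
    case 2
    have "z = x \<or> lt x z" if "z \<in> S" for z
      using 2 m(2) that trans[OF A(2,1), of z] A(3) by metis
    then show ?thesis by (intro bexI[of _ x]) auto
  qed
qed simp

text \<open>In a finite interval some point would be the greatest one below \<open>d\<close>, hence
  an immediate predecessor. So a finite interval never enters a later block.\<close>

lemma infinite_seg_no_pred:
  assumes "x \<in> A" "y \<in> A" "d \<in> A" "lt x d" "d = y \<or> lt d y" "no_pred A lt d"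
  shows "infinite (seg A lt x y)"
proof
  assume fin: "finite (seg A lt x y)"
  define S where "S = {z\<in>A. (x = z \<or> lt x z) \<and> lt z d}"
  have "S \<subseteq> seg A lt x y" using assms(2,3,5) trans[of _ d y] by (auto simp: S_def seg_def)
  then have "finite S" using fin finite_subset by blast
  moreover have "x \<in> S" using assms by (simp add: S_def)
  ultimately obtain m where m: "m \<in> S" "\<forall>z\<in>S. z = m \<or> lt z m"
    using finite_has_greatest[of S] by (auto simp: S_def)
  then obtain z where z: "z \<in> A" "lt m z" "lt z d" using assms(6) by (auto simp: no_pred_def S_def)
  have mA: "m \<in> A" "x = m \<or> lt x m" using m(1) by (auto simp: S_def)
  then have "z \<in> S" using z assms(1) trans[of x m z] by (auto simp: S_def)
  then show False using m(2) z(2) irrefl[OF mA(1)] asym[OF mA(1) z(1)] by auto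
qed

lemma infinite_seg_no_succ:
  assumes "x \<in> A" "y \<in> A" "l \<in> A" "lt l y" "x = l \<or> lt x l" "no_succ A lt l"
  shows "infinite (seg A lt x y)"
proof
  assume fin: "finite (seg A lt x y)"
  define S where "S = {z\<in>A. (z = y \<or> lt z y) \<and> lt l z}"
  have "S \<subseteq> seg A lt x y" using assms(1,3,5) trans[of x l] by (auto simp: S_def seg_def)
  then have "finite S" using fin finite_subset by blast
  moreover have "y \<in> S" using assms by (simp add: S_def)
  ultimately obtain m where m: "m \<in> S" "\<forall>z\<in>S. z = m \<or> lt m z"
    using finite_has_least[of S] by (auto simp: S_def)
  then obtain z where z: "z \<in> A" "lt l z" "lt z m" using assms(6) by (auto simp: no_succ_def S_def)
  have mA: "m \<in> A" "m = y \<or> lt m y" using m(1) by (auto simp: S_def)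
  then have "z \<in> S" using z assms(2) trans[of z m y] by (auto simp: S_def)
  then show False using m(2) z(3) irrefl[OF mA(1)] asym[OF z(1) mA(1)] by auto
qed

lemma seg_same: "x \<in> A \<Longrightarrow> seg A lt x x = {x}"
  using asym by (auto simp: seg_def)

lemma seg_extend:
  assumes "e \<in> A" "y \<in> A" "e = y \<or> lt e y" "finite (seg A lt e y)" "\<not> no_succ A lt y"
  shows "\<exists>z\<in>A. (e = z \<or> lt e z) \<and> finite (seg A lt e z) \<and>
    card (seg A lt e z) = Suc (card (seg A lt e y))"
proof -
  obtain z where z: "z \<in> A" "lt y z" "\<And>w. w \<in> A \<Longrightarrow> lt y w \<Longrightarrow> \<not> lt w z"
    using assms(5) by (auto simp: no_succ_def)
  have ez: "lt e z" using assms z trans[of e y z] by auto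
  have "w \<in> seg A lt e y" if w: "w \<in> seg A lt e z" "w \<noteq> z" for w
  proof -
    have "w \<in> A" "lt w z" using w by (auto simp: seg_def)
    then have "w = y \<or> lt w y" using z(3) total[OF _ assms(2), of w] by blast
    then show ?thesis using w by (auto simp: seg_def)
  qed
  moreover have "w \<in> seg A lt e z" if "w \<in> seg A lt e y" for w
    using that z(1,2) assms(2) trans[of w y z] by (auto simp: seg_def)
  moreover have "z \<in> seg A lt e z" using z(1) ez by (simp add: seg_def)
  ultimately have "seg A lt e z = insert z (seg A lt e y)" by blast
  moreover have "z \<notin> seg A lt e y"
    using z irrefl[OF z(1)] asym[OF assms(2) z(1)] by (auto simp: seg_def)
  ultimately show ?thesis using z(1) ez assms(4) by (intro bexI[of _ z]) auto
qed

text \<open>No point from \<open>a\<close> on lacks a successor, so \<open>seg_extend\<close> can be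
  iterated forever.\<close>

lemma nth_right:
  assumes "e \<in> A" "\<not> lt e a"
  shows "\<exists>y\<in>A. (e = y \<or> lt e y) \<and> finite (seg A lt e y) \<and> card (seg A lt e y) = Suc n"
proof (induction n)
  case 0
  then show ?case using assms(1) seg_same by (intro bexI[of _ e]) auto
next
  case (Suc n)
  then obtain y where y: "y \<in> A" "e = y \<or> lt e y" "finite (seg A lt e y)" "card (seg A lt e y) = Suc n"
    by blast
  have "\<not> lt y a" using y(1,2) assms a_in trans[of e y a] by auto
  then show ?case using seg_extend[OF assms(1) y(1-3)] right_succ[OF y(1)] y(4) by metis
qed

text \<open>Only the last point of the run lacks a successor, so counting goes on until the run is
  used up.\<close>

lemma nth_run:
  assumes "e \<in> A" "run A lt e c" "n < c"
  shows "\<exists>y\<in>A. (e = y \<or> lt e y) \<and> finite (seg A lt e y) \<and> card (seg A lt e y) = Suc n"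
  using assms(3)
proof (induction n)
  case 0
  then show ?case using assms(1) seg_same by (intro bexI[of _ e]) auto
next
  case (Suc n)
  then obtain y where y: "y \<in> A" "e = y \<or> lt e y" "finite (seg A lt e y)" "card (seg A lt e y) = Suc n"
    by force
  obtain l where l: "l \<in> A" "e = l \<or> lt e l" "no_succ A lt l" "finite (seg A lt e l)" "card (seg A lt e l) = c"
    using assms(2) by (auto simp: run_def)
  have "y \<noteq> l" using y(4) l(5) Suc.prems by auto
  moreover have "\<not> lt l y" using infinite_seg_no_succ[OF assms(1) y(1) l(1) _ l(2,3)] y(3) by blast
  ultimately have "lt y l" using total[OF y(1) l(1)] by blast
  then have "\<not> no_succ A lt y" using infinite_seg_no_succ[OF assms(1) l(1) y(1) _ y(2)] l(4) by blast
  then show ?case using seg_extend[OF assms(1) y(1-3)] y(4) by metis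
qed

lemma card_seg_le_run:
  assumes "d \<in> A" "x \<in> A" "d = x \<or> lt d x" "finite (seg A lt d x)" "run A lt d c"
  shows "card (seg A lt d x) \<le> c"
proof -
  obtain l where l: "l \<in> A" "d = l \<or> lt d l" "no_succ A lt l" "finite (seg A lt d l)" "card (seg A lt d l) = c"
    using assms(5) by (auto simp: run_def)
  have "\<not> lt l x" using infinite_seg_no_succ[OF assms(1,2) l(1) _ l(2,3)] assms(4) by blast
  then have "x = l \<or> lt x l" using total[OF assms(2) l(1)] by blast
  then have "seg A lt d x \<subseteq> seg A lt d l"
    using trans[OF _ assms(2) l(1)] by (auto simp: seg_def)
  then show ?thesis using l(4,5) card_mono by blast
qed

lemma run_pos: "x \<in> A \<Longrightarrow> run A lt x n \<Longrightarrow> 0 < n"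
  unfolding run_def by (auto simp: card_gt_0_iff) (auto simp: seg_def)

lemma card_seg_mono:
  assumes "d \<in> A" "x \<in> A" "y \<in> A" "d = x \<or> lt d x" "lt x y" "finite (seg A lt d y)"
  shows "card (seg A lt d x) < card (seg A lt d y)"
proof (rule psubset_card_mono[OF assms(6)])
  have "y \<in> seg A lt d y" "y \<notin> seg A lt d x"
    using assms(1-5) irrefl[OF assms(3)] asym[OF assms(2,3)] trans[of d x y] by (auto simp: seg_def)
  moreover have "seg A lt d x \<subseteq> seg A lt d y"
    using assms(2,3,5) trans[of _ x y] by (auto simp: seg_def)
  ultimately show "seg A lt d x \<subset> seg A lt d y" by blast
qed

end

section \<open>Back-and-forth on first elements of blocks\<close>

lemma back_and_forth_sequence:
  assumes "P p0" "countable A" "A \<noteq> {}" "countable B" "B \<noteq> {}"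
    and "\<And>p x. P p \<Longrightarrow> x \<in> A \<Longrightarrow> \<exists>p'. P p' \<and> p \<subseteq> p' \<and> x \<in> Domain p'"
    and "\<And>p y. P p \<Longrightarrow> y \<in> B \<Longrightarrow> \<exists>p'. P p' \<and> p \<subseteq> p' \<and> y \<in> Range p'"
  shows "\<exists>s::nat \<Rightarrow> ('a \<times> 'b) set. (\<forall>n. P (s n)) \<and> mono s \<and>
    A \<subseteq> Domain (\<Union>n. s n) \<and> B \<subseteq> Range (\<Union>n. s n)"
proof -
  have "\<exists>s. \<forall>n. P (s n) \<and> (s n \<subseteq> s (Suc n) \<and>
      from_nat_into A n \<in> Domain (s (Suc n)) \<and> from_nat_into B n \<in> Range (s (Suc n)))"
  proof (rule dependent_nat_choice)
    fix p and n :: nat assume p: "P p"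
    obtain p' where p': "P p'" "p \<subseteq> p'" "from_nat_into A n \<in> Domain p'"
      using assms(6)[OF p from_nat_into[OF assms(3)], of n] by blast
    obtain p'' where "P p''" "p' \<subseteq> p''" "from_nat_into B n \<in> Range p''"
      using assms(7)[OF p'(1) from_nat_into[OF assms(5)], of n] by blast
    then show "\<exists>p''. P p'' \<and> p \<subseteq> p'' \<and> from_nat_into A n \<in> Domain p'' \<and> from_nat_into B n \<in> Range p''"
      using p' by (intro exI[of _ p'']) auto
  qed (use assms(1) in blast)
  then obtain s where s: "\<And>n. P (s n)" "\<And>n. s n \<subseteq> s (Suc n)"
    "\<And>n. from_nat_into A n \<in> Domain (s (Suc n))" "\<And>n. from_nat_into B n \<in> Range (s (Suc n))"
    by blast
  have "A \<subseteq> Domain (\<Union>n. s n)"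
  proof
    fix x assume "x \<in> A"
    then obtain n where "from_nat_into A n = x" using from_nat_into_surj[OF assms(2)] by blast
    then show "x \<in> Domain (\<Union>n. s n)" using s(3)[of n] by blast
  qed
  moreover have "B \<subseteq> Range (\<Union>n. s n)"
  proof
    fix y assume "y \<in> B"
    then obtain n where "from_nat_into B n = y" using from_nat_into_surj[OF assms(4)] by blast
    then show "y \<in> Range (\<Union>n. s n)" using s(4)[of n] by blast
  qed
  moreover have "mono s" using s(2) by (simp add: mono_iff_le_Suc)
  ultimately show ?thesis using s(1) by blast
qed


text \<open>Only first elements of blocks are matched; the other points are added at the end by
  position. Sizes have to agree below \<open>a\<close> only, since the later blocks all have type
  \<open>\<omega>\<close>, and keeping \<open>(a, b)\<close> in \<open>p\<close> makes the two zones
  correspond.\<close>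

definition first_match ::
  "'a set \<Rightarrow> ('a \<Rightarrow> 'a \<Rightarrow> bool) \<Rightarrow> 'a \<Rightarrow> 'b set \<Rightarrow> ('b \<Rightarrow> 'b \<Rightarrow> bool) \<Rightarrow> 'b \<Rightarrow> ('a \<times> 'b) set \<Rightarrow> bool" where
  "first_match A lt a B lt' b p \<longleftrightarrow> finite p \<and> (a, b) \<in> p \<and>
    (\<forall>d e. (d, e) \<in> p \<longrightarrow> d \<in> A \<and> no_pred A lt d \<and> e \<in> B \<and> no_pred B lt' e \<and>
      (lt d a \<longrightarrow> (\<exists>n. run A lt d n \<and> run B lt' e n))) \<and>
    (\<forall>d e d' e'. (d, e) \<in> p \<longrightarrow> (d', e') \<in> p \<longrightarrow> (lt d d' \<longleftrightarrow> lt' e e') \<and> (d = d' \<longleftrightarrow> e = e'))"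

lemma first_match_converse:
  assumes "first_match A lt a B lt' b p"
  shows "first_match B lt' b A lt a (p\<inverse>)"
proof -
  have ab: "(a, b) \<in> p" and fin: "finite p"
    and D: "\<And>d e. (d, e) \<in> p \<Longrightarrow> d \<in> A \<and> no_pred A lt d \<and> e \<in> B \<and> no_pred B lt' e \<and>
      (lt d a \<longrightarrow> (\<exists>n. run A lt d n \<and> run B lt' e n))"
    and O: "\<And>d e d' e'. (d, e) \<in> p \<Longrightarrow> (d', e') \<in> p \<Longrightarrow> (lt d d' \<longleftrightarrow> lt' e e') \<and> (d = d' \<longleftrightarrow> e = e')"
    using assms unfolding first_match_def by blast+
  show ?thesis unfolding first_match_def
  proof (intro conjI allI impI)
    fix e d assume "(e, d) \<in> p\<inverse>"
    then have de: "(d, e) \<in> p" by simp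
    show "e \<in> B" "no_pred B lt' e" "d \<in> A" "no_pred A lt d" using D[OF de] by blast+
    show "\<exists>n. run B lt' e n \<and> run A lt d n" if "lt' e b"
      using D[OF de] O[OF de ab] that by blast
  next
    fix e d e' d' assume "(e, d) \<in> p\<inverse>" "(e', d') \<in> p\<inverse>"
    then show "lt' e e' = lt d d'" "(e = e') = (d = d')" using O[of d e d' e'] by simp_all
  qed (use ab fin in auto)
qed

text \<open>The position of \<open>d\<close> relative to \<open>a\<close> decides the zone of its
  image: below \<open>b\<close>, \<open>left_dense\<close> supplies a block of the required size;
  above \<open>b\<close>, any block given by \<open>right_dense\<close> or
  \<open>right_unbounded\<close> will do.\<close>

lemma first_match_forth:
  assumes M: "shuffle_model A lt a" and N: "shuffle_model B lt' b"
    and p: "first_match A lt a B lt' b p" and d: "d \<in> A" "no_pred A lt d"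
  shows "\<exists>p'. first_match A lt a B lt' b p' \<and> p \<subseteq> p' \<and> d \<in> Domain p'"
proof (cases "d \<in> Domain p")
  case True
  then show ?thesis using p by blast
next
  case False
  interpret M: shuffle_model A lt a by fact
  interpret N: shuffle_model B lt' b by fact
  have ab: "(a, b) \<in> p" and fin: "finite p"
    and D: "\<And>d e. (d, e) \<in> p \<Longrightarrow> d \<in> A \<and> no_pred A lt d \<and> e \<in> B \<and> no_pred B lt' e \<and>
      (lt d a \<longrightarrow> (\<exists>n. run A lt d n \<and> run B lt' e n))"
    and O: "\<And>d e d' e'. (d, e) \<in> p \<Longrightarrow> (d', e') \<in> p \<Longrightarrow> (lt d d' \<longleftrightarrow> lt' e e') \<and> (d = d' \<longleftrightarrow> e = e')"
    using p unfolding first_match_def by blast+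
  define lo where "lo = snd ` {z\<in>p. lt (fst z) d}"
  define up where "up = snd ` {z\<in>p. lt d (fst z)}"
  have lo: "e \<in> lo \<longleftrightarrow> (\<exists>d'. (d', e) \<in> p \<and> lt d' d)" for e by (force simp: lo_def)
  have up: "e \<in> up \<longleftrightarrow> (\<exists>d'. (d', e) \<in> p \<and> lt d d')" for e by (force simp: up_def)
  have sub: "finite lo" "finite up" "lo \<subseteq> B" "up \<subseteq> B"
    using fin D by (auto simp: lo_def up_def)
  have lu: "lt' l u" if l: "l \<in> lo" and u: "u \<in> up" for l u
  proof -
    obtain d1 d2 where *: "(d1, l) \<in> p" "lt d1 d" "(d2, u) \<in> p" "lt d d2" using l u lo up by blast
    then have "lt d1 d2" using M.trans[of d1 d d2] D d(1) by blast
    then show ?thesis using O[OF *(1,3)] by blast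
  qed
  have cases: "lt d a \<or> lt a d" using M.total[OF d(1) M.a_in] False ab by blast
  have "\<exists>e\<in>B. no_pred B lt' e \<and> (\<forall>l\<in>lo. lt' l e) \<and> (\<forall>u\<in>up. lt' e u) \<and>
     (lt d a \<longrightarrow> (\<exists>n. run A lt d n \<and> run B lt' e n))"
  proof (cases "lt d a")
    case True
    then have b: "b \<in> up" using up ab by blast
    then obtain u where u: "u \<in> up" "\<forall>z\<in>up. z = u \<or> lt' u z"
      using N.finite_has_least[OF sub(2,4)] by blast
    have uB: "u \<in> B" "no_pred B lt' u" using u(1) up D by blast+
    \<comment> \<open>\<open>left_dense\<close> admits upper ends up to and including
      \<open>b\<close>, and \<open>b\<close> itself is one of the upper constraints.\<close>
    have ub: "\<not> lt' b u" using u(2) b N.irrefl[OF N.a_in] N.asym[OF uB(1) N.a_in] by metis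
    obtain x where x: "x \<in> B" "lt' x u" "\<forall>z\<in>lo. z = x \<or> lt' z x"
    proof (cases "lo = {}")
      case True
      then show ?thesis using N.left_unbounded[OF uB(1)] that by blast
    next
      case False
      then obtain x where "x \<in> lo" "\<forall>z\<in>lo. z = x \<or> lt' z x"
        using N.finite_has_greatest[OF sub(1,3)] by blast
      then show ?thesis using that[of x] lu u(1) sub(3) by blast
    qed
    obtain n where n: "run A lt d n" using M.left_run[OF d(1) True] by blast
    obtain e where e: "e \<in> B" "lt' x e" "lt' e u" "no_pred B lt' e" "run B lt' e n"
      using N.left_dense[OF x(1) uB(1) x(2) ub uB(2) M.run_pos[OF d(1) n]] by blast
    have "lt' l e" if "l \<in> lo" for l
      using x(3) that e(2) N.trans[of l x e] sub(3) x(1) e(1) by (metis subsetD)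
    moreover have "lt' e v" if "v \<in> up" for v
      using u(2) that e(3) N.trans[of e u v] sub(4) uB(1) e(1) by (metis subsetD)
    ultimately show ?thesis using e n by blast
  next
    case False
    then have "lt a d" using cases by blast
    then have b: "b \<in> lo" using lo ab by blast
    then obtain x where x: "x \<in> lo" "\<forall>z\<in>lo. z = x \<or> lt' z x"
      using N.finite_has_greatest[OF sub(1,3)] by blast
    have xB: "x \<in> B" using x(1) sub(3) by blast
    have xb: "\<not> lt' x b" using x(2) b N.irrefl[OF N.a_in] N.asym[OF N.a_in xB] by metis
    have lo': "lt' l e" if "l \<in> lo" "lt' x e" "e \<in> B" for l e
      using x(2) that N.trans[of l x e] sub(3) xB by (metis subsetD)
    show ?thesis
    proof (cases "up = {}")
      case True
      obtain e where "e \<in> B" "lt' x e" "no_pred B lt' e" using N.right_unbounded[OF xB xb] by blast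
      then show ?thesis using True False lo' by blast
    next
      case upne: False
      then obtain u where u: "u \<in> up" "\<forall>z\<in>up. z = u \<or> lt' u z"
        using N.finite_has_least[OF sub(2,4)] by blast
      have uB: "u \<in> B" "no_pred B lt' u" using u(1) up D by blast+
      obtain e where e: "e \<in> B" "lt' x e" "lt' e u" "no_pred B lt' e"
        using N.right_dense[OF xB uB(1) xb lu[OF x(1) u(1)] uB(2)] by blast
      have "lt' e v" if "v \<in> up" for v
        using u(2) that e(3) N.trans[of e u v] sub(4) uB(1) e(1) by (metis subsetD)
      then show ?thesis using e lo' False by blast
    qed
  qed
  then obtain e where e: "e \<in> B" "no_pred B lt' e" "\<And>l. l \<in> lo \<Longrightarrow> lt' l e" "\<And>u. u \<in> up \<Longrightarrow> lt' e u"
     "lt d a \<longrightarrow> (\<exists>n. run A lt d n \<and> run B lt' e n)" by blast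
  have comp: "(lt d d' \<longleftrightarrow> lt' e e') \<and> (lt d' d \<longleftrightarrow> lt' e' e) \<and> d \<noteq> d' \<and> e \<noteq> e'" if q: "(d', e') \<in> p" for d' e'
  proof -
    have A: "d' \<in> A" "e' \<in> B" using D[OF q] by blast+
    have "d \<noteq> d'" using q False by blast
    then consider "lt d d'" | "lt d' d" using M.total[OF d(1) A(1)] by blast
    then show ?thesis
    proof cases
      case 1
      then have "lt' e e'" using e(4) up q by blast
      then show ?thesis using 1 M.asym[OF d(1) A(1)] N.asym[OF e(1) A(2)] M.irrefl[OF d(1)] N.irrefl[OF e(1)] by blast
    next
      case 2
      then have "lt' e' e" using e(3) lo q by blast
      then show ?thesis using 2 M.asym[OF A(1) d(1)] N.asym[OF A(2) e(1)] M.irrefl[OF d(1)] N.irrefl[OF e(1)] by blast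
    qed
  qed
  have "first_match A lt a B lt' b (insert (d, e) p)"
    unfolding first_match_def
  proof (intro conjI allI impI)
    fix d1 e1 assume "(d1, e1) \<in> insert (d, e) p"
    then consider "d1 = d" "e1 = e" | "(d1, e1) \<in> p" by blast
    then have "d1 \<in> A \<and> no_pred A lt d1 \<and> e1 \<in> B \<and> no_pred B lt' e1 \<and>
      (lt d1 a \<longrightarrow> (\<exists>n. run A lt d1 n \<and> run B lt' e1 n))"
      by cases (use d e D in blast)+
    then show "d1 \<in> A" "no_pred A lt d1" "e1 \<in> B" "no_pred B lt' e1"
      "lt d1 a \<Longrightarrow> \<exists>n. run A lt d1 n \<and> run B lt' e1 n" by blast+
  next
    fix d1 e1 d2 e2 assume 1: "(d1, e1) \<in> insert (d, e) p" and 2: "(d2, e2) \<in> insert (d, e) p"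
    show "lt d1 d2 = lt' e1 e2" "(d1 = d2) = (e1 = e2)"
      using 1 2 comp[of d1 e1] comp[of d2 e2] O[of d1 e1 d2 e2] M.irrefl[OF d(1)] N.irrefl[OF e(1)]
      by auto
  qed (use ab fin in auto)
  then show ?thesis by blast
qed

text \<open>Once the first elements are matched, a point is determined by the first element of its
  block and its position there; \<open>G\<close> relates points for which both agree.\<close>

lemma shuffle_model_iso:
  assumes M: "shuffle_model A lt a" and N: "shuffle_model B lt' b"
    and cnt: "countable A" "countable B"
  shows "\<exists>h. bij_betw h A B \<and> (\<forall>x\<in>A. \<forall>y\<in>A. lt x y \<longleftrightarrow> lt' (h x) (h y))"
proof -
  interpret M: shuffle_model A lt a by fact
  interpret N: shuffle_model B lt' b by fact
  let ?D = "{d\<in>A. no_pred A lt d}" and ?E = "{e\<in>B. no_pred B lt' e}"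
  let ?P = "first_match A lt a B lt' b"
  have "\<exists>s::nat \<Rightarrow> ('a \<times> 'b) set. (\<forall>n. ?P (s n)) \<and> mono s \<and>
    ?D \<subseteq> Domain (\<Union>n. s n) \<and> ?E \<subseteq> Range (\<Union>n. s n)"
  proof (rule back_and_forth_sequence)
    show "?P {(a, b)}"
      using M.a_in N.a_in M.a_first N.a_first M.irrefl N.irrefl by (simp add: first_match_def)
    show "countable ?D" "countable ?E" using cnt by auto
    show "?D \<noteq> {}" "?E \<noteq> {}" using M.a_in N.a_in M.a_first N.a_first by blast+
    show "\<exists>p'. ?P p' \<and> p \<subseteq> p' \<and> x \<in> Domain p'" if "?P p" "x \<in> ?D" for p x
      using first_match_forth[OF M N that(1)] that(2) by blast
    show "\<exists>p'. ?P p' \<and> p \<subseteq> p' \<and> y \<in> Range p'" if py: "?P p" "y \<in> ?E" for p y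
    proof -
      obtain p' where p': "first_match B lt' b A lt a p'" "p\<inverse> \<subseteq> p'" "y \<in> Domain p'"
        using first_match_forth[OF N M first_match_converse[OF py(1)]] py(2) by blast
      then show ?thesis using first_match_converse[OF p'(1)] by (intro exI[of _ "p'\<inverse>"]) auto
    qed
  qed
  then obtain s :: "nat \<Rightarrow> ('a \<times> 'b) set" where s: "\<And>n. ?P (s n)" "mono s"
    "?D \<subseteq> Domain (\<Union>n. s n)" "?E \<subseteq> Range (\<Union>n. s n)" by blast
  define H where "H = (\<Union>n. s n)"
  have D: "d \<in> A \<and> no_pred A lt d \<and> e \<in> B \<and> no_pred B lt' e \<and>
      (lt d a \<longrightarrow> (\<exists>n. run A lt d n \<and> run B lt' e n))" if "(d, e) \<in> H" for d e
    using that s(1) unfolding H_def first_match_def by blast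
  have O: "(lt d d' \<longleftrightarrow> lt' e e') \<and> (d = d' \<longleftrightarrow> e = e')" if de: "(d, e) \<in> H" "(d', e') \<in> H" for d e d' e'
  proof -
    obtain m n where "(d, e) \<in> s m" "(d', e') \<in> s n" using de by (auto simp: H_def)
    then have "(d, e) \<in> s (max m n)" "(d', e') \<in> s (max m n)"
      using monoD[OF s(2), of m "max m n"] monoD[OF s(2), of n "max m n"] by auto
    then show ?thesis using s(1)[of "max m n"] unfolding first_match_def by blast
  qed
  have abH: "(a, b) \<in> H" using s(1)[of 0] by (auto simp: H_def first_match_def)
  define G where "G = {(x, y). x \<in> A \<and> y \<in> B \<and> (\<exists>d e. (d, e) \<in> H \<and> (d = x \<or> lt d x) \<and> (e = y \<or> lt' e y) \<and>
     finite (seg A lt d x) \<and> finite (seg B lt' e y) \<and> card (seg A lt d x) = card (seg B lt' e y))}"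
  have G_mono: "lt' y y'" if g: "(x, y) \<in> G" "(x', y') \<in> G" "lt x x'" for x y x' y'
  proof -
    have A: "x \<in> A" "y \<in> B" "x' \<in> A" "y' \<in> B" using g by (auto simp: G_def)
    obtain d e where de: "(d, e) \<in> H" "d = x \<or> lt d x" "e = y \<or> lt' e y"
      "finite (seg A lt d x)" "finite (seg B lt' e y)" "card (seg A lt d x) = card (seg B lt' e y)"
      using g(1) by (auto simp: G_def)
    obtain d' e' where de': "(d', e') \<in> H" "d' = x' \<or> lt d' x'" "e' = y' \<or> lt' e' y'"
      "finite (seg A lt d' x')" "finite (seg B lt' e' y')" "card (seg A lt d' x') = card (seg B lt' e' y')"
      using g(2) by (auto simp: G_def)
    note D = D[OF de(1)] D[OF de'(1)]
    have dA: "d \<in> A" "d' \<in> A" "e \<in> B" "e' \<in> B" using D by blast+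
    consider "d = d'" | "lt d d'" | "lt d' d" using M.total[OF dA(1,2)] by blast
    then show ?thesis
    proof cases
      case 1
      then have e: "e = e'" using O[OF de(1) de'(1)] by blast
      have "card (seg A lt d x) < card (seg A lt d x')"
        using M.card_seg_mono[OF dA(1) A(1,3) de(2) g(3)] de'(4) 1 by blast
      then have "card (seg B lt' e y) < card (seg B lt' e y')" using de(6) de'(6) 1 e by simp
      moreover have "card (seg B lt' e y') < card (seg B lt' e y)" if "lt' y' y"
        using N.card_seg_mono[OF dA(3) A(4,2) _ that de(5)] de'(3) e by blast
      ultimately show ?thesis using N.total[OF A(2,4)] by fastforce
    next
      case 2
      then have ee: "lt' e e'" using O[OF de(1) de'(1)] by blast
      \<comment> \<open>The finite interval from \<open>e\<close> to \<open>y\<close> cannot contain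
        \<open>e'\<close>, the start of a later block.\<close>
      have "\<not> (e' = y \<or> lt' e' y)"
        using N.infinite_seg_no_pred[OF dA(3) A(2) dA(4) ee] D de(5) by blast
      then have "lt' y e'" using N.total[OF A(2) dA(4)] by blast
      then show ?thesis using de'(3) N.trans[OF A(2) dA(4) A(4)] by blast
    next
      case 3
      have "d = x' \<or> lt d x'" using de(2) g(3) M.trans[OF dA(1) A(1) A(3)] by blast
      then show ?thesis
        using M.infinite_seg_no_pred[OF dA(2) A(3) dA(1) 3] D de'(4) by blast
    qed
  qed
  have G_inv: "lt x x'" if g: "(x, y) \<in> G" "(x', y') \<in> G" "lt' y y'" for x y x' y'
  proof -
    have A: "x \<in> A" "y \<in> B" "x' \<in> A" "y' \<in> B" using g by (auto simp: G_def)
    obtain d e where de: "(d, e) \<in> H" "d = x \<or> lt d x" "e = y \<or> lt' e y"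
      "finite (seg A lt d x)" "finite (seg B lt' e y)" "card (seg A lt d x) = card (seg B lt' e y)"
      using g(1) by (auto simp: G_def)
    obtain d' e' where de': "(d', e') \<in> H" "d' = x' \<or> lt d' x'" "e' = y' \<or> lt' e' y'"
      "finite (seg A lt d' x')" "finite (seg B lt' e' y')" "card (seg A lt d' x') = card (seg B lt' e' y')"
      using g(2) by (auto simp: G_def)
    note D = D[OF de(1)] D[OF de'(1)]
    have dA: "d \<in> A" "d' \<in> A" "e \<in> B" "e' \<in> B" using D by blast+
    have "x \<noteq> x'"
    proof
      assume x: "x = x'"
      \<comment> \<open>A point has only one first element of a block at finite distance below
        it.\<close>
      have "d = d'"
        using M.total[OF dA(1,2)] M.infinite_seg_no_pred[OF dA(1) A(1) dA(2)]
          M.infinite_seg_no_pred[OF dA(2) A(3) dA(1)] D de de' x by blast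
      then have e: "e = e'" using O[OF de(1) de'(1)] by blast
      have "card (seg B lt' e y) < card (seg B lt' e y')"
        using N.card_seg_mono[OF dA(3) A(2,4) de(3) g(3)] de'(5) e by blast
      then show False using de(6) de'(6) x \<open>d = d'\<close> e by simp
    qed
    moreover have "\<not> lt x' x" using G_mono[OF g(2,1)] N.asym[OF A(2,4) g(3)] by blast
    ultimately show ?thesis using M.total[OF A(1,3)] by blast
  qed
  have G_eq: "x = x' \<longleftrightarrow> y = y'" if g: "(x, y) \<in> G" "(x', y') \<in> G" for x y x' y'
  proof -
    have A: "x \<in> A" "y \<in> B" "x' \<in> A" "y' \<in> B" using g by (auto simp: G_def)
    show ?thesis
      using M.total[OF A(1,3)] N.total[OF A(2,4)] G_mono[OF g] G_mono[OF g(2,1)] G_inv[OF g] G_inv[OF g(2,1)]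
        M.irrefl[OF A(1)] N.irrefl[OF A(2)] by blast
  qed
  have G_dom: "\<exists>y. (x, y) \<in> G" if x: "x \<in> A" for x
  proof -
    obtain d where d: "d \<in> A" "d = x \<or> lt d x" "no_pred A lt d" "finite (seg A lt d x)"
      using M.blocks[OF x] by blast
    obtain e where e: "(d, e) \<in> H" using s(3) d(1,3) unfolding H_def by blast
    have "d \<in> seg A lt d x" using d by (auto simp: seg_def)
    then obtain n where n: "card (seg A lt d x) = Suc n" using d(4) by (metis card_gt_0_iff empty_iff gr0_implies_Suc)
    have "\<exists>y\<in>B. (e = y \<or> lt' e y) \<and> finite (seg B lt' e y) \<and> card (seg B lt' e y) = Suc n"
    proof (cases "lt d a")
      case True
      then obtain c where c: "run A lt d c" "run B lt' e c" using D[OF e] by blast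
      have "n < c" using M.card_seg_le_run[OF d(1) x d(2,4) c(1)] n by simp
      then show ?thesis using N.nth_run[OF _ c(2)] D[OF e] by blast
    next
      case False
      then have "\<not> lt' e b" using O[OF e abH] by blast
      then show ?thesis using N.nth_right D[OF e] by blast
    qed
    then obtain y where "y \<in> B" "e = y \<or> lt' e y" "finite (seg B lt' e y)" "card (seg B lt' e y) = Suc n"
      by blast
    then have "(x, y) \<in> G" unfolding G_def mem_Collect_eq case_prod_conv
      using x d(2,4) e n by metis
    then show ?thesis by blast
  qed
  have G_ran: "\<exists>x. (x, y) \<in> G" if y: "y \<in> B" for y
  proof -
    obtain e where e: "e \<in> B" "e = y \<or> lt' e y" "no_pred B lt' e" "finite (seg B lt' e y)"
      using N.blocks[OF y] by blast
    obtain d where d: "(d, e) \<in> H" using s(4) e(1,3) unfolding H_def by blast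
    have "e \<in> seg B lt' e y" using e by (auto simp: seg_def)
    then obtain n where n: "card (seg B lt' e y) = Suc n" using e(4) by (metis card_gt_0_iff empty_iff gr0_implies_Suc)
    have "\<exists>x\<in>A. (d = x \<or> lt d x) \<and> finite (seg A lt d x) \<and> card (seg A lt d x) = Suc n"
    proof (cases "lt d a")
      case True
      then obtain c where c: "run A lt d c" "run B lt' e c" using D[OF d] by blast
      have "n < c" using N.card_seg_le_run[OF e(1) y e(2,4) c(2)] n by simp
      then show ?thesis using M.nth_run[OF _ c(1)] D[OF d] by blast
    next
      case False
      then show ?thesis using M.nth_right D[OF d] by blast
    qed
    then obtain x where "x \<in> A" "d = x \<or> lt d x" "finite (seg A lt d x)" "card (seg A lt d x) = Suc n"
      by blast
    then have "(x, y) \<in> G" unfolding G_def mem_Collect_eq case_prod_conv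
      using y e(2,4) d n by metis
    then show ?thesis by blast
  qed
  obtain h where h: "\<And>x. x \<in> A \<Longrightarrow> (x, h x) \<in> G" using G_dom by metis
  have "bij_betw h A B"
    unfolding bij_betw_def
  proof
    show "inj_on h A" using h G_eq by (metis inj_onI)
    show "h ` A = B"
    proof (intro subset_antisym subsetI)
      fix y assume "y \<in> h ` A"
      then show "y \<in> B" using h by (auto simp: G_def)
    next
      fix y assume "y \<in> B"
      then obtain x where x: "(x, y) \<in> G" using G_ran by blast
      then have "x \<in> A" by (auto simp: G_def)
      then show "y \<in> h ` A" using h[of x] G_eq[OF x, of x "h x"] by blast
    qed
  qed
  moreover have "lt x y \<longleftrightarrow> lt' (h x) (h y)" if "x \<in> A" "y \<in> A" for x y
    using G_mono[OF h h] G_inv[OF h h] that by blast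
  ultimately show ?thesis by blast
qed

text \<open>The axioms in the shape whose complexity is computed later: implications become
  disjunctions, finiteness becomes a bound by some \<open>n\<close> and thus a countable
  disjunction, and positive sizes are written \<open>Suc n\<close>.\<close>

lemma shuffle_model_iff:
  "shuffle_model A lt a \<longleftrightarrow>
    (\<forall>x\<in>A. \<not> lt x x) \<and>
    (\<forall>x\<in>A. \<forall>y\<in>A. \<forall>z\<in>A. \<not> lt x y \<or> \<not> lt y z \<or> lt x z) \<and>
    (\<forall>x\<in>A. \<forall>y\<in>A. lt x y \<or> x = y \<or> lt y x) \<and>
    a \<in> A \<and> no_pred A lt a \<and>
    (\<forall>x\<in>A. \<exists>n. \<exists>d\<in>A. (d = x \<or> lt d x) \<and> no_pred A lt d \<and>
       finite (seg A lt d x) \<and> card (seg A lt d x) < n) \<and>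
    (\<forall>x\<in>A. lt x a \<or> \<not> no_succ A lt x) \<and>
    (\<forall>x\<in>A. \<not> lt x a \<or> (\<exists>n. run A lt x n)) \<and>
    (\<forall>x\<in>A. \<forall>y\<in>A. lt x a \<or> \<not> lt x y \<or> \<not> no_pred A lt y \<or>
       (\<exists>z\<in>A. lt x z \<and> lt z y \<and> no_pred A lt z)) \<and>
    (\<forall>x\<in>A. lt x a \<or> (\<exists>z\<in>A. lt x z \<and> no_pred A lt z)) \<and>
    (\<forall>y\<in>A. \<exists>x\<in>A. lt x y) \<and>
    (\<forall>n. \<forall>x\<in>A. \<forall>y\<in>A. \<not> lt x y \<or> lt a y \<or> \<not> no_pred A lt y \<or>
       (\<exists>z\<in>A. lt x z \<and> lt z y \<and> no_pred A lt z \<and> run A lt z (Suc n)))"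
proof -
  have pos: "(\<forall>n. P (Suc n)) \<longleftrightarrow> (\<forall>n>0. P n)" for P :: "nat \<Rightarrow> bool"
    using gr0_conv_Suc by auto
  show ?thesis
    unfolding pos[of "\<lambda>n. \<forall>x\<in>A. \<forall>y\<in>A. \<not> lt x y \<or> lt a y \<or> \<not> no_pred A lt y \<or>
       (\<exists>z\<in>A. lt x z \<and> lt z y \<and> no_pred A lt z \<and> run A lt z n)"] shuffle_model_def conj_assoc
    by (intro arg_cong2[of _ _ _ _ "(\<and>)"]; blast)
qed

text \<open>The axioms mention only \<open>A\<close>, \<open>lt\<close> and \<open>a\<close>, so
  each conjunct of \<open>shuffle_model_iff\<close> is carried along \<open>f\<close> by
  rewriting.\<close>

lemma shuffle_model_transfer:
  assumes "bij_betw f A B" and lt: "\<And>x y. x \<in> A \<Longrightarrow> y \<in> A \<Longrightarrow> lt' (f x) (f y) \<longleftrightarrow> lt x y"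
    and M: "shuffle_model A lt a"
  shows "shuffle_model B lt' (f a)"
proof -
  have B: "B = f ` A" and inj: "inj_on f A" using assms(1) by (auto simp: bij_betw_def)
  have eq: "f x = f y \<longleftrightarrow> x = y" if "x \<in> A" "y \<in> A" for x y using inj that by (auto dest: inj_onD)
  have a: "a \<in> A" using M by (rule shuffle_model.a_in)
  have seg: "seg B lt' (f x) (f y) = f ` seg A lt x y" if "x \<in> A" "y \<in> A" for x y
    using that unfolding seg_def B by (auto simp: eq lt image_iff)
  have fc: "finite (seg B lt' (f x) (f y)) \<longleftrightarrow> finite (seg A lt x y)"
    "card (seg B lt' (f x) (f y)) = card (seg A lt x y)" if "x \<in> A" "y \<in> A" for x y
  proof -
    have "inj_on f (seg A lt x y)" using inj by (rule inj_on_subset) (auto simp: seg_def)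
    then show "finite (seg B lt' (f x) (f y)) \<longleftrightarrow> finite (seg A lt x y)"
      "card (seg B lt' (f x) (f y)) = card (seg A lt x y)"
      by (simp_all add: seg that finite_image_iff card_image)
  qed
  have np: "no_pred B lt' (f x) \<longleftrightarrow> no_pred A lt x" "no_succ B lt' (f x) \<longleftrightarrow> no_succ A lt x"
    if "x \<in> A" for x
    using that unfolding no_pred_def no_succ_def B by (simp_all add: lt)
  have rn: "run B lt' (f x) n \<longleftrightarrow> run A lt x n" if "x \<in> A" for x n
  proof -
    have "run B lt' (f x) n \<longleftrightarrow> (\<exists>l\<in>A. (f x = f l \<or> lt' (f x) (f l)) \<and> no_succ B lt' (f l) \<and>
     finite (seg B lt' (f x) (f l)) \<and> card (seg B lt' (f x) (f l)) = n)"
      unfolding run_def B by simp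
    also have "\<dots> \<longleftrightarrow> run A lt x n"
      unfolding run_def using that by (intro bex_cong) (simp_all add: eq lt np fc)
    finally show ?thesis .
  qed
  then have rn: "run B lt' (f x) = run A lt x" if "x \<in> A" for x using that by (intro ext)
  have all: "(\<forall>y\<in>B. P y) \<longleftrightarrow> (\<forall>x\<in>A. P (f x))" and ex: "(\<exists>y\<in>B. P y) \<longleftrightarrow> (\<exists>x\<in>A. P (f x))" for P
    by (auto simp: B)
  have fa: "f a \<in> B" using a B by blast
  have "shuffle_model B lt' (f a) \<longleftrightarrow> shuffle_model A lt a"
    unfolding shuffle_model_iff all ex
    by (intro arg_cong2[of _ _ _ _ "(\<and>)"]; simp add: a fa eq lt np rn fc)
  then show ?thesis using M by blast
qed

section \<open>Checking the axioms in the two orders\<close>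

lemma block_size_pos: "0 < block_size t"
  by (simp add: block_size_def)

lemma seg_same_block:
  assumes "(t, m) \<in> X" "X = LO q \<or> X = LO_lim"
  shows "seg X (<) (t, i) (t, m) = Pair t ` {i..m}"
proof -
  have "(t, j) \<in> X" if "j \<le> m" for j
    using assms that by (auto simp: LO_def LO_lim_def shuf_def)
  then show ?thesis by (force simp: seg_def)
qed

text \<open>A point below \<open>(t, 0)\<close> has a smaller index, so
  \<open>LO_infinite_gap\<close> puts points in between; for positive \<open>m\<close> the
  predecessor is the previous element of the block.\<close>

lemma no_pred_LO_iff:
  assumes "0 < q" "(t, m) \<in> LO q"
  shows "no_pred (LO q) (<) (t, m) \<longleftrightarrow> m = 0"
proof
  assume np: "no_pred (LO q) (<) (t, m)"
  show "m = 0"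
  proof (rule ccontr)
    assume "m \<noteq> 0"
    then obtain j where j: "m = Suc j" using not0_implies_Suc by blast
    have "(t, j) \<in> LO q" using assms(2) by (auto simp: LO_def shuf_def j)
    moreover have "(t, j) < (t, m)" by (simp add: j)
    ultimately obtain z where "(t, j) < z" "z < (t, m)" using np unfolding no_pred_def by blast
    then show False by (cases z) (auto simp: j)
  qed
next
  assume m: "m = 0"
  show "no_pred (LO q) (<) (t, m)"
    unfolding no_pred_def
  proof (intro ballI impI)
    fix y assume y: "y \<in> LO q" "y < (t, m)"
    then have "fst y < t" by (cases y) (auto simp: m)
    then have "infinite {u\<in>LO q. (\<forall>x\<in>{y}. x < u) \<and> (\<forall>x\<in>{(t, m)}. u < x)}"
      using y(1) assms by (intro LO_infinite_gap) auto
    then show "\<exists>z\<in>LO q. y < z \<and> z < (t, m)"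
      using not_finite_existsD by auto
  qed
qed

text \<open>Every later point has a larger index, and a finite block starts in between; the minimum
  with 0 keeps it in \<open>shuf\<close>.\<close>

lemma no_succ_last:
  assumes "t < 0" "X = LO q \<and> 0 < q \<or> X = LO_lim" "block_size t = Suc n"
  shows "no_succ X (<) (t, n)"
  unfolding no_succ_def
proof (intro ballI impI)
  fix y assume y: "y \<in> X" "(t, n) < y"
  have "t < fst y"
    using y assms by (cases y) (auto simp: LO_def LO_lim_def shuf_def)
  then obtain s where s: "t < s" "s < min (fst y) 0" using assms(1) dense[of t "min (fst y) 0"] by auto
  then have "(s, 0) \<in> X" using assms(2) by (auto simp: LO_def LO_lim_def shuf_def block_size_pos)
  moreover have "(t, n) < (s, 0)" "(s, 0) < y" using s by (auto simp: less_prod_def)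
  ultimately show "\<exists>z\<in>X. (t, n) < z \<and> z < y" by blast
qed

lemma not_no_succ:
  fixes t :: rat
  assumes "(t, Suc n) \<in> X"
  shows "\<not> no_succ X (<) (t, n)"
proof
  assume "no_succ X (<) (t, n)"
  moreover have "(t, n) < (t, Suc n)" by simp
  ultimately obtain z where "(t, n) < z" "z < (t, Suc n)" using assms unfolding no_succ_def by blast
  then show False by (cases z) auto
qed

lemma run_LO:
  assumes "t < 0" "(t, m) \<in> LO q" "0 < q"
  shows "run (LO q) (<) (t, m) (block_size t - m)"
proof -
  obtain n where n: "block_size t = Suc n" using block_size_pos gr0_implies_Suc by blast
  have in_LO: "(t, n) \<in> LO q" using assms(1) n by (simp add: LO_def shuf_def)
  have "m \<le> n" using assms n by (auto simp: LO_def shuf_def)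
  then show ?thesis
    unfolding run_def using in_LO no_succ_last[OF assms(1) _ n, of "LO q" q] assms(3) n
      seg_same_block[OF in_LO, of q m]
    by (intro bexI[of _ "(t, n)"]) (auto simp: card_image inj_on_def)
qed

lemma shuffle_model_LO: "shuffle_model (LO 1) (<) (1, 0)"
proof
  show in_LO: "(1, 0) \<in> LO 1" by (simp add: LO_def)
  show "no_pred (LO 1) (<) (1, 0)" using no_pred_LO_iff[OF _ in_LO] by simp
  have np: "snd y = 0" if "no_pred (LO 1) (<) y" "y \<in> LO 1" for y
    using no_pred_LO_iff[of 1 "fst y" "snd y"] that by simp
  have lt1: "fst x < 0" if "x \<in> LO 1" "x < (1, 0)" for x
    using that by (cases x) (auto simp: LO_def shuf_def)
  have ge1: "1 \<le> fst x" if "\<not> x < (1, 0)" for x :: "rat \<times> nat"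
    using that by (cases x) auto
  fix x :: "rat \<times> nat" assume x: "x \<in> LO 1"
  obtain t m where tm: "x = (t, m)" by fastforce
  show "\<exists>d\<in>LO 1. (d = x \<or> d < x) \<and> no_pred (LO 1) (<) d \<and> finite (seg (LO 1) (<) d x)"
  proof (rule bexI[of _ "(t, 0)"])
    show t0: "(t, 0) \<in> LO 1" using x by (auto simp: tm LO_def shuf_def)
    show "((t, 0) = x \<or> (t, 0) < x) \<and> no_pred (LO 1) (<) (t, 0) \<and> finite (seg (LO 1) (<) (t, 0) x)"
      using no_pred_LO_iff[OF _ t0] seg_same_block[of t m "LO 1" 1 0] x by (auto simp: tm)
  qed
  show "\<not> no_succ (LO 1) (<) x" if "\<not> x < (1, 0)"
    using ge1[OF that] not_no_succ[of t m "LO 1"] by (simp add: tm LO_def)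
  show "\<exists>n. run (LO 1) (<) x n" if "x < (1, 0)"
    using run_LO[of t m 1] lt1[OF x that] x by (auto simp: tm)
  show "\<exists>z\<in>LO 1. x < z \<and> no_pred (LO 1) (<) z" if "\<not> x < (1, 0)"
    using ge1[OF that] no_pred_LO_iff[of 1 "t + 1" 0]
    by (intro bexI[of _ "(t + 1, 0)"]) (auto simp: tm LO_def)
  show "\<exists>y\<in>LO 1. y < x"
    by (intro bexI[of _ "(min t 0 - 1, 0)"]) (auto simp: tm LO_def shuf_def block_size_pos)
  fix y :: "rat \<times> nat" assume y: "y \<in> LO 1"
  show "\<exists>z\<in>LO 1. x < z \<and> z < y \<and> no_pred (LO 1) (<) z"
    if xy: "\<not> x < (1, 0)" "x < y" "no_pred (LO 1) (<) y"
  proof -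
    obtain t' where t': "y = (t', 0)" using np[OF xy(3) y] by (metis prod.collapse)
    have "t < t'" using that(2) by (auto simp: tm t')
    then obtain s where s: "t < s" "s < t'" using dense by blast
    then have "(s, 0) \<in> LO 1" using ge1[OF that(1)] by (simp add: tm LO_def)
    then show ?thesis using s no_pred_LO_iff[of 1 s 0] by (intro bexI[of _ "(s, 0)"]) (auto simp: tm t')
  qed
  show "\<exists>z\<in>LO 1. x < z \<and> z < y \<and> no_pred (LO 1) (<) z \<and> run (LO 1) (<) z n"
    if xy: "x < y" "\<not> (1, 0) < y" "no_pred (LO 1) (<) y" "0 < n" for n
  proof -
    obtain t' where t': "y = (t', 0)" using np[OF xy(3) y] by (metis prod.collapse)
    have "t < t'" "t' \<le> 1" using that(1,2) by (auto simp: tm t')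
    then have "t < 0" using x by (auto simp: tm LO_def shuf_def)
    \<comment> \<open>The upper end \<open>y\<close> may be the parameter itself, so 0 is imposed as
      a second bound to obtain a finite block.\<close>
    then obtain s where s: "t < s" "s < min t' 0" "block_size s = n"
      using block_size_dense[of t "min t' 0" n] \<open>t < t'\<close> xy(4) by auto
    then have "(s, 0) \<in> LO 1" using block_size_pos[of s] by (simp add: LO_def shuf_def)
    then show ?thesis using s no_pred_LO_iff[of 1 s 0] run_LO[of s 0 1]
      by (intro bexI[of _ "(s, 0)"]) (auto simp: tm t')
  qed
qed (auto simp: LO_def)

lemma not_shuffle_model_LO_lim: "\<not> shuffle_model LO_lim (<) a"
proof
  assume M: "shuffle_model LO_lim (<) a"
  interpret shuffle_model LO_lim "(<)" a by fact
  obtain t m where tm: "a = (t, m)" by fastforce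
  consider "t < 0" | "0 < t" using a_in by (auto simp: tm LO_lim_def shuf_def)
  then show False
  proof cases
    case 1
    \<comment> \<open>The last point of the finite block containing \<open>a\<close> violates
      \<open>right_succ\<close>.\<close>
    obtain n where n: "block_size t = Suc n" using block_size_pos gr0_implies_Suc by blast
    have "(t, n) \<in> LO_lim" using 1 n by (simp add: LO_lim_def shuf_def)
    moreover have "\<not> (t, n) < a" using a_in 1 n by (auto simp: tm LO_lim_def shuf_def)
    ultimately show False using right_succ no_succ_last[OF 1 _ n, of LO_lim] by blast
  next
    case 2
    \<comment> \<open>Halving the index gives an \<open>\<omega>\<close>-block below
      \<open>a\<close>, and no run starting there or later has an end.\<close>
    have "(t / 2, 0) \<in> LO_lim" "(t / 2, 0) < a" using 2 by (auto simp: tm LO_lim_def)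
    then obtain n where "run LO_lim (<) (t / 2, 0) n" using left_run by blast
    then obtain l where l: "(t / 2, 0) = l \<or> (t / 2, 0) < l" "no_succ LO_lim (<) l"
      by (auto simp: run_def)
    then have "0 < fst l" using 2 by (cases l) auto
    then have "(fst l, Suc (snd l)) \<in> LO_lim" by (simp add: LO_lim_def)
    then show False using not_no_succ[of "fst l" "snd l"] l(2) by simp
  qed
qed

section \<open>A Scott sentence\<close>

definition slt :: "struc \<Rightarrow> nat \<Rightarrow> nat \<Rightarrow> bool" where
  "slt M x y \<longleftrightarrow> (x, y) \<in> snd M \<and> x \<noteq> y"

lemma pdef_le: "pdef j F P \<Longrightarrow> j \<le> k \<Longrightarrow> pdef k F P"
  by (induction k) (auto simp: le_Suc_eq intro: pdef_SucI)

lemma sdef_le: "sdef j F P \<Longrightarrow> j \<le> k \<Longrightarrow> sdef k F P"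
  by (induction k) (auto simp: le_Suc_eq intro: sdef_SucI)

lemma sdef_imp_pdef: "sdef j F P \<Longrightarrow> j < k \<Longrightarrow> pdef k F P"
  using sdef_imp_pdef_Suc pdef_le by (metis Suc_leI)

lemma pdef_imp_sdef: "pdef j F P \<Longrightarrow> j < k \<Longrightarrow> sdef k F P"
  using pdef_imp_sdef_Suc sdef_le by (metis Suc_leI)

lemma qf_pdef: "pdef 0 F P \<Longrightarrow> pdef k F P"
  using pdef_le by blast

lemma qf_sdef: "pdef 0 F P \<Longrightarrow> sdef k F P"
  unfolding sdef_0_iff[symmetric] using sdef_le by blast

lemma qf_Not: "pdef 0 F P \<Longrightarrow> pdef 0 F (\<lambda>M e. \<not> P M e)"
  by (simp add: pdef_Not_iff sdef_0_iff)

lemma qf_disj: "pdef 0 F P \<Longrightarrow> pdef 0 F Q \<Longrightarrow> pdef 0 F (\<lambda>M e. P M e \<or> Q M e)"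
  using sdef_disj[of 0] by (simp add: sdef_0_iff)

lemma qf_slt: "x \<in> F \<Longrightarrow> y \<in> F \<Longrightarrow> pdef 0 F (\<lambda>M e. slt M (e x) (e y))"
  unfolding slt_def by (intro pdef_conj qf_Not pdef_Eq pdef_Le)

lemma qf_ball_less:
  assumes "\<And>i. i < n \<Longrightarrow> pdef 0 F (P i)"
  shows "pdef 0 F (\<lambda>M e. \<forall>i<n::nat. P i M e)"
  using assms
proof (induction n)
  case 0
  show ?case unfolding pdef_def
    by (intro exI[of _ "Conj {} (\<lambda>_. Eq 0 0)"]) (auto simp: is_Pi_0_iff intro!: fin_qf.intros)
next
  case (Suc n)
  have "pdef 0 F (\<lambda>M e. (\<forall>i<n. P i M e) \<and> P n M e)"
    using Suc by (intro pdef_conj) auto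
  then show ?case by (rule pdef_cong) (auto simp: less_Suc_eq)
qed

text \<open>Binds \<open>n\<close> consecutive variables at once, as the counting formulas require
  for arbitrary \<open>n\<close>.\<close>

lemma sdef_bex_many:
  assumes "sdef (Suc k) (F \<union> {c..<c + n}) P"
  shows "sdef (Suc k) F (\<lambda>M e. \<exists>g. (\<forall>i<n. g i \<in> fst M) \<and>
    P M (\<lambda>v. if c \<le> v \<and> v < c + n then g (v - c) else e v))"
  using assms
proof (induction n arbitrary: P)
  case 0
  have "(\<lambda>v. if c \<le> v \<and> v < c + 0 then g (v - c) else e v) = e" for g e :: "nat \<Rightarrow> nat" by auto
  then show ?case using 0 by simp
next
  case (Suc n)
  have "F \<union> {c..<c + Suc n} = insert (c + n) (F \<union> {c..<c + n})" by auto
  then have "sdef (Suc k) (insert (c + n) (F \<union> {c..<c + n})) P"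
    using Suc.prems by (simp only:)
  then have "sdef (Suc k) (F \<union> {c..<c + n}) (\<lambda>M e. \<exists>a\<in>fst M. P M (e(c + n := a)))"
    by (rule sdef_bex)
  from Suc.IH[OF this] show ?case
  proof (rule sdef_cong)
    fix M :: struc and e :: "nat \<Rightarrow> nat"
    let ?o = "\<lambda>n g v. if c \<le> v \<and> v < c + n then g (v - c) else e v"
    have o: "?o (Suc n) g = (?o n g)(c + n := g n)" for g by (auto simp: fun_eq_iff)
    have o': "?o (Suc n) (g(n := a)) = (?o n g)(c + n := a)" for g a by (auto simp: fun_eq_iff)
    show "(\<exists>g. (\<forall>i<n. g i \<in> fst M) \<and> (\<exists>a\<in>fst M. P M ((?o n g)(c + n := a)))) =
      (\<exists>g. (\<forall>i<Suc n. g i \<in> fst M) \<and> P M (?o (Suc n) g))"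
    proof
      assume "\<exists>g. (\<forall>i<n. g i \<in> fst M) \<and> (\<exists>a\<in>fst M. P M ((?o n g)(c + n := a)))"
      then obtain g a where g: "\<forall>i<n. g i \<in> fst M" "a \<in> fst M" "P M ((?o n g)(c + n := a))" by blast
      then show "\<exists>g. (\<forall>i<Suc n. g i \<in> fst M) \<and> P M (?o (Suc n) g)"
        unfolding o'[symmetric] by (intro exI[of _ "g(n := a)"]) (auto simp: less_Suc_eq)
    next
      assume "\<exists>g. (\<forall>i<Suc n. g i \<in> fst M) \<and> P M (?o (Suc n) g)"
      then obtain g where g: "\<forall>i<Suc n. g i \<in> fst M" "P M ((?o n g)(c + n := g n))" unfolding o by blast
      then show "\<exists>g. (\<forall>i<n. g i \<in> fst M) \<and> (\<exists>a\<in>fst M. P M ((?o n g)(c + n := a)))"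
        by (intro exI[of _ g]) auto
    qed
  qed
qed

section \<open>Levels of the individual axioms\<close>

lemma ex_inj_iff_card_ge:
  "(\<exists>g. (\<forall>i<n. g i \<in> S) \<and> (\<forall>i<n. \<forall>j<n. i = j \<or> g i \<noteq> g j)) \<longleftrightarrow> \<not> (finite S \<and> card S < n)"
  for n :: nat
proof
  assume "\<exists>g. (\<forall>i<n. g i \<in> S) \<and> (\<forall>i<n. \<forall>j<n. i = j \<or> g i \<noteq> g j)"
  then obtain g where g: "g ` {..<n} \<subseteq> S" "inj_on g {..<n}" by (auto simp: inj_on_def)
  show "\<not> (finite S \<and> card S < n)"
    using card_mono[OF _ g(1)] card_image[OF g(2)] by auto
next
  assume "\<not> (finite S \<and> card S < n)"
  then obtain T where T: "T \<subseteq> S" "finite T" "card T = n"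
    by (meson infinite_arbitrarily_large linorder_not_less obtain_subset_with_card_n)
  then obtain g where g: "bij_betw g {0..<n} T" using ex_bij_betw_nat_finite[OF T(2)] by blast
  have "g i \<in> S" if "i < n" for i using bij_betwE[OF g] T(1) that by auto
  moreover have "i = j \<or> g i \<noteq> g j" if "i < n" "j < n" for i j
    using inj_onD[OF bij_betw_imp_inj_on[OF g], of i j] that by auto
  ultimately show "\<exists>g. (\<forall>i<n. g i \<in> S) \<and> (\<forall>i<n. \<forall>j<n. i = j \<or> g i \<noteq> g j)" by blast
qed

abbreviation mseg where "mseg M \<equiv> seg (fst M) (slt M)"

text \<open>Having at least \<open>n\<close> elements asks for \<open>n\<close> distinct witnesses,
  which is existential. They occupy the variables from 10 on; 0 is kept for the parameter, 1 to 3
  for points, 4 for the end of a run, 5 and 6 for the quantifiers in \<open>no_pred\<close> and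
  \<open>no_succ\<close>.\<close>

lemma sdef_card_seg:
  assumes "u \<in> F" "v \<in> F" "u < 10" "v < 10"
  shows "sdef 1 F (\<lambda>M e. \<not> (finite (mseg M (e u) (e v)) \<and> card (mseg M (e u) (e v)) < n))"
proof -
  let ?F = "F \<union> {10..<10 + n}"
  let ?P = "\<lambda>M e. (\<forall>i<n. (e u = e (10 + i) \<or> slt M (e u) (e (10 + i))) \<and>
       (e (10 + i) = e v \<or> slt M (e (10 + i)) (e v))) \<and>
     (\<forall>i<n. \<forall>j<n. i = j \<or> e (10 + i) \<noteq> e (10 + j))"
  have "pdef 0 ?F ?P"
  proof (intro pdef_conj qf_ball_less)
    fix i j assume "i < n" "j < n"
    show "pdef 0 ?F (\<lambda>M e. i = j \<or> e (10 + i) \<noteq> e (10 + j))"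
    proof (cases "i = j")
      case True
      have "pdef 0 ?F (\<lambda>M e. e u = e u)" using assms by (intro pdef_Eq) auto
      then show ?thesis using True by (simp add: pdef_cong)
    next
      case False
      have "pdef 0 ?F (\<lambda>M e. \<not> e (10 + i) = e (10 + j))"
        using \<open>i < n\<close> \<open>j < n\<close> by (intro qf_Not pdef_Eq) auto
      then show ?thesis using False by (simp add: pdef_cong)
    qed
  qed (use assms in \<open>auto intro!: qf_disj pdef_Eq qf_slt\<close>)
  then have "sdef (Suc 0) ?F ?P" by (rule qf_sdef)
  from sdef_bex_many[OF this] show ?thesis
    unfolding One_nat_def
  proof (rule sdef_cong)
    fix M :: struc and e :: "nat \<Rightarrow> nat"
    show "(\<exists>g. (\<forall>i<n. g i \<in> fst M) \<and> ?P M (\<lambda>v. if 10 \<le> v \<and> v < 10 + n then g (v - 10) else e v)) =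
      (\<not> (finite (mseg M (e u) (e v)) \<and> card (mseg M (e u) (e v)) < n))"
      unfolding ex_inj_iff_card_ge[symmetric]
      using assms(3,4) by (intro arg_cong[of _ _ Ex] ext) (auto simp: seg_def)
  qed
qed

lemma pdef_card_seg:
  assumes "u \<in> F" "v \<in> F" "u < 10" "v < 10"
  shows "pdef 1 F (\<lambda>M e. finite (mseg M (e u) (e v)) \<and> card (mseg M (e u) (e v)) < n)"
  using sdef_card_seg[OF assms] unfolding sdef_Not_iff .

lemma pdef_no_pred:
  assumes "v \<in> F" "v < 5"
  shows "pdef 2 F (\<lambda>M e. no_pred (fst M) (slt M) (e v))"
proof -
  have "sdef (Suc 0) (insert 6 (insert 5 F)) (\<lambda>M e. slt M (e 5) (e 6) \<and> slt M (e 6) (e v))"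
    using assms by (intro qf_sdef pdef_conj qf_slt) auto
  from sdef_bex[OF this] have "sdef (Suc 0) (insert 5 F) (\<lambda>M e. \<exists>z\<in>fst M. slt M (e 5) z \<and> slt M z (e v))"
    using assms by simp
  then have "sdef (Suc 0) (insert 5 F) (\<lambda>M e. \<not> slt M (e 5) (e v) \<or> (\<exists>z\<in>fst M. slt M (e 5) z \<and> slt M z (e v)))"
    by (rule sdef_disj[OF qf_sdef[OF qf_Not[OF qf_slt]], rotated 2]) (use assms in auto)
  from pdef_ball[OF sdef_imp_pdef_Suc[OF this]] show ?thesis
    using assms by (simp add: no_pred_def numeral_2_eq_2)
qed

lemma pdef_no_succ:
  assumes "v \<in> F" "v < 5"
  shows "pdef 2 F (\<lambda>M e. no_succ (fst M) (slt M) (e v))"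
proof -
  have "sdef (Suc 0) (insert 6 (insert 5 F)) (\<lambda>M e. slt M (e v) (e 6) \<and> slt M (e 6) (e 5))"
    using assms by (intro qf_sdef pdef_conj qf_slt) auto
  from sdef_bex[OF this] have "sdef (Suc 0) (insert 5 F) (\<lambda>M e. \<exists>z\<in>fst M. slt M (e v) z \<and> slt M z (e 5))"
    using assms by simp
  then have "sdef (Suc 0) (insert 5 F) (\<lambda>M e. \<not> slt M (e v) (e 5) \<or> (\<exists>z\<in>fst M. slt M (e v) z \<and> slt M z (e 5)))"
    by (rule sdef_disj[OF qf_sdef[OF qf_Not[OF qf_slt]], rotated 2]) (use assms in auto)
  from pdef_ball[OF sdef_imp_pdef_Suc[OF this]] show ?thesis
    using assms by (simp add: no_succ_def numeral_2_eq_2)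
qed

text \<open>The matrix of \<open>run\<close>, with the last element of the run as a free variable, so that further
  conjuncts can be added before quantifying it.\<close>

lemma pdef_run_to:
  assumes "v \<in> F" "v < 4" "4 \<in> F"
  shows "pdef 2 F (\<lambda>M e. (e v = e 4 \<or> slt M (e v) (e 4)) \<and> no_succ (fst M) (slt M) (e 4) \<and>
    finite (mseg M (e v) (e 4)) \<and> card (mseg M (e v) (e 4)) = n)"
proof -
  let ?S = "\<lambda>M e. mseg M (e v) (e 4)"
  have 1: "pdef 2 F (\<lambda>M e. e v = e 4 \<or> slt M (e v) (e 4))"
    by (rule qf_pdef, intro qf_disj pdef_Eq qf_slt assms)
  have 2: "pdef 2 F (\<lambda>M e. no_succ (fst M) (slt M) (e 4))"
    using assms by (intro pdef_no_succ) auto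
  have 3: "pdef 2 F (\<lambda>M e. finite (?S M e) \<and> card (?S M e) < Suc n)"
    by (rule pdef_le[OF pdef_card_seg]) (use assms in auto)
  have 4: "pdef 2 F (\<lambda>M e. \<not> (finite (?S M e) \<and> card (?S M e) < n))"
    by (rule sdef_imp_pdef[OF sdef_card_seg]) (use assms in auto)
  from pdef_conj[OF 1 pdef_conj[OF 2 pdef_conj[OF 3 4]]] show ?thesis
    by (rule pdef_cong) auto
qed

lemma pdef_ballI:
  assumes "pdef k (insert x F) P" "0 < k" "\<And>M e. (\<forall>a\<in>fst M. P M (e(x := a))) = Q M e"
  shows "pdef k F Q"
  using pdef_ball[of "k - 1" x F P] assms by (simp add: pdef_def)

lemma sdef_bexI:
  assumes "sdef k (insert x F) P" "0 < k" "\<And>M e. (\<exists>a\<in>fst M. P M (e(x := a))) = Q M e"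
  shows "sdef k F Q"
  using sdef_bex[of "k - 1" x F P] assms by (simp add: sdef_def)

lemma sdef_run:
  assumes "v \<in> F" "v < 4"
  shows "sdef 3 F (\<lambda>M e. run (fst M) (slt M) (e v) n)"
  by (rule sdef_bexI[where x = 4, OF pdef_imp_sdef[OF pdef_run_to[where v = v and n = n]]])
    (use assms in \<open>auto simp: run_def\<close>)

text \<open>For each bound \<open>n\<close> the statement about \<open>x\<close> is
  \<open>\<Sigma>\<^sub>3\<close>, and so is the countable disjunction over \<open>n\<close>;
  quantifying \<open>x\<close> gives \<open>\<Pi>\<^sub>4\<close>.\<close>

lemma pdef_shuffle_model_blocks:
  "pdef 4 {0} (\<lambda>M e. \<forall>x\<in>fst M. \<exists>n. \<exists>d\<in>fst M. (d = x \<or> slt M d x) \<and> no_pred (fst M) (slt M) d \<and>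
       finite (mseg M d x) \<and> card (mseg M d x) < n)"
proof -
  have "sdef 3 {1, 0} (\<lambda>M e. \<exists>d\<in>fst M. (d = e 1 \<or> slt M d (e 1)) \<and> no_pred (fst M) (slt M) d \<and>
       finite (mseg M d (e 1)) \<and> card (mseg M d (e 1)) < n)" for n
  proof (rule sdef_bexI[where x = 2])
    have 1: "pdef 2 {2, 1, 0} (\<lambda>M e. e 2 = e 1 \<or> slt M (e 2) (e 1))"
      by (rule qf_pdef, intro qf_disj pdef_Eq qf_slt) auto
    have 2: "pdef 2 {2, 1, 0} (\<lambda>M e. no_pred (fst M) (slt M) (e 2))"
      by (rule pdef_no_pred) auto
    have 3: "pdef 2 {2, 1, 0} (\<lambda>M e. finite (mseg M (e 2) (e 1)) \<and> card (mseg M (e 2) (e 1)) < n)"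
      by (rule pdef_le[OF pdef_card_seg]) auto
    show "sdef 3 {2, 1, 0} (\<lambda>M e. (e 2 = e 1 \<or> slt M (e 2) (e 1)) \<and> no_pred (fst M) (slt M) (e 2) \<and>
      finite (mseg M (e 2) (e 1)) \<and> card (mseg M (e 2) (e 1)) < n)"
      by (rule pdef_imp_sdef[OF pdef_conj[OF 1 pdef_conj[OF 2 3]]]) simp
  qed simp_all
  then have "sdef (Suc 2) {1, 0} (\<lambda>M e. \<exists>n. \<exists>d\<in>fst M. (d = e 1 \<or> slt M d (e 1)) \<and> no_pred (fst M) (slt M) d \<and>
       finite (mseg M d (e 1)) \<and> card (mseg M d (e 1)) < n)"
    by (intro sdef_SUP) simp
  from sdef_imp_pdef[OF this, of 4] show ?thesis
    by (rule pdef_ballI[where x = 1]) simp_all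
qed

text \<open>The \<open>\<Pi>\<^sub>2\<close> premise on \<open>y\<close> occurs negated, so it stays
  within \<open>\<Sigma>\<^sub>3\<close> like the conclusion.\<close>

lemma pdef_shuffle_model_right_dense:
  "pdef 4 {0} (\<lambda>M e. \<forall>x\<in>fst M. \<forall>y\<in>fst M. slt M x (e 0) \<or> \<not> slt M x y \<or> \<not> no_pred (fst M) (slt M) y \<or>
       (\<exists>z\<in>fst M. slt M x z \<and> slt M z y \<and> no_pred (fst M) (slt M) z))"
proof -
  let ?F = "{2, 1, 0}"
  have 1: "pdef 2 (insert 3 ?F) (\<lambda>M e. slt M (e 1) (e 3))" "pdef 2 (insert 3 ?F) (\<lambda>M e. slt M (e 3) (e 2))"
    "pdef 2 (insert 3 ?F) (\<lambda>M e. no_pred (fst M) (slt M) (e 3))"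
    by (rule qf_pdef, rule qf_slt; simp)+ (rule pdef_no_pred; simp)
  have 2: "sdef 3 ?F (\<lambda>M e. \<exists>z\<in>fst M. slt M (e 1) z \<and> slt M z (e 2) \<and> no_pred (fst M) (slt M) z)"
    by (rule sdef_bexI[where x = 3, OF pdef_imp_sdef[OF pdef_conj[OF 1(1) pdef_conj[OF 1(2,3)]]]]) auto
  have 3: "sdef 3 ?F (\<lambda>M e. \<not> no_pred (fst M) (slt M) (e 2))"
    unfolding sdef_Not_iff by (rule pdef_le[OF pdef_no_pred]) auto
  have 4: "sdef 3 ?F (\<lambda>M e. slt M (e 1) (e 0))" "sdef 3 ?F (\<lambda>M e. \<not> slt M (e 1) (e 2))"
    by (intro qf_sdef qf_slt; simp) (intro qf_sdef qf_Not qf_slt; simp)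
  have 5: "pdef 4 ?F (\<lambda>M e. slt M (e 1) (e 0) \<or> \<not> slt M (e 1) (e 2) \<or> \<not> no_pred (fst M) (slt M) (e 2) \<or>
       (\<exists>z\<in>fst M. slt M (e 1) z \<and> slt M z (e 2) \<and> no_pred (fst M) (slt M) z))"
    by (rule sdef_imp_pdef[OF sdef_disj[OF 4(1) sdef_disj[OF 4(2) sdef_disj[OF 3 2]]]]) simp
  have "pdef 4 {1, 0} (\<lambda>M e. \<forall>y\<in>fst M. slt M (e 1) (e 0) \<or> \<not> slt M (e 1) y \<or> \<not> no_pred (fst M) (slt M) y \<or>
       (\<exists>z\<in>fst M. slt M (e 1) z \<and> slt M z y \<and> no_pred (fst M) (slt M) z))"
    by (rule pdef_ballI[where x = 2, OF 5]) simp_all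
  then show ?thesis by (rule pdef_ballI[where x = 1]) simp_all
qed

lemma pdef_shuffle_model_left_dense:
  "pdef 4 {0} (\<lambda>M e. \<forall>x\<in>fst M. \<forall>y\<in>fst M. \<not> slt M x y \<or> slt M (e 0) y \<or> \<not> no_pred (fst M) (slt M) y \<or>
       (\<exists>z\<in>fst M. slt M x z \<and> slt M z y \<and> no_pred (fst M) (slt M) z \<and> run (fst M) (slt M) z n))"
proof -
  let ?F = "{2, 1, 0}"
  let ?R = "\<lambda>M x l. (x = l \<or> slt M x l) \<and> no_succ (fst M) (slt M) l \<and>
    finite (mseg M x l) \<and> card (mseg M x l) = n"
  have 1: "pdef 2 (insert 4 (insert 3 ?F)) (\<lambda>M e. slt M (e 1) (e 3))"
    "pdef 2 (insert 4 (insert 3 ?F)) (\<lambda>M e. slt M (e 3) (e 2))"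
    "pdef 2 (insert 4 (insert 3 ?F)) (\<lambda>M e. no_pred (fst M) (slt M) (e 3))"
    "pdef 2 (insert 4 (insert 3 ?F)) (\<lambda>M e. ?R M (e 3) (e 4))"
    by (rule qf_pdef, rule qf_slt; simp)+ (rule pdef_no_pred pdef_run_to; simp)+
  \<comment> \<open>The end \<open>l\<close> of the run is quantified outside the whole conjunction.
    All conjuncts are then \<open>\<Pi>\<^sub>2\<close>, as \<open>pdef_conj\<close>
    requires.\<close>
  have "sdef 3 (insert 3 ?F) (\<lambda>M e. \<exists>l\<in>fst M. slt M (e 1) (e 3) \<and> slt M (e 3) (e 2) \<and> no_pred (fst M) (slt M) (e 3) \<and> ?R M (e 3) l)"
    by (rule sdef_bexI[where x = 4, OF pdef_imp_sdef[OF pdef_conj[OF 1(1) pdef_conj[OF 1(2) pdef_conj[OF 1(3,4)]]]]]) auto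
  then have 2: "sdef 3 ?F (\<lambda>M e. \<exists>z\<in>fst M. slt M (e 1) z \<and> slt M z (e 2) \<and> no_pred (fst M) (slt M) z \<and> run (fst M) (slt M) z n)"
    by (rule sdef_bexI[where x = 3]) (simp_all add: run_def)
  have 3: "sdef 3 ?F (\<lambda>M e. \<not> no_pred (fst M) (slt M) (e 2))"
    unfolding sdef_Not_iff by (rule pdef_le[OF pdef_no_pred]) auto
  have 4: "sdef 3 ?F (\<lambda>M e. slt M (e 0) (e 2))" "sdef 3 ?F (\<lambda>M e. \<not> slt M (e 1) (e 2))"
    by (intro qf_sdef qf_slt; simp) (intro qf_sdef qf_Not qf_slt; simp)
  have 5: "pdef 4 ?F (\<lambda>M e. \<not> slt M (e 1) (e 2) \<or> slt M (e 0) (e 2) \<or> \<not> no_pred (fst M) (slt M) (e 2) \<or>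
       (\<exists>z\<in>fst M. slt M (e 1) z \<and> slt M z (e 2) \<and> no_pred (fst M) (slt M) z \<and> run (fst M) (slt M) z n))"
    by (rule sdef_imp_pdef[OF sdef_disj[OF 4(2) sdef_disj[OF 4(1) sdef_disj[OF 3 2]]]]) simp
  have "pdef 4 {1, 0} (\<lambda>M e. \<forall>y\<in>fst M. \<not> slt M (e 1) y \<or> slt M (e 0) y \<or> \<not> no_pred (fst M) (slt M) y \<or>
       (\<exists>z\<in>fst M. slt M (e 1) z \<and> slt M z y \<and> no_pred (fst M) (slt M) z \<and> run (fst M) (slt M) z n))"
    by (rule pdef_ballI[where x = 2, OF 5]) simp_all
  then show ?thesis by (rule pdef_ballI[where x = 1]) simp_all
qed

text \<open>All axioms are \<open>\<Pi>\<^sub>4\<close> in variable 0, the parameter, and one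
  existential quantifier leads to level 5. Reflexivity is demanded separately because
  \<open>slt\<close> ignores the diagonal.\<close>

lemma sdef_shuffle_model:
  "sdef 5 {} (\<lambda>M e. (\<forall>x\<in>fst M. (x, x) \<in> snd M) \<and> (\<exists>a\<in>fst M. shuffle_model (fst M) (slt M) a))"
proof -
  have refl: "pdef 4 {0} (\<lambda>M e. \<forall>x\<in>fst M. (x, x) \<in> snd M)"
    by (rule pdef_ballI[where x = 1 and P = "\<lambda>M e. (e 1, e 1) \<in> snd M"])
      (simp_all add: qf_pdef pdef_Le)
  have 1: "pdef 4 {0} (\<lambda>M e. \<forall>x\<in>fst M. \<not> slt M x x)"
    by (rule pdef_ballI[where x = 1 and P = "\<lambda>M e. \<not> slt M (e 1) (e 1)"])
      (simp_all add: qf_pdef qf_Not qf_slt)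
  have "pdef 4 {3, 2, 1, 0} (\<lambda>M e. \<not> slt M (e 1) (e 2) \<or> \<not> slt M (e 2) (e 3) \<or> slt M (e 1) (e 3))"
    by (rule qf_pdef, intro qf_disj qf_Not qf_slt) auto
  then have "pdef 4 {2, 1, 0} (\<lambda>M e. \<forall>z\<in>fst M. \<not> slt M (e 1) (e 2) \<or> \<not> slt M (e 2) z \<or> slt M (e 1) z)"
    by (rule pdef_ballI[where x = 3]) simp_all
  then have "pdef 4 {1, 0} (\<lambda>M e. \<forall>y\<in>fst M. \<forall>z\<in>fst M. \<not> slt M (e 1) y \<or> \<not> slt M y z \<or> slt M (e 1) z)"
    by (rule pdef_ballI[where x = 2]) simp_all
  then have 2: "pdef 4 {0} (\<lambda>M e. \<forall>x\<in>fst M. \<forall>y\<in>fst M. \<forall>z\<in>fst M. \<not> slt M x y \<or> \<not> slt M y z \<or> slt M x z)"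
    by (rule pdef_ballI[where x = 1]) simp_all
  have "pdef 4 {2, 1, 0} (\<lambda>M e. slt M (e 1) (e 2) \<or> e 1 = e 2 \<or> slt M (e 2) (e 1))"
    by (rule qf_pdef, intro qf_disj pdef_Eq qf_slt) auto
  then have "pdef 4 {1, 0} (\<lambda>M e. \<forall>y\<in>fst M. slt M (e 1) y \<or> e 1 = y \<or> slt M y (e 1))"
    by (rule pdef_ballI[where x = 2]) simp_all
  then have 3: "pdef 4 {0} (\<lambda>M e. \<forall>x\<in>fst M. \<forall>y\<in>fst M. slt M x y \<or> x = y \<or> slt M y x)"
    by (rule pdef_ballI[where x = 1]) simp_all
  have 5: "pdef 4 {0} (\<lambda>M e. no_pred (fst M) (slt M) (e 0))"
    by (rule pdef_le[OF pdef_no_pred]) auto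
  have up: "pdef 4 F P" if "sdef 3 F P" for F P
    using that by (rule sdef_imp_pdef) simp
  have s: "sdef 3 {1, 0} (\<lambda>M e. slt M (e 1) (e 0))" "sdef 3 {1, 0} (\<lambda>M e. \<not> slt M (e 1) (e 0))"
    by (intro qf_sdef qf_slt; simp) (intro qf_sdef qf_Not qf_slt; simp)
  have "sdef 3 {1, 0} (\<lambda>M e. \<not> no_succ (fst M) (slt M) (e 1))"
    unfolding sdef_Not_iff by (rule pdef_le[OF pdef_no_succ]) auto
  from up[OF sdef_disj[OF s(1) this]]
  have 7: "pdef 4 {0} (\<lambda>M e. \<forall>x\<in>fst M. slt M x (e 0) \<or> \<not> no_succ (fst M) (slt M) x)"
    by (rule pdef_ballI[where x = 1]) simp_all
  have "sdef (Suc 2) {1, 0} (\<lambda>M e. \<exists>n. run (fst M) (slt M) (e 1) n)"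
    by (rule sdef_SUP) (use sdef_run[of 1 "{1, 0}"] in simp)
  then have "sdef 3 {1, 0} (\<lambda>M e. \<exists>n. run (fst M) (slt M) (e 1) n)" by simp
  from up[OF sdef_disj[OF s(2) this]]
  have 8: "pdef 4 {0} (\<lambda>M e. \<forall>x\<in>fst M. \<not> slt M x (e 0) \<or> (\<exists>n. run (fst M) (slt M) x n))"
    by (rule pdef_ballI[where x = 1]) simp_all
  have q: "pdef 2 {2, 1, 0} (\<lambda>M e. slt M (e 1) (e 2))" "pdef 2 {2, 1, 0} (\<lambda>M e. no_pred (fst M) (slt M) (e 2))"
    by (rule qf_pdef, rule qf_slt; simp) (rule pdef_no_pred; simp)
  have "sdef 3 {1, 0} (\<lambda>M e. \<exists>z\<in>fst M. slt M (e 1) z \<and> no_pred (fst M) (slt M) z)"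
    by (rule sdef_bexI[where x = 2, OF pdef_imp_sdef[OF pdef_conj[OF q]]]) simp_all
  from up[OF sdef_disj[OF s(1) this]]
  have 10: "pdef 4 {0} (\<lambda>M e. \<forall>x\<in>fst M. slt M x (e 0) \<or> (\<exists>z\<in>fst M. slt M x z \<and> no_pred (fst M) (slt M) z))"
    by (rule pdef_ballI[where x = 1]) simp_all
  have "sdef 3 {2, 1, 0} (\<lambda>M e. slt M (e 2) (e 1))" by (intro qf_sdef qf_slt) auto
  then have "sdef 3 {1, 0} (\<lambda>M e. \<exists>x\<in>fst M. slt M x (e 1))"
    by (rule sdef_bexI[where x = 2]) simp_all
  from up[OF this]
  have 11: "pdef 4 {0} (\<lambda>M e. \<forall>y\<in>fst M. \<exists>x\<in>fst M. slt M x y)"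
    by (rule pdef_ballI[where x = 1]) simp_all
  have "pdef (Suc 3) {0} (\<lambda>M e. \<forall>n. \<forall>x\<in>fst M. \<forall>y\<in>fst M. \<not> slt M x y \<or> slt M (e 0) y \<or> \<not> no_pred (fst M) (slt M) y \<or>
       (\<exists>z\<in>fst M. slt M x z \<and> slt M z y \<and> no_pred (fst M) (slt M) z \<and> run (fst M) (slt M) z (Suc n)))"
    by (rule pdef_INF) (use pdef_shuffle_model_left_dense in simp)
  then have 12: "pdef 4 {0} (\<lambda>M e. \<forall>n. \<forall>x\<in>fst M. \<forall>y\<in>fst M. \<not> slt M x y \<or> slt M (e 0) y \<or> \<not> no_pred (fst M) (slt M) y \<or>
       (\<exists>z\<in>fst M. slt M x z \<and> slt M z y \<and> no_pred (fst M) (slt M) z \<and> run (fst M) (slt M) z (Suc n)))"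
    by simp
  \<comment> \<open>The order is that of \<open>shuffle_model_iff\<close>; membership of
    \<open>a\<close> comes from the bounded quantifier.\<close>
  note all = pdef_conj[OF refl pdef_conj[OF 1 pdef_conj[OF 2 pdef_conj[OF 3 pdef_conj[OF 5
    pdef_conj[OF pdef_shuffle_model_blocks pdef_conj[OF 7 pdef_conj[OF 8
    pdef_conj[OF pdef_shuffle_model_right_dense pdef_conj[OF 10 pdef_conj[OF 11 12]]]]]]]]]]]
  show ?thesis
    by (rule sdef_bexI[where x = 0, OF pdef_imp_sdef[OF all]])
      (simp_all only: shuffle_model_iff fun_upd_same, auto)
qed

section \<open>Complexity\<close>

text \<open>The level \<open>\<alpha>\<close> has to be positive, as a quantifier-free formula need
  not be a disjunction.\<close>

lemma is_Sigma_mono: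
  assumes "is_Sigma \<alpha> \<phi>" "0 < \<alpha>" "\<alpha> \<le> \<beta>"
  shows "is_Sigma \<beta> \<phi>"
proof -
  obtain I f where If: "\<phi> = Disj I f"
    "\<And>i. i \<in> I \<Longrightarrow> \<exists>xs \<gamma> \<psi>. \<gamma> < \<alpha> \<and> is_Pi \<gamma> \<psi> \<and> f i = foldr FEx xs \<psi>"
    using assms(1,2) by (cases rule: is_Sigma.cases) auto
  show ?thesis unfolding If(1)
    by (rule is_Sigma_is_Pi.intros(3)) (use If(2) assms in \<open>force, meson order_less_le_trans\<close>)
qed

lemma is_Pi_ConjI:
  assumes "0 < \<alpha>" "\<And>i. i \<in> I \<Longrightarrow> \<exists>\<beta><\<alpha>. is_Sigma \<beta> (f i)"
  shows "is_Pi \<alpha> (Conj I f)"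
  by (rule is_Sigma_is_Pi.intros(4)[OF assms(1)], rule exI[of _ "[]"]) (use assms(2) in auto)

text \<open>These are the classes in which a further Scott sentence does no harm to
  minimality.\<close>

lemma Sigma_in_class_le:
  assumes "0 < \<alpha>"
  shows "\<alpha> \<le> \<beta> \<Longrightarrow> class_le (Sigma_in \<alpha>) (Sigma_in \<beta>)"
    and "\<alpha> < \<beta> \<Longrightarrow> class_le (Sigma_in \<alpha>) (Pi_in \<beta>)"
    and "\<alpha> \<le> \<beta> \<Longrightarrow> class_le (Sigma_in \<alpha>) (dSigma_in \<beta>)"
proof -
  show "class_le (Sigma_in \<alpha>) (Sigma_in \<beta>)" if "\<alpha> \<le> \<beta>"
    unfolding class_le_def
  proof
    fix \<phi> assume "\<phi> \<in> Sigma_in \<alpha>"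
    then have "\<phi> \<in> Sigma_in \<beta>" using is_Sigma_mono[OF _ assms that] by (simp add: Sigma_in_def)
    then show "\<exists>\<psi>\<in>Sigma_in \<beta>. fm_equiv \<phi> \<psi>" by (auto simp: fm_equiv_def)
  qed
  show "class_le (Sigma_in \<alpha>) (Pi_in \<beta>)" if "\<alpha> < \<beta>"
    unfolding class_le_def
  proof
    fix \<phi> assume \<phi>: "\<phi> \<in> Sigma_in \<alpha>"
    have "0 < \<beta>" using assms that by (rule order.strict_trans)
    then have "is_Pi \<beta> (Conj {0} (\<lambda>_. \<phi>))"
      by (rule is_Pi_ConjI) (use \<phi> that in \<open>auto simp: Sigma_in_def\<close>)
    then have "Conj {0} (\<lambda>_. \<phi>) \<in> Pi_in \<beta>" using \<phi> by (simp add: Pi_in_def Sigma_in_def)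
    then show "\<exists>\<psi>\<in>Pi_in \<beta>. fm_equiv \<phi> \<psi>"
      by (rule bexI[rotated]) (simp add: fm_equiv_def)
  qed
  show "class_le (Sigma_in \<alpha>) (dSigma_in \<beta>)" if "\<alpha> \<le> \<beta>"
    unfolding class_le_def
  proof
    fix \<phi> assume \<phi>: "\<phi> \<in> Sigma_in \<alpha>"
    \<comment> \<open>The \<open>\<Pi>\<close> part is the empty conjunction, which is always
      true.\<close>
    define f where "f i = (if i = 0 then \<phi> else Conj {} (\<lambda>_. \<phi>))" for i :: nat
    have "0 < \<beta>" using assms that by (rule order.strict_trans2)
    then have "f 1 \<in> Pi_in \<beta>" by (auto simp: f_def Pi_in_def intro: is_Pi_ConjI)
    moreover have "f 0 \<in> Sigma_in \<beta>"
      using \<phi> is_Sigma_mono[OF _ assms that] by (simp add: Sigma_in_def f_def)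
    ultimately have "Conj {0, 1} f \<in> dSigma_in \<beta>" unfolding dSigma_in_def by blast
    then show "\<exists>\<psi>\<in>dSigma_in \<beta>. fm_equiv \<phi> \<psi>"
      by (rule bexI[rotated]) (simp add: fm_equiv_def f_def)
  qed
qed

text \<open>The three cases are exactly those left over by \<open>Sigma_in_class_le\<close> when
  \<open>\<Sigma>\<^sub>\<beta>\<close> is the lower class.\<close>

lemma ex_Pi_equivalent:
  assumes "0 < \<alpha>" "fv \<phi> = {}"
    and "\<phi> \<in> Pi_in \<alpha> \<and> \<alpha> \<le> \<beta> \<or> \<phi> \<in> Sigma_in \<alpha> \<and> \<alpha> < \<beta> \<or> \<phi> \<in> dSigma_in \<alpha> \<and> \<alpha> < \<beta>"
  shows "\<exists>\<psi>. is_Pi \<beta> \<psi> \<and> fv \<psi> = {} \<and> (\<forall>M e. sat M \<psi> e = sat M \<phi> e)"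
proof -
  have pi: "\<exists>I f. \<psi> = Conj I f \<and> (\<forall>i\<in>I. \<exists>xs \<gamma> \<chi>. \<gamma> < \<beta> \<and> is_Sigma \<gamma> \<chi> \<and> f i = foldr FAll xs \<chi>)"
    if "is_Pi \<alpha> \<psi>" "\<alpha> \<le> \<beta>" for \<psi>
    using that assms(1) by (cases rule: is_Pi.cases) (auto, meson order_less_le_trans)
  have \<beta>: "0 < \<beta>" using assms by (auto intro: order.strict_trans2 order.strict_trans)
  from assms(3) consider "\<phi> \<in> Pi_in \<alpha>" "\<alpha> \<le> \<beta>" | "\<phi> \<in> Sigma_in \<alpha>" "\<alpha> < \<beta>" | "\<phi> \<in> dSigma_in \<alpha>" "\<alpha> < \<beta>"
    by blast
  then show ?thesis
  proof cases
    case 1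
    then have "is_Pi \<beta> \<phi>" using pi[of \<phi>] \<beta> by (auto simp: Pi_in_def intro!: is_Sigma_is_Pi.intros(4))
    then show ?thesis using assms(2) by blast
  next
    case 2
    then have "is_Pi \<beta> (Conj {0} (\<lambda>_. \<phi>))"
      by (intro is_Pi_ConjI \<beta>) (auto simp: Sigma_in_def)
    then show ?thesis using assms(2) by (intro exI[of _ "Conj {0} (\<lambda>_. \<phi>)"]) simp
  next
    case 3
    then obtain f where f: "\<phi> = Conj {0, 1} f" "is_Sigma \<alpha> (f 0)" "is_Pi \<alpha> (f 1)"
      by (auto simp: dSigma_in_def Sigma_in_def Pi_in_def)
    obtain J g where g: "f 1 = Conj J g"
      "\<And>i. i \<in> J \<Longrightarrow> \<exists>xs \<gamma> \<chi>. \<gamma> < \<beta> \<and> is_Sigma \<gamma> \<chi> \<and> g i = foldr FAll xs \<chi>"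
      using pi[OF f(3) order_less_imp_le[OF 3(2)]] by blast
    \<comment> \<open>The pair is flattened: index 0 holds the \<open>\<Sigma>\<close> part, and the
      conjuncts of the \<open>\<Pi>\<close> part are shifted by one.\<close>
    let ?\<psi> = "Conj (insert 0 (Suc ` J)) (case_nat (f 0) g)"
    have "is_Pi \<beta> ?\<psi>"
    proof (rule is_Sigma_is_Pi.intros(4)[OF \<beta>])
      fix i assume "i \<in> insert 0 (Suc ` J)"
      then consider "i = 0" | j where "j \<in> J" "i = Suc j" by blast
      then show "\<exists>xs \<gamma> \<chi>. \<gamma> < \<beta> \<and> is_Sigma \<gamma> \<chi> \<and> case_nat (f 0) g i = foldr FAll xs \<chi>"
      proof cases
        case 1
        then show ?thesis using f(2) \<open>\<alpha> < \<beta>\<close>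
          by (intro exI[of _ "[]"] exI[of _ \<alpha>] exI[of _ "f 0"]) simp
      qed (use g(2) in simp)
    qed
    moreover have "fv ?\<psi> = {}" using assms(2) f(1) g(1) by auto
    moreover have "sat M ?\<psi> e = sat M \<phi> e" for M e using f(1) g(1) by auto
    ultimately show ?thesis by blast
  qed
qed

section \<open>From orders to structures on natural numbers\<close>

lemma is_struc_order_struc: "X \<noteq> {} \<Longrightarrow> is_struc (order_struc X)"
  by (auto simp: is_struc_def order_struc_def)

lemma slt_order_struc:
  "x \<in> X \<Longrightarrow> y \<in> X \<Longrightarrow> slt (order_struc X) (to_nat x) (to_nat y) \<longleftrightarrow> x < y"
  by (auto simp: slt_def)

lemma linear_order_on_order_struc: "linear_order_on (to_nat ` X) (snd (order_struc X))"
  unfolding order_on_defs order_struc_def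
  by (auto simp: refl_on_def trans_def antisym_def total_on_def)

lemma shuffle_model_order_struc:
  "shuffle_model X (<) a \<Longrightarrow> shuffle_model (to_nat ` X) (slt (order_struc X)) (to_nat a)"
  by (rule shuffle_model_transfer[of to_nat X]) (simp_all add: slt_order_struc inj_on_imp_bij_betw inj_on_def)

lemma shuffle_model_of_order_struc:
  fixes X :: "'a::{countable,linorder} set"
  assumes "shuffle_model (to_nat ` X) (slt (order_struc X)) a"
  shows "shuffle_model X (<) (from_nat a)"
proof (rule shuffle_model_transfer[OF _ _ assms])
  show "bij_betw from_nat (to_nat ` X) X"
    by (rule bij_betw_byWitness[of _ to_nat]) auto
  show "(from_nat x :: 'a) < from_nat y \<longleftrightarrow> slt (order_struc X) x y"
    if "x \<in> to_nat ` X" "y \<in> to_nat ` X" for x y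
    using that by (auto simp: slt_order_struc)
qed

text \<open>The axioms force a linear order, so \<open>N\<close> may be any structure. One direction
  is invariance of the axioms, the other is \<open>shuffle_model_iso\<close>, with reflexivity
  recovering the weak order from the strict one.\<close>

lemma struc_iso_LO_iff:
  assumes "is_struc N"
  shows "struc_iso (order_struc (LO 1)) N \<longleftrightarrow>
    (\<forall>x\<in>fst N. (x, x) \<in> snd N) \<and> (\<exists>a\<in>fst N. shuffle_model (fst N) (slt N) a)"
proof
  let ?L = "order_struc (LO 1)"
  assume "struc_iso ?L N"
  then obtain h where h: "bij_betw h (fst ?L) (fst N)"
    "\<And>x y. x \<in> fst ?L \<Longrightarrow> y \<in> fst ?L \<Longrightarrow> (x, y) \<in> snd ?L \<longleftrightarrow> (h x, h y) \<in> snd N"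
    unfolding struc_iso_def by blast
  have "slt N (h x) (h y) \<longleftrightarrow> slt ?L x y" if "x \<in> fst ?L" "y \<in> fst ?L" for x y
    using h(2)[OF that] inj_onD[OF bij_betw_imp_inj_on[OF h(1)] _ that] unfolding slt_def by blast
  then have m: "shuffle_model (fst N) (slt N) (h (to_nat (1 :: rat, 0 :: nat)))"
    using shuffle_model_transfer[OF h(1) _ shuffle_model_order_struc[OF shuffle_model_LO, folded fst_order_struc]]
    by blast
  have "(x, x) \<in> snd N" if x: "x \<in> fst N" for x
  proof -
    obtain y where y: "y \<in> fst ?L" "x = h y" using h(1) x unfolding bij_betw_def by blast
    then have "(y, y) \<in> snd ?L" by auto
    then show ?thesis using h(2)[OF y(1,1)] y(2) by simp
  qed
  then show "(\<forall>x\<in>fst N. (x, x) \<in> snd N) \<and> (\<exists>a\<in>fst N. shuffle_model (fst N) (slt N) a)"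
    using m shuffle_model.a_in[OF m] by blast
next
  let ?L = "order_struc (LO 1)"
  assume R: "(\<forall>x\<in>fst N. (x, x) \<in> snd N) \<and> (\<exists>a\<in>fst N. shuffle_model (fst N) (slt N) a)"
  then obtain a where "shuffle_model (fst N) (slt N) a" by blast
  from shuffle_model_iso[OF shuffle_model_order_struc[OF shuffle_model_LO, folded fst_order_struc] this]
  obtain h where h: "bij_betw h (fst ?L) (fst N)"
    "\<And>x y. x \<in> fst ?L \<Longrightarrow> y \<in> fst ?L \<Longrightarrow> slt ?L x y \<longleftrightarrow> slt N (h x) (h y)"
    by auto
  have "(x, y) \<in> snd ?L \<longleftrightarrow> (h x, h y) \<in> snd N" if xy: "x \<in> fst ?L" "y \<in> fst ?L" for x y
  proof (cases "x = y")
    case True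
    then show ?thesis using R bij_betwE[OF h(1)] xy by auto
  next
    case False
    then have "h x \<noteq> h y" using inj_onD[OF bij_betw_imp_inj_on[OF h(1)] _ xy] by blast
    then show ?thesis using False h(2)[OF xy] by (simp add: slt_def)
  qed
  then show "struc_iso ?L N" unfolding struc_iso_def using h(1) by blast
qed

lemma LO_no_Pi_5_scott_sentence:
  assumes "scott_sentence (order_struc (LO 1)) \<phi>" "is_Pi (fin_ord 5) \<psi>" "fv \<psi> = {}"
    "\<And>M e. sat M \<psi> e = sat M \<phi> e"
  shows False
proof -
  have ne: "LO 1 \<noteq> {}" "LO_lim \<noteq> {}" by (auto simp: LO_def LO_lim_def)
  have iso: "struc_iso (order_struc (LO 1)) (order_struc (LO 1))"
    unfolding struc_iso_def by (intro exI[of _ id]) auto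
  define e :: "nat \<Rightarrow> nat" where "e = (\<lambda>_. to_nat (1 :: rat, 0 :: nat))"
  have e: "range e \<subseteq> fst (order_struc (LO 1))" by (auto simp: e_def LO_def)
  have "sat (order_struc (LO 1)) \<phi> e"
    using assms(1) iso is_struc_order_struc[OF ne(1)] e unfolding scott_sentence_def models_def by blast
  then have "sat (order_struc (LO 1)) \<psi> e" using assms(4) by simp
  \<comment> \<open>\<open>\<psi>\<close> has no free variables, so the empty set of pairs suffices
    and the assignment \<open>e'\<close> is arbitrary.\<close>
  then have "sat (order_struc LO_lim) \<psi> e'" for e'
    using bf_preserves(1)[OF bf_5_LO order_refl ne _ assms(2)] assms(3) by simp
  then have "models (order_struc LO_lim) \<phi>" using assms(4) by (simp add: models_def)
  then have "struc_iso (order_struc (LO 1)) (order_struc LO_lim)"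
    using assms(1) is_struc_order_struc[OF ne(2)] unfolding scott_sentence_def by blast
  then obtain a where "shuffle_model (to_nat ` LO_lim) (slt (order_struc LO_lim)) a"
    using struc_iso_LO_iff[OF is_struc_order_struc[OF ne(2)]] by auto
  then show False using shuffle_model_of_order_struc not_shuffle_model_LO_lim by blast
qed

lemma LO_Sigma_5_scott_sentence: "\<exists>\<phi>\<in>Sigma_in (fin_ord 5). scott_sentence (order_struc (LO 1)) \<phi>"
proof -
  obtain \<phi> where \<phi>: "is_Sigma (fin_ord 5) \<phi>" "fv \<phi> = {}" "\<And>M e. sat M \<phi> e \<longleftrightarrow>
      (\<forall>x\<in>fst M. (x, x) \<in> snd M) \<and> (\<exists>a\<in>fst M. shuffle_model (fst M) (slt M) a)"
    using sdef_shuffle_model unfolding sdef_def by auto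
  have "models N \<phi> \<longleftrightarrow> struc_iso (order_struc (LO 1)) N" if N: "is_struc N" for N
  proof -
    obtain c where "c \<in> fst N" using N by (auto simp: is_struc_def)
    then have "range (\<lambda>_. c) \<subseteq> fst N" by auto
    then show ?thesis unfolding models_def \<phi>(3) struc_iso_LO_iff[OF N] by blast
  qed
  then show ?thesis using \<phi>(1,2) by (auto simp: scott_sentence_def Sigma_in_def)
qed

theorem mainTheorem8:
  shows "\<exists>A r. A \<noteq> {} \<and> linear_order_on A r \<and>
    scott_sentence_complexity (A, r) (Sigma_in (fin_ord 5))"
proof (intro exI conjI)
  let ?L = "order_struc (LO 1)"
  have 5: "fin_ord 5 = fin_ord (Suc 4)" by simp
  have pos: "0 < fin_ord 5" unfolding 5 by (rule fin_ord_Suc_pos)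
  show "to_nat ` LO 1 \<noteq> {}" by (auto simp: LO_def)
  show "linear_order_on (to_nat ` LO 1) (snd ?L)" by (rule linear_order_on_order_struc)
  have "class_le (Sigma_in (fin_ord 5)) \<Delta>"
    if \<Delta>: "\<Delta> \<in> complexity_classes" and \<phi>: "\<phi> \<in> \<Delta>" "scott_sentence ?L \<phi>" for \<Delta> \<phi>
  proof -
    obtain \<alpha> where \<alpha>: "0 < \<alpha>" "\<Delta> = Pi_in \<alpha> \<or> \<Delta> = Sigma_in \<alpha> \<or> \<Delta> = dSigma_in \<alpha>"
      using \<Delta> by (auto simp: complexity_classes_def)
    have fv: "fv \<phi> = {}" using \<phi>(2) by (simp add: scott_sentence_def)
    \<comment> \<open>In each of these cases the sentence would have a \<open>\<Pi>\<^sub>5\<close>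
      equivalent; the remaining classes are all above \<open>\<Sigma>\<^sub>5\<close>.\<close>
    have "\<not> (\<phi> \<in> Pi_in \<alpha> \<and> \<alpha> \<le> fin_ord 5 \<or> \<phi> \<in> Sigma_in \<alpha> \<and> \<alpha> < fin_ord 5 \<or>
       \<phi> \<in> dSigma_in \<alpha> \<and> \<alpha> < fin_ord 5)"
      using ex_Pi_equivalent[OF \<alpha>(1) fv] LO_no_Pi_5_scott_sentence[OF \<phi>(2)] by metis
    then show ?thesis
      using \<alpha>(2) \<phi>(1) Sigma_in_class_le[OF pos, of \<alpha>] by (metis linorder_not_less)
  qed
  moreover have "Sigma_in (fin_ord 5) \<in> complexity_classes"
    unfolding complexity_classes_def using pos by blast
  ultimately have "scott_sentence_complexity ?L (Sigma_in (fin_ord 5))"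
    unfolding scott_sentence_complexity_def using LO_Sigma_5_scott_sentence by blast
  then show "scott_sentence_complexity (to_nat ` LO 1, snd ?L) (Sigma_in (fin_ord 5))"
    by (metis fst_order_struc prod.collapse)
qed

end
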